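(* Let $1\le p<2$. Suppose that the random vector $\xi=(\xi_w)_{w\in[W]}$ in $\mathbb{R}^W$ is bounded, that its distribution is log-concave, and that the output of the wind farm at each location $w$ is proportional to the number $x_w$ of turbines installed there, i.e. equals $x_w\xi_w$. Let $\Sigma$ be the covariance matrix of $\xi$, let $a=(a_w)_{w\in[W]}\in\mathbb{R}^W$, and consider the real random variable $\sum_w a_wx_w\xi_w$. Then for any decision $x$, any significance level $\beta\in(0,1)$ and a sufficiently large sample size $N$, there exists a radius $$\varepsilon'(x)=\sqrt{\frac{3(a\cdot x)^\top\widehat{\Sigma}(a\cdot x)}{N}}\,\log\left(\frac{C_1}{\beta}\right)+\left(\frac{C_2}{2-p}\right)^{1/p}\sqrt{\frac{(a\cdot x)^\top\widehat{\Sigma}(a\cdot x)}{N}}$$ such that $$\Pr\{W_p(\hat{\mathbb{P}}(x),\mathbb{P}(x))\ge\varepsilon'(x)\}\le\beta',$$ where $\widehat\Sigma$ is the sample covariance matrix, $$\beta'=\inf_{k\in(0,1)}\Big\{C_1\exp\Big[-k\log\Big(\frac{C_1}{\beta}\Big)+\frac{1-k}{\sqrt3}\Big(\frac{C_2}{2-p}\Big)^{1/p}\Big]+2\exp\big[-N\min\{C_3(1-k^2)^2((a\cdot x)^\top\Sigma(a\cdot x))^2,\;C_4(1-k^2)(a\cdot x)^\top\Sigma(a\cdot x)\}\big]\Big\},$$ and $C_1,C_2,C_3,C_4$ are positive constants. Here $\mathbb{P}(x)$ is the distribution of $\sum_w a_wx_w\xi_w$; $\hat{\mathbb{P}}(x)=\frac1N\sum_{i=1}^N\delta_{\sum_w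 a_wx_w\hat\xi_{wi}}$ and $\widehat\Sigma$ are the empirical distribution and the sample covariance matrix built from the same $N$ independent samples $\hat\xi_i=(\hat\xi_{wi})_{w\in[W]}$, $i\in[N]$, of $\xi$; the probability $\Pr$ is over these samples.
   Context: $[n]=\{1,\dots,n\}$. A decision $x=(x_w)_{w\in[W]}$ is a vector of non-negative integers, $x_w$ being the number of wind turbines installed at location $w$; $\xi_w$ is the random output of a single turbine at location $w$. $a\cdot x=(a_wx_w)_{w\in[W]}$ denotes the element-wise product. $\delta_u$ is the Dirac measure at $u$. The sample covariance matrix is $\widehat{\Sigma}=\frac1{N-1}\sum_{i=1}^N(\hat\xi_i-\bar\xi)(\hat\xi_i-\bar\xi)^\top$ with $\bar\xi=\frac1N\sum_{i=1}^N\hat\xi_i$. For distributions $\mathbb{P},\mathbb{Q}$ on $\mathbb{R}$, the $p$-Wasserstein distance $W_p$ is defined by $W_p^p(\mathbb{P},\mathbb{Q})=\inf_{\Pi}\mathbb{E}_{\Pi}[|\tilde\xi-\xi|^p]$, the infimum being over joint distributions $\Pi$ of $(\tilde\xi,\xi)$ on $\mathbb{R}\times\mathbb{R}$ with marginals $\mathbb{P}$ and $\mathbb{Q}$. *)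

theory Defs
  imports "HOL-Probability.Probability"
begin

text \<open>Log-concavity of a measure in the sense of Borell. Testing on compact sets suffices and keeps
  the Minkowski combination compact, hence measurable. No density is required, so degenerate
  distributions are included.\<close>

definition log_concave_measure :: "'a::euclidean_space measure \<Rightarrow> bool" where
  "log_concave_measure \<mu> \<longleftrightarrow> sets \<mu> = sets borel \<and>
     (\<forall>A B t. compact A \<and> compact B \<and> 0 < t \<and> t < 1 \<longrightarrow>
        measure \<mu> {(1 - t) *\<^sub>R u + t *\<^sub>R v |u v. u \<in> A \<and> v \<in> B}
          \<ge> measure \<mu> A powr (1 - t) * measure \<mu> B powr t)"

definition couplings :: "real measure \<Rightarrow> real measure \<Rightarrow> (real \<times> real) measure set" where
  "couplings P Q = {J. sets J = sets borel \<and> distr J borel fst = P \<and> distr J borel snd = Q}"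

text \<open>The infimum is taken in \<^typ>\<open>ennreal\<close>. An infinite distance would be mapped to \<open>0\<close> by
  \<^const>\<open>enn2real\<close>; this cannot happen for distributions with finite \<open>p\<close>-th moment.\<close>

definition wasserstein :: "real \<Rightarrow> real measure \<Rightarrow> real measure \<Rightarrow> real" where
  "wasserstein p P Q =
     enn2real (INF J\<in>couplings P Q. \<integral>\<^sup>+z. ennreal (\<bar>fst z - snd z\<bar> powr p) \<partial>J) powr (1 / p)"

definition empirical_distribution :: "nat \<Rightarrow> (nat \<Rightarrow> real) \<Rightarrow> real measure" where
  "empirical_distribution N y =
     measure_of UNIV (sets borel)
       (\<lambda>A. ennreal (1 / real N) * (\<Sum>i = 1..N. emeasure (return borel (y i)) A))"

lemma sets_empirical_distribution [simp, measurable_cong]: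
  "sets (empirical_distribution N y) = sets borel"
  unfolding empirical_distribution_def
  by (metis sets.sets_measure_of_eq space_borel)

lemma space_empirical_distribution [simp]: "space (empirical_distribution N y) = UNIV"
  unfolding empirical_distribution_def by (metis sets.space_measure_of_eq space_borel)

lemma emeasure_empirical_distribution:
  assumes "A \<in> sets borel"
  shows "emeasure (empirical_distribution N y) A =
           ennreal (1 / real N) * (\<Sum>i = 1..N. emeasure (return borel (y i)) A)"
proof (rule emeasure_measure_of[OF empirical_distribution_def])
  show "sets borel \<subseteq> Pow (UNIV :: real set)" by simp
  show "A \<in> sets (empirical_distribution N y)" using assms by simp
  show "positive (sets (empirical_distribution N y))
          (\<lambda>A. ennreal (1 / real N) * (\<Sum>i = 1..N. emeasure (return borel (y i)) A))"
    by (simp add: positive_def)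
  show "countably_additive (sets (empirical_distribution N y))
          (\<lambda>A. ennreal (1 / real N) * (\<Sum>i = 1..N. emeasure (return borel (y i)) A))"
  proof (rule countably_additiveI)
    fix F :: "nat \<Rightarrow> real set"
    assume F: "range F \<subseteq> sets (empirical_distribution N y)" "disjoint_family F"
    have "(\<Sum>n. ennreal (1 / real N) * (\<Sum>i = 1..N. emeasure (return borel (y i)) (F n)))
            = ennreal (1 / real N) * (\<Sum>i = 1..N. \<Sum>n. emeasure (return borel (y i)) (F n))"
      by (simp add: suminf_sum)
    also have "(\<Sum>i = 1..N. \<Sum>n. emeasure (return borel (y i)) (F n))
            = (\<Sum>i = 1..N. emeasure (return borel (y i)) (\<Union>n. F n))"
      using F by (intro sum.cong refl suminf_emeasure) auto
    finally show "(\<Sum>n. ennreal (1 / real N) * (\<Sum>i = 1..N. emeasure (return borel (y i)) (F n)))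
            = ennreal (1 / real N) * (\<Sum>i = 1..N. emeasure (return borel (y i)) (\<Union>n. F n))" .
  qed
qed

definition covariance_matrix :: "'s measure \<Rightarrow> ('s \<Rightarrow> real ^ 'w) \<Rightarrow> real ^ 'w ^ 'w" where
  "covariance_matrix M \<xi> =
     (\<chi> v w. \<integral>\<omega>. (\<xi> \<omega> $ v - (\<integral>\<omega>'. \<xi> \<omega>' $ v \<partial>M)) * (\<xi> \<omega> $ w - (\<integral>\<omega>'. \<xi> \<omega>' $ w \<partial>M)) \<partial>M)"

definition sample_mean :: "nat \<Rightarrow> (nat \<Rightarrow> real ^ 'w) \<Rightarrow> real ^ 'w" where
  "sample_mean N z = (1 / real N) *\<^sub>R (\<Sum>i = 1..N. z i)"

definition sample_covariance_matrix :: "nat \<Rightarrow> (nat \<Rightarrow> real ^ 'w) \<Rightarrow> real ^ 'w ^ 'w" where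
  "sample_covariance_matrix N z =
     (\<chi> v w. 1 / (real N - 1) *
        (\<Sum>i = 1..N. (z i $ v - sample_mean N z $ v) * (z i $ w - sample_mean N z $ w)))"

definition quad_form :: "real ^ 'w ^ 'w \<Rightarrow> real ^ 'w \<Rightarrow> real" where
  "quad_form S u = u \<bullet> (S *v u)"

definition iid_samples ::
    "'s measure \<Rightarrow> ('s \<Rightarrow> real ^ 'w) \<Rightarrow> nat \<Rightarrow> (nat \<Rightarrow> 's \<Rightarrow> real ^ 'w) \<Rightarrow> bool" where
  "iid_samples M \<xi> N \<xi>hat \<longleftrightarrow>
     prob_space.indep_vars M (\<lambda>_. borel) \<xi>hat {1..N} \<and>
     (\<forall>i\<in>{1..N}. distr M borel (\<xi>hat i) = distr M borel \<xi>)"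

definition weighted_decision :: "real ^ 'w \<Rightarrow> nat ^ 'w \<Rightarrow> real ^ 'w" where
  "weighted_decision a x = (\<chi> w. a $ w * real (x $ w))"

definition weighted_output :: "real ^ 'w \<Rightarrow> nat ^ 'w \<Rightarrow> real ^ 'w \<Rightarrow> real" where
  "weighted_output a x z = (\<Sum>w\<in>UNIV. a $ w * (real (x $ w) * z $ w))"

text \<open>In the next two definitions \<open>v\<close> stands for the value of the quadratic form at the weighted
  decision: of the sample covariance matrix for the radius, of the true one for the level.\<close>

definition radius :: "real \<Rightarrow> real \<Rightarrow> real \<Rightarrow> real \<Rightarrow> nat \<Rightarrow> real \<Rightarrow> real" where
  "radius C1 C2 p \<beta> N v =
     sqrt (3 * v / real N) * ln (C1 / \<beta>) + (C2 / (2 - p)) powr (1 / p) * sqrt (v / real N)"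

definition level ::
    "real \<Rightarrow> real \<Rightarrow> real \<Rightarrow> real \<Rightarrow> real \<Rightarrow> real \<Rightarrow> nat \<Rightarrow> real \<Rightarrow> real" where
  "level C1 C2 C3 C4 p \<beta> N v =
     (INF k\<in>{0<..<1}.
        C1 * exp (- k * ln (C1 / \<beta>) + (1 - k) / sqrt 3 * (C2 / (2 - p)) powr (1 / p))
        + 2 * exp (- real N * min (C3 * (1 - k\<^sup>2)\<^sup>2 * v\<^sup>2) (C4 * (1 - k\<^sup>2) * v)))"

end

theory Submission
  imports Defs
begin

text \<open>
  The level always exceeds \<open>\<beta>\<close>, and exceeds \<open>1\<close> when the variance vanishes, so it suffices to bound the
  probability by \<open>\<beta>\<close> for large \<open>N\<close> and a nondegenerate projection \<open>\<mu>\<close> of the law of \<open>\<xi>\<close>. Such a \<open>\<mu>\<close> is a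
  one-dimensional log-concave law with standard deviation \<open>\<sigma>\<close>, hence a \<open>12 \<sigma>\<close>-Lipschitz image of the logistic law:
  log-concavity of both tails together with Chebyshev's inequality bounds the slopes of \<open>ln F\<close> and \<open>ln (1 - F)\<close> away from zero.
  Therefore \<open>W\<^sub>p\<close> is at most \<open>12 \<sigma>\<close> times the logistic transport cost of the uniform sample \<open>F (X i)\<close>, and its \<open>p\<close>-th power is
  controlled by the integral of \<open>\<bar>G s - s\<bar> ^ p / (s (1 - s)) ^ p\<close>, where \<open>G\<close> is the empirical distribution function.

  For \<open>p < 2\<close> this integral is compared with a weighted quadratic functional of the empirical process. Along a dyadic
  grid the counts form a Markov chain with binomial transitions, so the normalised deviations are autoregressive and the
  quadratic functional has exponential moments with constants that do not depend on \<open>p\<close> or on \<open>\<mu>\<close>. Averaging over the offset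
  of the grid (Jensen) covers all \<open>s\<close>; the ends of the interval contribute little by Markov's inequality. The
  sample variance is at least \<open>\<sigma>\<^sup>2 / 4\<close> with probability tending to \<open>1\<close>, and taking \<open>C\<^sub>2\<close> large absorbs all constants.
\<close>

section \<open>Exponential moments of dyadic counts\<close>

text \<open>The radius grows only linearly in \<open>ln (C1 / \<beta>)\<close>, with
  \<open>C1\<close> and \<open>C2\<close> fixed before the law and before \<open>p\<close>. Second
  moments are too weak for this, so the quadratic functional needs an exponential tail. Its rate
  1/96 is universal; the price is a factor \<open>exp (1 / (2 - p))\<close>, which the summand
  \<open>(C2 / (2 - p)) powr (1 / p)\<close> of the radius pays for. The \<open>1 / (2 - p)\<close>
  comes from the dyadic blocks: block \<open>j\<close> carries the weight
  \<open>2^(-j (1 - p/2))\<close>, and these weights sum to at most \<open>4 / (2 - p)\<close>.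
  Polynomial bounds suffice for all other errors, since the threshold for \<open>N\<close> may
  depend on the law, on \<open>p\<close>, on the decision and on \<open>\<beta>\<close>: the number
  \<open>J\<close> of dyadic levels is fixed first, then \<open>N\<close> grows.
  \<open>C1 = 8\<close> is an error budget. The exponential tail is at most
  \<open>\<beta> / 8\<close> on each half of the unit interval, together \<open>\<beta> / 4\<close>;
  the ends of the interval and the terms that vanish with \<open>N\<close> get less than
  \<open>\<beta> / 4\<close> each.\<close>

lemma nn_integral_gaussian_exp:
  fixes s a :: real
  assumes a: "a < 1/2"
  shows "(\<integral>\<^sup>+ g. ennreal (std_normal_density g * exp (s * g + a * g\<^sup>2)) \<partial>lborel)
           = ennreal (exp (s\<^sup>2 / (2 * (1 - 2 * a))) / sqrt (1 - 2 * a))"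
proof -
  define r where "r = 1 - 2 * a"
  have r: "r > 0" using a by (simp add: r_def)
  define C where "C = exp (s\<^sup>2 / (2 * r)) / sqrt r"
  have C: "C \<ge> 0" using r by (simp add: C_def)
  have eq: "std_normal_density g * exp (s * g + a * g\<^sup>2) = C * normal_density (s / r) (1 / sqrt r) g" for g
  proof -
    have ee: "- (g\<^sup>2 / 2) + (s * g + a * g\<^sup>2) = s\<^sup>2 / (2 * r) - (g - s / r)\<^sup>2 / (2 * (1 / sqrt r)\<^sup>2)"
    proof -
      have "(1 / sqrt r)\<^sup>2 = 1 / r" using r by (simp add: power_divide)
      moreover have aa: "a = (1 - r) / 2" by (simp add: r_def)
      ultimately show ?thesis using r
        unfolding aa by (simp add: field_simps power2_eq_square)
    qed
    have "std_normal_density g * exp (s * g + a * g\<^sup>2)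
            = (1 / sqrt (2 * pi)) * exp (- (g\<^sup>2 / 2) + (s * g + a * g\<^sup>2))"
      by (simp only: std_normal_density_def exp_add) simp
    also have "\<dots> = (1 / sqrt (2 * pi)) * (exp (s\<^sup>2 / (2 * r)) * exp (- ((g - s / r)\<^sup>2 / (2 * (1 / sqrt r)\<^sup>2))))"
      unfolding ee by (simp only: diff_conv_add_uminus exp_add)
    also have "\<dots> = C * normal_density (s / r) (1 / sqrt r) g"
    proof -
      have "sqrt (2 * pi * (1 / sqrt r)\<^sup>2) = sqrt (2 * pi) / sqrt r"
        using r by (simp add: power_divide real_sqrt_divide)
      then show ?thesis using r by (simp add: C_def normal_density_def)
    qed
    finally show ?thesis .
  qed
  interpret N: prob_space "density lborel (normal_density (s / r) (1 / sqrt r))"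
    using r by (intro prob_space_normal_density) simp
  have "(\<integral>\<^sup>+ g. ennreal (normal_density (s / r) (1 / sqrt r) g) \<partial>lborel) = 1"
    using N.emeasure_space_1 by (simp add: emeasure_density)
  then have "(\<integral>\<^sup>+ g. ennreal (C * normal_density (s / r) (1 / sqrt r) g) \<partial>lborel) = ennreal C"
    using C by (simp add: ennreal_mult' nn_integral_cmult)
  then show ?thesis unfolding eq by (simp add: C_def r_def)
qed

text \<open>Hoeffding's lemma for a Bernoulli variable. \<open>Hoeffdings_lemma_aux\<close> yields
  the case \<open>0 \<le> h\<close>; exchanging success and failure reduces negative
  \<open>h\<close> to it.\<close>

lemma bernoulli_exp_le:
  fixes p h :: real
  assumes p: "0 \<le> p" "p \<le> 1"
  shows "1 - p + p * exp h \<le> exp (p * h + h\<^sup>2 / 8)"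
proof -
  have pos: "1 - q + q * exp k \<le> exp (q * k + k\<^sup>2 / 8)" if "0 \<le> k" "0 \<le> q" for q k :: real
  proof -
    have *: "0 \<le> q * (exp k - 1)" using that by simp
    then have "1 + q * (exp k - 1) = exp (ln (1 + q * (exp k - 1)))" by simp
    also have "\<dots> \<le> exp (q * k + k\<^sup>2 / 8)"
      using Hoeffdings_lemma_aux[OF that] by (simp add: mult.commute)
    finally show ?thesis by (simp add: algebra_simps)
  qed
  show ?thesis
  proof (cases "0 \<le> h")
    case True then show ?thesis using pos p by blast
  next
    case False
    have "1 - p + p * exp h = exp h * (1 - (1 - p) + (1 - p) * exp (- h))"
      by (simp add: algebra_simps flip: exp_add)
    also have "\<dots> \<le> exp h * exp ((1 - p) * (- h) + (- h)\<^sup>2 / 8)"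
      using pos[of "- h" "1 - p"] False p by (intro mult_left_mono) auto
    also have "\<dots> = exp (p * h + h\<^sup>2 / 8)" by (simp add: algebra_simps flip: exp_add)
    finally show ?thesis .
  qed
qed

text \<open>Turns the normalising factor of a Gaussian integral into a term of the exponent, so that
  the costs of successive levels simply add up.\<close>

lemma inverse_sqrt_le_exp:
  fixes x :: real
  assumes "0 \<le> x" "x \<le> 1/2"
  shows "1 / sqrt (1 - x) \<le> exp x"
proof -
  have "exp (- 2 * x) \<le> 1 - x"
  proof -
    have "1 + 2 * x \<le> exp (2 * x)" by simp
    then have "exp (- 2 * x) \<le> 1 / (1 + 2 * x)"
      using assms by (simp add: exp_minus field_simps)
    also have "\<dots> \<le> 1 - x" using assms mult_left_mono[of x "1/2" "2 * x"] by (simp add: field_simps)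
    finally show ?thesis .
  qed
  then have "sqrt (exp (- 2 * x)) \<le> sqrt (1 - x)" by simp
  moreover have "sqrt (exp (- 2 * x)) = exp (- x)"
    by (rule real_sqrt_unique) (simp_all flip: exp_double)
  ultimately have "exp (- x) \<le> sqrt (1 - x)" by argo
  then show ?thesis using assms by (simp add: exp_minus field_simps)
qed

text \<open>Conditioning on the truncated levels without conditional expectations: they take
  finitely many values, so the integral is a finite sum over configurations \<open>f\<close>. For
  each \<open>f\<close> independence factorises the product, and \<open>eq\<close> exchanges the
  factors index by index.\<close>

lemma (in prob_space) nn_integral_indep_vars_swap:
  fixes L :: "'i \<Rightarrow> 'a \<Rightarrow> nat" and g h :: "nat \<Rightarrow> ennreal" and \<Psi> :: "('i \<Rightarrow> nat) \<Rightarrow> ennreal"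
  assumes I: "finite I" and ind: "indep_vars (\<lambda>_. count_space UNIV) L I"
    and eq: "\<And>i l. i \<in> I \<Longrightarrow>
      (\<integral>\<^sup>+ \<omega>. indicator {l} (min (L i \<omega>) J) * g (L i \<omega>) \<partial>M)
        = (\<integral>\<^sup>+ \<omega>. indicator {l} (min (L i \<omega>) J) * h (L i \<omega>) \<partial>M)"
  shows "(\<integral>\<^sup>+ \<omega>. \<Psi> (\<lambda>i\<in>I. min (L i \<omega>) J) * (\<Prod>i\<in>I. g (L i \<omega>)) \<partial>M)
       = (\<integral>\<^sup>+ \<omega>. \<Psi> (\<lambda>i\<in>I. min (L i \<omega>) J) * (\<Prod>i\<in>I. h (L i \<omega>)) \<partial>M)"
proof -
  have L [measurable]: "L i \<in> measurable M (count_space UNIV)" if "i \<in> I" for i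
    using ind that unfolding indep_vars_def by auto
  define F where "F = PiE I (\<lambda>_. {..J})"
  have finF: "finite F" unfolding F_def using I by (intro finite_PiE) auto
  let ?p = "\<lambda>f (k :: nat \<Rightarrow> ennreal) i \<omega>. indicator {f i} (min (L i \<omega>) J) * k (L i \<omega>)"
  have expand: "\<Psi> (\<lambda>i\<in>I. min (L i \<omega>) J) * (\<Prod>i\<in>I. k (L i \<omega>))
      = (\<Sum>f\<in>F. \<Psi> f * (\<Prod>i\<in>I. ?p f k i \<omega>))"
    for k :: "nat \<Rightarrow> ennreal" and \<omega>
  proof -
    define f0 where "f0 = (\<lambda>i\<in>I. min (L i \<omega>) J)"
    have f0: "f0 \<in> F" by (auto simp: f0_def F_def)
    have "(\<Sum>f\<in>F. \<Psi> f * (\<Prod>i\<in>I. ?p f k i \<omega>))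
        = (\<Sum>f\<in>F. if f = f0 then \<Psi> f0 * (\<Prod>i\<in>I. k (L i \<omega>)) else 0)"
    proof (intro sum.cong refl)
      fix f assume f: "f \<in> F"
      show "\<Psi> f * (\<Prod>i\<in>I. ?p f k i \<omega>)
          = (if f = f0 then \<Psi> f0 * (\<Prod>i\<in>I. k (L i \<omega>)) else 0)"
      proof (cases "f = f0")
        case True
        have "(\<Prod>i\<in>I. indicator {f0 i} (min (L i \<omega>) J) * k (L i \<omega>)) = (\<Prod>i\<in>I. k (L i \<omega>))"
          by (intro prod.cong) (auto simp: f0_def)
        then show ?thesis using True by simp
      next
        case False
        have "\<exists>i\<in>I. f i \<noteq> f0 i"
          using False f f0 unfolding F_def by (metis PiE_ext)
        then obtain i where "i \<in> I" "f i \<noteq> min (L i \<omega>) J" by (auto simp: f0_def)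
        then have "(\<Prod>i\<in>I. ?p f k i \<omega>) = 0"
          using I by (intro prod_zero) (auto intro!: bexI[of _ i])
        then show ?thesis using False by simp
      qed
    qed
    also have "\<dots> = \<Psi> f0 * (\<Prod>i\<in>I. k (L i \<omega>))" using finF f0 by simp
    finally show ?thesis by (simp add: f0_def)
  qed
  have one: "(\<integral>\<^sup>+ \<omega>. \<Psi> (\<lambda>i\<in>I. min (L i \<omega>) J) * (\<Prod>i\<in>I. k (L i \<omega>)) \<partial>M)
      = (\<Sum>f\<in>F. \<Psi> f * (\<Prod>i\<in>I. \<integral>\<^sup>+ \<omega>. ?p f k i \<omega> \<partial>M))"
    for k :: "nat \<Rightarrow> ennreal"
  proof -
    have m: "(\<lambda>\<omega>. ?p f k i \<omega>) \<in> borel_measurable M" if "i \<in> I"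
      for f :: "'i \<Rightarrow> nat" and i
      by (rule measurable_compose[OF L[OF that]]) simp
    have "indep_vars (\<lambda>_. borel) (\<lambda>i \<omega>. ?p f k i \<omega>) I"
      for f :: "'i \<Rightarrow> nat"
      by (rule indep_vars_compose2[OF ind, of "\<lambda>i n. indicator {f i} (min n J) * k n"]) simp
    then have prod_eq: "(\<integral>\<^sup>+ \<omega>. (\<Prod>i\<in>I. ?p f k i \<omega>) \<partial>M)
      = (\<Prod>i\<in>I. \<integral>\<^sup>+ \<omega>. ?p f k i \<omega> \<partial>M)" for f :: "'i \<Rightarrow> nat"
      by (intro indep_vars_nn_integral[OF I]) auto
    have pm: "(\<lambda>\<omega>. \<Prod>i\<in>I. ?p f k i \<omega>) \<in> borel_measurable M"
      for f :: "'i \<Rightarrow> nat" using m by (intro borel_measurable_prod_ennreal)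
    have "(\<integral>\<^sup>+ \<omega>. \<Psi> (\<lambda>i\<in>I. min (L i \<omega>) J) * (\<Prod>i\<in>I. k (L i \<omega>)) \<partial>M)
      = (\<Sum>f\<in>F. \<integral>\<^sup>+ \<omega>. \<Psi> f * (\<Prod>i\<in>I. ?p f k i \<omega>) \<partial>M)"
      unfolding expand by (intro nn_integral_sum borel_measurable_times_ennreal pm) simp
    also have "\<dots> = (\<Sum>f\<in>F. \<Psi> f * (\<Prod>i\<in>I. \<integral>\<^sup>+ \<omega>. ?p f k i \<omega> \<partial>M))"
      unfolding prod_eq[symmetric] by (intro sum.cong refl nn_integral_cmult pm)
    finally show ?thesis .
  qed
  show ?thesis
    unfolding one by (intro sum.cong refl arg_cong2[where f="(*)"] prod.cong eq) auto
qed

text \<open>\<open>L i\<close> is the depth of sample \<open>i\<close> in a decreasing chain of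
  events with probabilities \<open>q j\<close>. The upper bound on the ratio of consecutive
  probabilities makes the recursion contract; the lower bound leaves room for a grid offset between
  1/2 and 1 in the first step.\<close>

locale dyadic_levels = prob_space +
  fixes I :: "'i set" and L :: "'i \<Rightarrow> 'a \<Rightarrow> nat" and q :: "nat \<Rightarrow> real" and K :: nat
  assumes fin: "finite I" "I \<noteq> {}"
    and ind: "indep_vars (\<lambda>_. count_space UNIV) L I"
    and prob_level: "\<And>i j. i \<in> I \<Longrightarrow> j \<le> K \<Longrightarrow> prob {\<omega>\<in>space M. j \<le> L i \<omega>} = q j"
    and q_pos: "\<And>j. 0 < q j"
    and q_step: "\<And>j. q j / 4 \<le> q (Suc j)" "\<And>j. q (Suc j) \<le> q j / 2"
begin

abbreviation levels :: "'a \<Rightarrow> 'i \<Rightarrow> nat" where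
  "levels \<omega> \<equiv> \<lambda>i. L i \<omega>"

abbreviation truncated :: "nat \<Rightarrow> 'a \<Rightarrow> 'i \<Rightarrow> nat" where
  "truncated J \<omega> \<equiv> \<lambda>i\<in>I. min (L i \<omega>) J"

definition count :: "nat \<Rightarrow> ('i \<Rightarrow> nat) \<Rightarrow> real" where
  "count j f = real (card {i\<in>I. j \<le> f i})"

text \<open>The normalisation is by \<open>n q\<close>, not by the binomial variance
  \<open>n q (1 - q)\<close>: the conditional mean of the next deviation is then exactly
  \<open>sqrt \<rho>\<close> times the present one.\<close>

definition dev :: "nat \<Rightarrow> ('i \<Rightarrow> nat) \<Rightarrow> real" where
  "dev j f = (count j f - real (card I) * q j) / sqrt (real (card I) * q j)"

lemma L_measurable [measurable]: "i \<in> I \<Longrightarrow> L i \<in> measurable M (count_space UNIV)"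
  using ind unfolding indep_vars_def by auto

text \<open>A finite product of countable discrete spaces is discrete, so every function of the
  restricted level vector is measurable.\<close>

lemma levels_measurable: "(\<lambda>\<omega>. (\<Phi> :: ('i \<Rightarrow> nat) \<Rightarrow> ennreal) (\<lambda>i\<in>I. L i \<omega>)) \<in> borel_measurable M"
proof -
  have "(\<lambda>\<omega>. \<lambda>i\<in>I. L i \<omega>) \<in> measurable M (PiM I (\<lambda>_. count_space UNIV))"
    by measurable
  then have 1: "(\<lambda>\<omega>. \<lambda>i\<in>I. L i \<omega>) \<in> measurable M (count_space (PiE I (\<lambda>_. UNIV)))"
    using fin by (subst (asm) count_space_PiM_finite) auto
  have 2: "\<Phi> \<in> measurable (count_space (PiE I (\<lambda>_. UNIV))) borel" by simp
  show ?thesis using measurable_compose[OF 1 2] .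
qed

lemma levels_min_measurable:
  "(\<lambda>\<omega>. (\<Phi> :: ('i \<Rightarrow> nat) \<Rightarrow> ennreal) (truncated J \<omega>)) \<in> borel_measurable M"
proof -
  have "(\<lambda>i\<in>I. min ((\<lambda>i\<in>I. L i \<omega>) i) J) = (truncated J \<omega>)" for \<omega> by auto
  with levels_measurable[of "\<lambda>f. \<Phi> (\<lambda>i\<in>I. min (f i) J)"] show ?thesis by simp
qed

lemma count_nonneg: "0 \<le> count j f" by (simp add: count_def)

lemma card_pos: "0 < real (card I)" using fin by (simp add: card_gt_0_iff)

lemma count_restrict [simp]: "count j (restrict f I) = count j f"
  unfolding count_def by (metis (mono_tags, lifting) Collect_cong restrict_apply')

lemma count_min: "j \<le> J \<Longrightarrow> count j (\<lambda>i. min (f i) J) = count j f"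
  unfolding count_def by simp

lemma dev_restrict [simp]: "dev j (restrict f I) = dev j f" by (simp add: dev_def)

lemma dev_min: "j \<le> J \<Longrightarrow> dev j (\<lambda>i. min (f i) J) = dev j f" by (simp add: dev_def count_min)

lemma prod_count: "(\<Prod>i\<in>I. if j \<le> f i then c else 1) = c ^ card {i\<in>I. j \<le> f i}" for c :: ennreal
  using fin by (simp add: prod.If_cases Int_def conj_commute)

text \<open>Once depth \<open>J\<close> is reached, depth \<open>Suc J\<close> is reached with
  probability \<open>q (Suc J) / q J\<close>. If \<open>l < J\<close>, both weights equal 1 on the
  event \<open>min (L i \<omega>) J = l\<close>; if \<open>l > J\<close>, that event is
  empty.\<close>

lemma swap_one:
  assumes J: "Suc J \<le> K" and i: "i \<in> I" and c: "0 \<le> c"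
  shows "(\<integral>\<^sup>+ \<omega>. indicator {l} (min (L i \<omega>) J) * (if Suc J \<le> L i \<omega> then ennreal c else 1) \<partial>M)
    = (\<integral>\<^sup>+ \<omega>. indicator {l} (min (L i \<omega>) J) *
        (if J \<le> L i \<omega> then ennreal (1 - q (Suc J) / q J + q (Suc J) / q J * c) else 1) \<partial>M)"
proof (cases "l = J")
  case False
  then show ?thesis
    by (intro nn_integral_cong) (auto simp: indicator_def min_def split: if_splits)
next
  case True
  define A where "A k = {\<omega>\<in>space M. k \<le> L i \<omega>}" for k
  have A [measurable]: "A k \<in> sets M" for k unfolding A_def using i by measurable
  let ?r = "1 - q (Suc J) / q J + q (Suc J) / q J * c"
  have eA: "emeasure M (A k) = ennreal (q k)" if "k \<le> Suc J" for k
    using prob_level[OF i, of k] that J by (simp add: A_def emeasure_eq_measure)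
  have sub: "A (Suc J) \<subseteq> A J" by (auto simp: A_def)
  have dif: "emeasure M (A J - A (Suc J)) = ennreal (q J - q (Suc J))"
    using sub by (simp add: emeasure_Diff eA ennreal_minus less_imp_le[OF q_pos])
  have "(\<integral>\<^sup>+ \<omega>. indicator {l} (min (L i \<omega>) J) * (if Suc J \<le> L i \<omega> then ennreal c else 1) \<partial>M)
     = (\<integral>\<^sup>+ \<omega>. ennreal c * indicator (A (Suc J)) \<omega> + indicator (A J - A (Suc J)) \<omega> \<partial>M)"
    by (intro nn_integral_cong) (auto simp: indicator_def A_def True min_def split: if_splits)
  also have "\<dots> = ennreal c * ennreal (q (Suc J)) + ennreal (q J - q (Suc J))"
    by (subst nn_integral_add) (auto simp: nn_integral_cmult eA dif)
  also have "\<dots> = ennreal (c * q (Suc J) + (q J - q (Suc J)))"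
    using c q_pos[of "Suc J"] q_step(2)[of J] q_pos[of J]
    by (simp add: ennreal_mult'' ennreal_plus)
  also have "c * q (Suc J) + (q J - q (Suc J)) = ?r * q J"
    using q_pos[of J] by (simp add: field_simps)
  also have "ennreal \<dots> = ennreal ?r * ennreal (q J)"
    by (simp add: ennreal_mult'' less_imp_le[OF q_pos])
  also have "\<dots> = (\<integral>\<^sup>+ \<omega>. ennreal ?r * indicator (A J) \<omega> \<partial>M)"
    by (simp add: nn_integral_cmult eA)
  also have "\<dots> = (\<integral>\<^sup>+ \<omega>. indicator {l} (min (L i \<omega>) J) *
        (if J \<le> L i \<omega> then ennreal ?r else 1) \<partial>M)"
    by (intro nn_integral_cong) (auto simp: indicator_def A_def True min_def split: if_splits)
  finally show ?thesis .
qed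

text \<open>Given the levels up to \<open>J\<close>, the next count is binomial.\<close>

lemma next_level_mgf:
  fixes \<theta> :: real
  assumes J: "Suc J \<le> K"
  shows "(\<integral>\<^sup>+ \<omega>. \<Psi> (truncated J \<omega>) * ennreal (exp (\<theta> * count (Suc J) (levels \<omega>))) \<partial>M)
    \<le> (\<integral>\<^sup>+ \<omega>. \<Psi> (truncated J \<omega>) *
          ennreal (exp ((q (Suc J) / q J * \<theta> + \<theta>\<^sup>2 / 8) * count J (levels \<omega>))) \<partial>M)"
proof -
  define \<rho> where "\<rho> = q (Suc J) / q J"
  have \<rho>: "0 \<le> \<rho>" "\<rho> \<le> 1"
    using q_pos[of J] q_pos[of "Suc J"] q_step(2)[of J] by (auto simp: \<rho>_def field_simps)
  have bp: "0 \<le> 1 - \<rho> + \<rho> * exp \<theta>" using \<rho> by simp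
  have e: "ennreal (exp (\<theta> * count (Suc J) f)) = (\<Prod>i\<in>I. if Suc J \<le> f i then ennreal (exp \<theta>) else 1)" for f
    unfolding prod_count count_def by (simp add: ennreal_power exp_of_nat2_mult)
  have "(\<integral>\<^sup>+ \<omega>. \<Psi> (truncated J \<omega>) * ennreal (exp (\<theta> * count (Suc J) (levels \<omega>))) \<partial>M)
    = (\<integral>\<^sup>+ \<omega>. \<Psi> (truncated J \<omega>) *
        (\<Prod>i\<in>I. if J \<le> L i \<omega> then ennreal (1 - \<rho> + \<rho> * exp \<theta>) else 1) \<partial>M)"
    unfolding e
    by (rule nn_integral_indep_vars_swap[OF fin(1) ind, of J "\<lambda>k. if Suc J \<le> k then ennreal (exp \<theta>) else 1"
          "\<lambda>k. if J \<le> k then ennreal (1 - \<rho> + \<rho> * exp \<theta>) else 1"])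
       (unfold \<rho>_def, rule swap_one[OF J], auto)
  also have "\<dots> \<le> (\<integral>\<^sup>+ \<omega>. \<Psi> (truncated J \<omega>) *
          ennreal (exp ((\<rho> * \<theta> + \<theta>\<^sup>2 / 8) * count J (levels \<omega>))) \<partial>M)"
  proof (intro nn_integral_mono mult_left_mono)
    fix \<omega>
    show "(\<Prod>i\<in>I. if J \<le> L i \<omega> then ennreal (1 - \<rho> + \<rho> * exp \<theta>) else 1)
        \<le> ennreal (exp ((\<rho> * \<theta> + \<theta>\<^sup>2 / 8) * count J (levels \<omega>)))"
      unfolding prod_count count_def exp_of_nat2_mult ennreal_power[OF bp]
      by (intro ennreal_leI power_mono bernoulli_exp_le \<rho> bp)
  qed simp
  finally show ?thesis by (simp add: \<rho>_def)
qed

text \<open>Squares in the exponent are linearised by a Gaussian integral, which reduces them to the moment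
  generating function above.\<close>

lemma next_level_exp_square:
  fixes b :: real
  assumes J: "Suc J \<le> K" and b: "0 \<le> b" "b \<le> 1/32"
    and \<Psi>: "\<And>f. 4 * real (card I) * q J < count J f \<Longrightarrow> \<Psi> f = 0"
  shows "(\<integral>\<^sup>+ \<omega>. \<Psi> (truncated J \<omega>) * ennreal (exp (b * (dev (Suc J) (levels \<omega>))\<^sup>2)) \<partial>M)
    \<le> ennreal (exp (8 * b)) *
       (\<integral>\<^sup>+ \<omega>. \<Psi> (truncated J \<omega>) * ennreal (exp (2 / 3 * b * (dev J (levels \<omega>))\<^sup>2)) \<partial>M)"
proof -
  define n where "n = real (card I)"
  have n: "0 < n" using card_pos by (simp add: n_def)
  define \<rho> where "\<rho> = q (Suc J) / q J"
  have \<rho>: "1/4 \<le> \<rho>" "\<rho> \<le> 1/2" "q J = q (Suc J) / \<rho>" 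
    using q_pos[of J] q_pos[of "Suc J"] q_step[of J] by (auto simp: \<rho>_def field_simps)
  define Q where "Q = n * q (Suc J)"
  have Q: "0 < Q" using n q_pos by (simp add: Q_def)
  have QJ: "n * q J = Q / \<rho>" using \<rho> by (simp add: Q_def)
  \<comment> \<open>\<open>g\<close> will be a standard Gaussian variable:
    \<open>exp (b d^2)\<close> is the mean of \<open>exp (sqrt (2 b) d g)\<close>, and
    \<open>\<theta> g\<close> is the resulting coefficient of the count at level
    \<open>Suc J\<close>.\<close>
  define \<theta> where "\<theta> g = sqrt (2 * b) * g / sqrt Q" for g
  define P where "P \<omega> = \<Psi> (truncated J \<omega>)" for \<omega>
  have P [measurable]: "P \<in> borel_measurable M" unfolding P_def by (rule levels_min_measurable)
  define X where "X j \<omega> = count j (levels \<omega>)" for j \<omega>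
  have [measurable]: "X j \<in> borel_measurable M" for j
  proof -
    have "X j = (\<lambda>\<omega>. enn2real (ennreal (count j (\<lambda>i\<in>I. L i \<omega>))))"
      by (simp add: X_def fun_eq_iff count_nonneg)
    then show ?thesis using levels_measurable[of "\<lambda>f. ennreal (count j f)"] by simp
  qed
  interpret lb: pair_sigma_finite M "lborel :: real measure"
    by (intro pair_sigma_finite.intro sigma_finite_measure_axioms sigma_finite_lborel)
  let ?d = "\<lambda>j \<omega>. (dev j (levels \<omega>))\<^sup>2"
  let ?N = "std_normal_density"
  let ?\<phi> = "\<lambda>g. ennreal (?N g * exp (- \<theta> g * Q))"
  let ?E = "\<lambda>g \<omega>. ennreal (exp ((\<rho> * \<theta> g + (\<theta> g)\<^sup>2 / 8) * X J \<omega>))"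
  let ?F = "\<lambda>g \<omega>. ennreal (exp (\<theta> g * X (Suc J) \<omega>))"
  have pull: "(\<integral>\<^sup>+ \<omega>. P \<omega> * (c * ennreal (exp (t * X j \<omega>))) \<partial>M)
      = c * (\<integral>\<^sup>+ \<omega>. P \<omega> * ennreal (exp (t * X j \<omega>)) \<partial>M)" for c t j
    by (subst mult.left_commute, rule nn_integral_cmult) measurable
  have lin: "ennreal (exp (b * ?d (Suc J) \<omega>))
      = (\<integral>\<^sup>+ g. ?\<phi> g * ?F g \<omega> \<partial>lborel)"
    for \<omega>
  proof -
    define d where "d = dev (Suc J) (levels \<omega>)"
    have "d = (X (Suc J) \<omega> - Q) / sqrt Q" by (simp add: d_def dev_def X_def Q_def n_def)
    then have dd: "sqrt Q * d = X (Suc J) \<omega> - Q" using Q by simp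
    have e: "?N g * exp (- \<theta> g * Q) * exp (\<theta> g * X (Suc J) \<omega>)
        = ?N g * exp (sqrt (2 * b) * d * g + 0 * g\<^sup>2)" for g
    proof -
      have "- \<theta> g * Q + \<theta> g * X (Suc J) \<omega> = \<theta> g * (sqrt Q * d)" unfolding dd by (simp add: algebra_simps)
      also have "\<dots> = sqrt (2 * b) * d * g" using Q by (simp add: \<theta>_def)
      finally show ?thesis by (simp add: mult.assoc flip: exp_add)
    qed
    have "(\<integral>\<^sup>+ g. ?\<phi> g * ?F g \<omega> \<partial>lborel)
        = (\<integral>\<^sup>+ g. ennreal (?N g * exp (sqrt (2 * b) * d * g + 0 * g\<^sup>2)) \<partial>lborel)"
      unfolding e[symmetric] by (intro nn_integral_cong ennreal_mult'[symmetric]) simp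
    then show ?thesis using nn_integral_gaussian_exp[of 0 "sqrt (2 * b) * d"] b
      by (simp add: power_mult_distrib d_def)
  qed
  have "(\<integral>\<^sup>+ \<omega>. P \<omega> * ennreal (exp (b * ?d (Suc J) \<omega>)) \<partial>M)
     = (\<integral>\<^sup>+ \<omega>. \<integral>\<^sup>+ g. P \<omega> * (?\<phi> g * ?F g \<omega>) \<partial>lborel \<partial>M)"
    unfolding lin \<theta>_def by (subst nn_integral_cmult) auto
  also have "\<dots> = (\<integral>\<^sup>+ g. \<integral>\<^sup>+ \<omega>. P \<omega> * (?\<phi> g * ?F g \<omega>) \<partial>M \<partial>lborel)"
    unfolding \<theta>_def by (rule lb.Fubini'[symmetric]) measurable
  also have "\<dots> = (\<integral>\<^sup>+ g. ?\<phi> g * (\<integral>\<^sup>+ \<omega>. P \<omega> * ?F g \<omega> \<partial>M) \<partial>lborel)"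
    by (simp only: pull)
  also have "\<dots> \<le> (\<integral>\<^sup>+ g. ?\<phi> g * (\<integral>\<^sup>+ \<omega>. P \<omega> * ?E g \<omega> \<partial>M) \<partial>lborel)"
    unfolding P_def X_def \<rho>_def by (intro nn_integral_mono mult_left_mono next_level_mgf[OF J]) simp
  also have "\<dots> = (\<integral>\<^sup>+ g. \<integral>\<^sup>+ \<omega>. P \<omega> * (?\<phi> g * ?E g \<omega>) \<partial>M \<partial>lborel)"
    by (simp only: pull)
  also have "\<dots> = (\<integral>\<^sup>+ \<omega>. \<integral>\<^sup>+ g. P \<omega> * (?\<phi> g * ?E g \<omega>) \<partial>lborel \<partial>M)"
    unfolding \<theta>_def by (rule lb.Fubini') measurable
  also have "\<dots> = (\<integral>\<^sup>+ \<omega>. P \<omega> * (\<integral>\<^sup>+ g. ?\<phi> g * ?E g \<omega> \<partial>lborel) \<partial>M)"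
    unfolding \<theta>_def by (subst nn_integral_cmult) auto
  \<comment> \<open>Above the cap \<open>4 n q J\<close> the weight \<open>P\<close> vanishes. Below
    it, the quadratic Hoeffding term is at most \<open>4 b g^2\<close> because
    \<open>1 / \<rho> \<le> 4\<close>, and the Gaussian integral still converges since
    \<open>8 b < 1\<close>.\<close>
  also have "\<dots> \<le> (\<integral>\<^sup>+ \<omega>. P \<omega> * (ennreal (exp (8 * b)) * ennreal (exp (2 / 3 * b * ?d J \<omega>))) \<partial>M)"
  proof (intro nn_integral_mono)
    fix \<omega>
    show "P \<omega> * (\<integral>\<^sup>+ g. ?\<phi> g * ?E g \<omega> \<partial>lborel)
      \<le> P \<omega> * (ennreal (exp (8 * b)) * ennreal (exp (2 / 3 * b * ?d J \<omega>)))"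
    proof (cases "4 * n * q J < X J \<omega>")
      case True
      then have "P \<omega> = 0" unfolding P_def by (intro \<Psi>) (simp add: X_def n_def count_min)
      then show ?thesis by simp
    next
      case False
      then have XJ: "X J \<omega> \<le> 4 * (Q / \<rho>)" using QJ by simp
      define d where "d = dev J (levels \<omega>)"
      have "d = (X J \<omega> - Q / \<rho>) / sqrt (Q / \<rho>)"
        unfolding QJ[symmetric] by (simp add: d_def dev_def X_def n_def)
      then have dd: "sqrt (Q / \<rho>) * d = X J \<omega> - Q / \<rho>" using Q \<rho> by simp
      have "(\<integral>\<^sup>+ g. ?\<phi> g * ?E g \<omega> \<partial>lborel)
         \<le> (\<integral>\<^sup>+ g. ennreal (?N g * exp (sqrt (2 * b * \<rho>) * d * g + (4 * b) * g\<^sup>2)) \<partial>lborel)"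
      proof (intro nn_integral_mono)
        fix g
        have s: "(\<theta> g)\<^sup>2 = 2 * b * g\<^sup>2 / Q"
          using b Q by (simp add: \<theta>_def power_mult_distrib power_divide)
        have t1: "(\<theta> g)\<^sup>2 / 8 * X J \<omega> \<le> 4 * b * g\<^sup>2"
        proof -
          have "(\<theta> g)\<^sup>2 / 8 * X J \<omega> \<le> (\<theta> g)\<^sup>2 / 8 * (4 * (Q / \<rho>))" by (intro mult_left_mono XJ) simp
          also have "\<dots> = b * g\<^sup>2 * (1 / \<rho>)" using Q unfolding s by (simp add: field_simps)
          also have "\<dots> \<le> b * g\<^sup>2 * 4" using b \<rho> by (intro mult_left_mono) (auto simp: field_simps)
          finally show ?thesis by simp
        qed
        have t2: "\<rho> * \<theta> g * X J \<omega> - \<theta> g * Q = sqrt (2 * b * \<rho>) * d * g"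
        proof -
          have "\<rho> * \<theta> g * X J \<omega> - \<theta> g * Q = \<rho> * \<theta> g * (X J \<omega> - Q / \<rho>)"
            using \<rho> by (simp add: field_simps)
          also have "\<dots> = \<rho> * (sqrt (2 * b) * g / sqrt Q) * (sqrt Q / sqrt \<rho> * d)"
            unfolding dd[symmetric] \<theta>_def by (simp add: real_sqrt_divide)
          also have "\<dots> = (\<rho> / sqrt \<rho>) * sqrt (2 * b) * g * d" using Q by simp
          also have "\<rho> / sqrt \<rho> = sqrt \<rho>" using \<rho> by (simp add: real_div_sqrt)
          finally show ?thesis by (simp add: real_sqrt_mult)
        qed
        have "- \<theta> g * Q + (\<rho> * \<theta> g + (\<theta> g)\<^sup>2 / 8) * X J \<omega> \<le> sqrt (2 * b * \<rho>) * d * g + (4 * b) * g\<^sup>2"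
          using t1 t2 by (simp add: algebra_simps)
        then have "?N g * (exp (- \<theta> g * Q) * exp ((\<rho> * \<theta> g + (\<theta> g)\<^sup>2 / 8) * X J \<omega>))
           \<le> ?N g * exp (sqrt (2 * b * \<rho>) * d * g + (4 * b) * g\<^sup>2)"
          unfolding exp_add[symmetric] by (intro mult_left_mono) auto
        then show "?\<phi> g * ?E g \<omega>
          \<le> ennreal (?N g * exp (sqrt (2 * b * \<rho>) * d * g + (4 * b) * g\<^sup>2))"
          by (simp add: ennreal_leI mult.assoc flip: ennreal_mult')
      qed
      also have "\<dots> = ennreal (exp ((sqrt (2 * b * \<rho>) * d)\<^sup>2 / (2 * (1 - 2 * (4 * b)))) / sqrt (1 - 2 * (4 * b)))"
        using b by (intro nn_integral_gaussian_exp) simp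
      also have "\<dots> \<le> ennreal (exp (8 * b) * exp (2 / 3 * b * d\<^sup>2))"
      proof (intro ennreal_leI)
        have "(sqrt (2 * b * \<rho>) * d)\<^sup>2 / (2 * (1 - 2 * (4 * b))) = b * d\<^sup>2 * (\<rho> / (1 - 8 * b))"
          using b \<rho> by (simp add: power_mult_distrib field_simps)
        \<comment> \<open>\<open>\<rho> \<le> 1/2\<close> and \<open>1 - 8 b \<ge> 3/4\<close> give
          the contraction factor 2/3; this is the origin of the bound 1/32 on
          \<open>b\<close>.\<close>
        also have "\<dots> \<le> b * d\<^sup>2 * (2 / 3)"
          using b \<rho> by (intro mult_left_mono) (auto simp: field_simps)
        finally have e1: "exp ((sqrt (2 * b * \<rho>) * d)\<^sup>2 / (2 * (1 - 2 * (4 * b)))) \<le> exp (2 / 3 * b * d\<^sup>2)"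
          by simp
        have e2: "1 / sqrt (1 - 2 * (4 * b)) \<le> exp (8 * b)"
          using inverse_sqrt_le_exp[of "8 * b"] b by simp
        show "exp ((sqrt (2 * b * \<rho>) * d)\<^sup>2 / (2 * (1 - 2 * (4 * b)))) / sqrt (1 - 2 * (4 * b))
            \<le> exp (8 * b) * exp (2 / 3 * b * d\<^sup>2)"
          using mult_mono[OF e2 e1] b by (simp add: field_simps)
      qed
      finally show ?thesis
        by (intro mult_left_mono) (simp_all add: d_def ennreal_mult')
    qed
  qed
  also have "\<dots> = ennreal (exp (8 * b)) * (\<integral>\<^sup>+ \<omega>. P \<omega> * ennreal (exp (2 / 3 * b * ?d J \<omega>)) \<partial>M)"
  proof -
    have "(\<lambda>\<omega>. P \<omega> * ennreal (exp (2 / 3 * b * ?d J \<omega>))) \<in> borel_measurable M"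
      unfolding dev_def using P by (fold X_def) measurable
    then show ?thesis by (subst mult.left_commute) (rule nn_integral_cmult)
  qed
  finally show ?thesis by (simp add: P_def)
qed

text \<open>Writing \<open>\<rho> = q (Suc j) / q j\<close>, the next deviation is \<open>sqrt \<rho> * dev j\<close> plus sub-Gaussian noise.
  Since \<open>\<rho> \<le> 1/2\<close>, eliminating the top level passes at most two thirds of its coefficient on to the level
  below; \<open>c\<close> carries that contribution.\<close>

lemma exp_weighted_deviation_le:
  fixes w :: "nat \<Rightarrow> real" and \<kappa> c :: real
  assumes J: "J \<le> K" and q0: "q 0 = 1" and w: "antimono w" "\<And>j. 0 \<le> w j" "\<And>j. w j \<le> 1"
    and \<kappa>: "0 \<le> \<kappa>" "\<kappa> \<le> 1/96" and c: "0 \<le> c" "c \<le> 2 * \<kappa> * w J"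
  shows "(\<integral>\<^sup>+ \<omega>. indicator {f. \<forall>j\<le>J. count j f \<le> 4 * real (card I) * q j} (levels \<omega>) *
       ennreal (exp (\<kappa> * (\<Sum>j=1..J. w j * (dev j (levels \<omega>))\<^sup>2) + c * (dev J (levels \<omega>))\<^sup>2)) \<partial>M)
     \<le> ennreal (exp (24 * \<kappa> * (\<Sum>j=1..J. w j)))"
  using J c
proof (induction J arbitrary: c)
  case 0
  \<comment> \<open>With \<open>q 0 = 1\<close> every sample is counted at level 0, so the recursion
    ends without a remainder.\<close>
  have d0: "dev 0 f = 0" for f by (simp add: dev_def count_def q0)
  have "(\<integral>\<^sup>+ \<omega>. indicator {f. \<forall>j\<le>0. count j f \<le> 4 * real (card I) * q j} (levels \<omega>) *
       ennreal (exp (\<kappa> * (\<Sum>j=1..0. w j * (dev j (levels \<omega>))\<^sup>2) + c * (dev 0 (levels \<omega>))\<^sup>2)) \<partial>M)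
     \<le> (\<integral>\<^sup>+ \<omega>. 1 \<partial>M)"
    unfolding d0 by (intro nn_integral_mono) (simp add: indicator_def)
  then show ?case by (simp add: emeasure_space_1)
next
  case (Suc J)
  let ?G = "\<lambda>J. {f. \<forall>j\<le>J. count j f \<le> 4 * real (card I) * q j}"
  let ?d = "\<lambda>j \<omega>. (dev j (levels \<omega>))\<^sup>2"
  let ?W = "\<Sum>j=1..J. w j"
  \<comment> \<open>The invariant \<open>c \<le> 2 \<kappa> w\<close> gives
    \<open>b \<le> 3 \<kappa> w\<close>, hence \<open>b \<le> 1/32\<close> when
    \<open>\<kappa> \<le> 1/96\<close>. Two thirds of \<open>b\<close> are at most
    \<open>2 \<kappa> w (Suc J)\<close>, which restores the invariant one level down because
    \<open>w\<close> decreases. The factor \<open>exp (8 b)\<close> per level explains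
    \<open>24 = 8 * 3\<close>.\<close>
  define b where "b = \<kappa> * w (Suc J) + c"
  have b: "0 \<le> b" "b \<le> 3 * \<kappa> * w (Suc J)" using Suc.prems \<kappa> w(2)[of "Suc J"] by (auto simp: b_def)
  have "\<kappa> * w (Suc J) \<le> 1/96 * 1" using \<kappa> w by (intro mult_mono) auto
  then have b': "b \<le> 1/32" using b by simp
  define \<Psi> :: "('i \<Rightarrow> nat) \<Rightarrow> ennreal" where "\<Psi> f = indicator (?G J) f *
      ennreal (exp (\<kappa> * (\<Sum>j=1..J. w j * (dev j f)\<^sup>2)))" for f
  have Psi: "\<Psi> (\<lambda>i\<in>I. min (f i) J) = \<Psi> f" for f
  proof -
    have "(\<Sum>j=1..J. w j * (dev j (\<lambda>i. min (f i) J))\<^sup>2) = (\<Sum>j=1..J. w j * (dev j f)\<^sup>2)"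
      by (intro sum.cong) (auto simp: dev_min)
    then show ?thesis unfolding \<Psi>_def by (simp add: indicator_def count_min)
  qed
  have "(\<integral>\<^sup>+ \<omega>. indicator (?G (Suc J)) (levels \<omega>) *
       ennreal (exp (\<kappa> * (\<Sum>j=1..Suc J. w j * ?d j \<omega>) + c * ?d (Suc J) \<omega>)) \<partial>M)
    \<le> (\<integral>\<^sup>+ \<omega>. \<Psi> (truncated J \<omega>) * ennreal (exp (b * ?d (Suc J) \<omega>)) \<partial>M)"
    unfolding Psi
  proof (intro nn_integral_mono)
    fix \<omega>
    have "\<kappa> * (\<Sum>j=1..Suc J. w j * ?d j \<omega>) + c * ?d (Suc J) \<omega>
      = \<kappa> * (\<Sum>j=1..J. w j * ?d j \<omega>) + b * ?d (Suc J) \<omega>"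
      by (simp add: b_def algebra_simps)
    then show "indicator (?G (Suc J)) (levels \<omega>) *
       ennreal (exp (\<kappa> * (\<Sum>j=1..Suc J. w j * ?d j \<omega>) + c * ?d (Suc J) \<omega>))
      \<le> \<Psi> (levels \<omega>) * ennreal (exp (b * ?d (Suc J) \<omega>))"
      unfolding \<Psi>_def mult.assoc ennreal_mult'[OF exp_ge_zero, symmetric] exp_add[symmetric]
      by (intro mult_mono) (auto simp: indicator_def)
  qed
  also have "\<dots> \<le> ennreal (exp (8 * b)) *
       (\<integral>\<^sup>+ \<omega>. \<Psi> (truncated J \<omega>) * ennreal (exp (2 / 3 * b * ?d J \<omega>)) \<partial>M)"
  proof (rule next_level_exp_square[OF Suc.prems(1) b(1) b'])
    fix f assume "4 * real (card I) * q J < count J f"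
    then have "f \<notin> (?G J)" using not_le by blast
    then show "\<Psi> f = 0" unfolding \<Psi>_def by simp
  qed
  also have "\<dots> \<le> ennreal (exp (8 * b)) * ennreal (exp (24 * \<kappa> * ?W))"
  proof (rule mult_left_mono)
    have "2 / 3 * b \<le> 2 * \<kappa> * w (Suc J)" using b by simp
    also have "\<dots> \<le> 2 * \<kappa> * w J" using \<kappa> w(1) by (intro mult_left_mono) (auto simp: antimono_def)
    finally have "(\<integral>\<^sup>+ \<omega>. indicator (?G J) (levels \<omega>) *
       ennreal (exp (\<kappa> * (\<Sum>j=1..J. w j * ?d j \<omega>) + (2 / 3 * b) * ?d J \<omega>)) \<partial>M)
     \<le> ennreal (exp (24 * \<kappa> * ?W))" using b Suc.prems(1) by (intro Suc.IH) auto
    then show "(\<integral>\<^sup>+ \<omega>. \<Psi> (truncated J \<omega>) * ennreal (exp (2 / 3 * b * ?d J \<omega>)) \<partial>M)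
      \<le> ennreal (exp (24 * \<kappa> * ?W))"
      unfolding Psi unfolding \<Psi>_def mult.assoc ennreal_mult'[OF exp_ge_zero, symmetric] exp_add[symmetric] .
  qed simp
  also have "\<dots> = ennreal (exp (8 * b + 24 * \<kappa> * ?W))"
    by (simp only: exp_add ennreal_mult'[OF exp_ge_zero])
  also have "\<dots> \<le> ennreal (exp (24 * \<kappa> * (\<Sum>j=1..Suc J. w j)))"
    using b by (intro ennreal_leI) (simp add: algebra_simps)
  finally show ?case .
qed

end

section \<open>Transport in the logistic scale\<close>

definition ecdf_of :: "nat \<Rightarrow> (nat \<Rightarrow> real) \<Rightarrow> real \<Rightarrow> real" where
  "ecdf_of N x a = real (card {i\<in>{1..N}. x i \<le> a}) / real N"

text \<open>The quantile function of the standard logistic law.\<close>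

definition logit :: "real \<Rightarrow> real" where
  "logit t = ln t - ln (1 - t)"

lemma logit_measurable [measurable]: "logit \<in> borel_measurable borel"
  unfolding logit_def by measurable

lemma DERIV_logit: "0 < t \<Longrightarrow> t < 1 \<Longrightarrow> DERIV logit t :> 1 / (t * (1 - t))"
  unfolding logit_def by (auto intro!: derivative_eq_intros simp: divide_simps)

lemma logit_strict_mono: "0 < s \<Longrightarrow> s < t \<Longrightarrow> t < 1 \<Longrightarrow> logit s < logit t"
  unfolding logit_def by (intro diff_strict_mono) auto

lemma logit_mono: "0 < s \<Longrightarrow> s \<le> t \<Longrightarrow> t < 1 \<Longrightarrow> logit s \<le> logit t"
  using logit_strict_mono[of s t] by (cases "s = t") auto

lemma logit_surj: "\<exists>t. 0 < t \<and> t < 1 \<and> logit t = y"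
proof (intro exI[of _ "1 / (1 + exp (- y))"] conjI)
  have p: "0 < 1 + exp (- y)" by (simp add: add_pos_pos)
  have "1 - 1 / (1 + exp (- y)) = exp (- y) / (1 + exp (- y))" using p by (simp add: field_simps)
  then show "logit (1 / (1 + exp (- y))) = y" unfolding logit_def using p by (simp add: ln_div)
qed (auto simp: add_pos_pos field_simps)

lemma nn_integral_powr_0:
  fixes q d :: real
  assumes "q < 1" "0 \<le> d"
  shows "(\<integral>\<^sup>+ s. indicator {0..d} s * ennreal (s powr (- q)) \<partial>lborel) = ennreal (d powr (1 - q) / (1 - q))"
proof -
  have "((\<lambda>s. s powr (- q)) has_integral (d powr (- q + 1) / (- q + 1))) {0..d}"
    using assms by (intro has_integral_powr_from_0) auto
  then have "((\<lambda>s. if s \<in> {0..d} then s powr (- q) else 0) has_integral (d powr (- q + 1) / (- q + 1))) UNIV"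
    by (simp only: has_integral_restrict_UNIV)
  also have "(\<lambda>s. if s \<in> {0..d} then s powr (- q) else 0) = (\<lambda>s. indicator {0..d} s * s powr (- q))"
    by auto
  finally have "(\<integral>\<^sup>+ s. ennreal (indicator {0..d} s * s powr (- q)) \<partial>lborel) = ennreal (d powr (- q + 1) / (- q + 1))"
    by (intro nn_integral_has_integral_lborel) auto
  then show ?thesis by (simp add: ennreal_mult' ennreal_indicator add.commute)
qed

lemma nn_integral_reflect:
  fixes f :: "real \<Rightarrow> ennreal"
  assumes "f \<in> borel_measurable borel"
  shows "(\<integral>\<^sup>+ s. f (1 - s) \<partial>lborel) = (\<integral>\<^sup>+ s. f s \<partial>lborel)"
  using nn_integral_real_affine[OF assms, of "-1" 1] by simp

text \<open>The logarithm is bounded by a power with exponent -1/4, so that its square keeps the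
  integrable singularity \<open>s powr (- (1/2))\<close>.\<close>

lemma logit_sq_le:
  assumes "0 < t" "t < 1"
  shows "(logit t)\<^sup>2 \<le> 32 * t powr (- (1/2)) + 32 * (1 - t) powr (- (1/2))"
proof -
  have l: "(ln s)\<^sup>2 \<le> 16 * s powr (- (1/2))" if "0 < s" "s < 1" for s :: real
  proof -
    have "ln (1 / s) \<le> (1 / s) powr (1/4) / (1/4)" using that by (intro ln_powr_bound) auto
    then have "- ln s \<le> 4 * s powr (- (1/4))" using that by (simp add: ln_div powr_minus_divide powr_divide)
    then have "(- ln s)\<^sup>2 \<le> (4 * s powr (- (1/4)))\<^sup>2" using that by (intro power_mono) auto
    also have "\<dots> = 16 * (s powr (- (1/4)) * s powr (- (1/4)))" by (simp add: power2_eq_square)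
    also have "\<dots> = 16 * s powr (- (1/2))" by (simp flip: powr_add)
    finally show ?thesis by simp
  qed
  have "(logit t)\<^sup>2 \<le> 2 * (ln t)\<^sup>2 + 2 * (ln (1 - t))\<^sup>2"
    unfolding logit_def using sum_squares_ge_zero[of "ln t + ln (1 - t)" 0]
    by (simp add: power2_eq_square algebra_simps)
  then show ?thesis using l[of t] l[of "1 - t"] assms by simp
qed

text \<open>Provides the finiteness that \<open>logit_transport_le\<close> asks for, where a
  multiple of the transport cost is absorbed into the left-hand side.\<close>

lemma logit_moment_finite:
  fixes u :: "real \<Rightarrow> real" and p C :: real
  assumes p: "0 \<le> p" "p \<le> 2" and u: "\<And>t. 0 < t \<Longrightarrow> t < 1 \<Longrightarrow> \<bar>logit (u t)\<bar> \<le> C"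
  shows "(\<integral>\<^sup>+ t. indicator {0<..<1} t * ennreal (\<bar>logit (u t) - logit t\<bar> powr p) \<partial>lborel) < \<infinity>"
proof -
  let ?b = "\<lambda>t. indicator {0..1::real} t * ennreal (t powr (- (1/2)))"
  have "(\<integral>\<^sup>+ t. indicator {0<..<1} t * ennreal (\<bar>logit (u t) - logit t\<bar> powr p) \<partial>lborel)
    \<le> (\<integral>\<^sup>+ t. ennreal (2 * (1 + C)\<^sup>2) * indicator {0..1} t + (64 * ?b t + 64 * ?b (1 - t)) \<partial>lborel)"
  proof (intro nn_integral_mono)
    fix t :: real
    show "indicator {0<..<1} t * ennreal (\<bar>logit (u t) - logit t\<bar> powr p)
      \<le> ennreal (2 * (1 + C)\<^sup>2) * indicator {0..1} t + (64 * ?b t + 64 * ?b (1 - t))"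
    proof (cases "t \<in> {0<..<1}")
      case True
      define z where "z = 1 + \<bar>logit (u t) - logit t\<bar>"
      have z: "1 \<le> z" "z \<le> (1 + C) + \<bar>logit t\<bar>" using u[of t] True by (auto simp: z_def)
      have "\<bar>logit (u t) - logit t\<bar> powr p \<le> z powr p" using p by (intro powr_mono2) (auto simp: z_def)
      also have "\<dots> \<le> z powr 2" using p z by (intro powr_mono) auto
      also have "\<dots> = z\<^sup>2" using z by (simp add: powr_numeral)
      also have "\<dots> \<le> ((1 + C) + \<bar>logit t\<bar>)\<^sup>2" using z by (intro power_mono) auto
      also have "\<dots> \<le> 2 * (1 + C)\<^sup>2 + 2 * (logit t)\<^sup>2"
        using zero_le_power2[of "(1 + C) - \<bar>logit t\<bar>"] by (simp add: power2_eq_square algebra_simps)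
      also have "\<dots> \<le> 2 * (1 + C)\<^sup>2 + (64 * t powr (- (1/2)) + 64 * (1 - t) powr (- (1/2)))"
        using logit_sq_le[of t] True by simp
      finally have "ennreal (\<bar>logit (u t) - logit t\<bar> powr p) \<le> ennreal \<dots>" by (rule ennreal_leI)
      also have "\<dots> = ennreal (2 * (1 + C)\<^sup>2) + (64 * ennreal (t powr (- (1/2))) + 64 * ennreal ((1 - t) powr (- (1/2))))"
        by (simp add: ennreal_mult')
      finally show ?thesis using True by simp
    qed simp
  qed
  also have "\<dots> = ennreal (2 * (1 + C)\<^sup>2) + (64 * (\<integral>\<^sup>+ t. ?b t \<partial>lborel) + 64 * (\<integral>\<^sup>+ t. ?b (1 - t) \<partial>lborel))"
    by (simp add: nn_integral_add nn_integral_cmult)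
  also have "(\<integral>\<^sup>+ t. ?b (1 - t) \<partial>lborel) = (\<integral>\<^sup>+ t. ?b t \<partial>lborel)"
    by (rule nn_integral_reflect) measurable
  also have "(\<integral>\<^sup>+ t. ?b t \<partial>lborel) = ennreal (1 powr (1 - 1/2) / (1 - 1/2))"
    by (rule nn_integral_powr_0) auto
  also have "ennreal (2 * (1 + C)\<^sup>2) + (64 * ennreal (1 powr (1 - 1/2) / (1 - 1/2)) + 64 * ennreal (1 powr (1 - 1/2) / (1 - 1/2))) < \<infinity>"
    by (simp add: ennreal_mult_less_top)
  finally show ?thesis .
qed

text \<open>The kernel inequality in the proof replaces \<open>h t ^ p\<close> by an integral over those
  points \<open>s\<close> between \<open>t\<close> and \<open>u t\<close> where \<open>h\<close> is still at least half as large; exchanging the integrals turns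
  the set of admissible \<open>t\<close> into the segment between \<open>s\<close> and \<open>G s\<close>.\<close>

lemma logit_transport_le:
  fixes u G :: "real \<Rightarrow> real" and p :: real
  assumes p: "1 \<le> p" "p \<le> 2"
    and [measurable]: "u \<in> borel_measurable borel" "G \<in> borel_measurable borel"
    and u01: "\<And>t. 0 < t \<Longrightarrow> t < 1 \<Longrightarrow> 0 < u t \<and> u t < 1"
    and u_mono: "\<And>s t. 0 < s \<Longrightarrow> s \<le> t \<Longrightarrow> t < 1 \<Longrightarrow> u s \<le> u t"
    and galois: "\<And>s t. 0 < s \<Longrightarrow> s < 1 \<Longrightarrow> 0 < t \<Longrightarrow> t < 1 \<Longrightarrow> u t \<le> s \<longleftrightarrow> t \<le> G s"
    and fin: "(\<integral>\<^sup>+ t. indicator {0<..<1} t * ennreal (\<bar>logit (u t) - logit t\<bar> powr p) \<partial>lborel) < \<infinity>"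
  shows "(\<integral>\<^sup>+ t. indicator {0<..<1} t * ennreal (\<bar>logit (u t) - logit t\<bar> powr p) \<partial>lborel)
    \<le> 64 * (\<integral>\<^sup>+ s. indicator {0<..<1} s * ennreal ((\<bar>G s - s\<bar> / (s * (1 - s))) powr p) \<partial>lborel)"
proof -
  define h where "h t = \<bar>logit (u t) - logit t\<bar>" for t
  define a where "a s = \<bar>G s - s\<bar> / (s * (1 - s))" for s
  define S where "S s = {min s (G s)..max s (G s)}" for s
  define k where "k s = ennreal (h s powr (p - 1) * (1 / (s * (1 - s))))" for s
  have [measurable]: "h \<in> borel_measurable borel" "a \<in> borel_measurable borel" "k \<in> borel_measurable borel"
    unfolding h_def a_def k_def by measurable
  let ?K = "\<lambda>t s. indicator (S s) t * (indicator {0<..<1} s * k s)"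
  have S_meas [measurable]: "(\<lambda>(t, s). indicator (S s) t :: ennreal) \<in> borel_measurable (borel \<Otimes>\<^sub>M borel)"
  proof -
    have "(\<lambda>(t, s). indicator (S s) t :: ennreal) = (\<lambda>(t, s). if min s (G s) \<le> t \<and> t \<le> max s (G s) then 1 else 0)"
      by (auto simp: S_def fun_eq_iff)
    then show ?thesis by simp
  qed
  \<comment> \<open>\<open>{c..d}\<close> will be the half next to \<open>t\<close> of the segment
    between \<open>t\<close> and \<open>u t\<close>, measured in the logit scale.
    \<open>h t powr p\<close> is at most 4 times \<open>(h t / 2) powr (p - 1)\<close> times the
    logit length \<open>h t / 2\<close>; the length becomes the integral of the derivative of
    \<open>logit\<close>, and the other factor is at most \<open>h s powr (p - 1)\<close>
    there.\<close>
  have half: "ennreal (h t powr p) \<le> 4 * (\<integral>\<^sup>+ s. ?K t s \<partial>lborel)"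
    if h: "0 < h t" and cd: "0 < c" "c \<le> d" "d < 1" "logit d - logit c = h t / 2"
      and s: "\<And>s. c \<le> s \<Longrightarrow> s \<le> d \<Longrightarrow> t \<in> S s \<and> h t / 2 \<le> h s" for t c d
  proof -
    have two: "h t / 2 > 0" using h by simp
    have "h t powr p = 2 powr p * (h t / 2) powr p" using h by (simp add: powr_divide)
    also have "\<dots> \<le> 2 powr 2 * (h t / 2) powr p" using p by (intro mult_right_mono powr_mono) auto
    also have "(h t / 2) powr p = (h t / 2) powr (p - 1) * (logit d - logit c)"
      unfolding cd using two by (simp add: powr_diff)
    finally have "ennreal (h t powr p) \<le> ennreal (4 * ((h t / 2) powr (p - 1) * (logit d - logit c)))"
      by (intro ennreal_leI) simp
    also have "\<dots> = 4 * (ennreal ((h t / 2) powr (p - 1)) * ennreal (logit d - logit c))"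
      by (simp add: ennreal_mult')
    also have "ennreal (logit d - logit c) = (\<integral>\<^sup>+ s. ennreal (1 / (s * (1 - s))) * indicator {c..d} s \<partial>lborel)"
      using cd by (intro nn_integral_FTC_Icc[symmetric]) (auto intro!: DERIV_logit)
    also have "ennreal ((h t / 2) powr (p - 1)) * \<dots>
        = (\<integral>\<^sup>+ s. ennreal ((h t / 2) powr (p - 1)) * (ennreal (1 / (s * (1 - s))) * indicator {c..d} s) \<partial>lborel)"
      by (intro nn_integral_cmult[symmetric]) measurable
    also have "\<dots> \<le> (\<integral>\<^sup>+ s. ?K t s \<partial>lborel)"
    proof (intro nn_integral_mono)
      fix x
      show "ennreal ((h t / 2) powr (p - 1)) * (ennreal (1 / (x * (1 - x))) * indicator {c..d} x)
          \<le> indicator (S x) t * (indicator {0<..<1} x * k x)"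
      proof (cases "x \<in> {c..d}")
        case True
        then have "t \<in> S x" "h t / 2 \<le> h x" "0 < x" "x < 1" using s[of x] cd by auto
        then show ?thesis using True two p
          by (auto simp: k_def ennreal_mult'[symmetric] intro!: ennreal_leI divide_right_mono powr_mono2)
      qed simp
    qed
    finally show ?thesis by (simp add: mult_left_mono)
  qed
  have ker: "ennreal (h t powr p) \<le> 4 * (\<integral>\<^sup>+ s. ?K t s \<partial>lborel)"
    if t: "0 < t" "t < 1" for t
  proof -
    \<comment> \<open>The midpoint in the logit scale. For \<open>s\<close> between \<open>t\<close>
      and \<open>m\<close>, monotonicity keeps \<open>u s\<close> no closer than \<open>u t\<close>,
      so at least half of the distance \<open>h t\<close> remains.\<close>
    obtain m where m: "0 < m" "m < 1" "logit m = (logit t + logit (u t)) / 2" using logit_surj by blast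
    have ut: "0 < u t" "u t < 1" using u01[OF t] by auto
    consider "u t = t" | "t < u t" | "u t < t" by linarith
    then show ?thesis
    proof cases
      case 1 then show ?thesis by (simp add: h_def)
    next
      case 2
      have l: "logit t < logit (u t)" using 2 t ut by (intro logit_strict_mono) auto
      have m': "t < m" "m < u t"
        using logit_mono[of m t] logit_mono[of "u t" m] m t ut l by (force simp: not_le[symmetric])+
      show ?thesis
      proof (rule half[of t t m])
        fix s assume s: "t \<le> s" "s \<le> m"
        have "\<not> t \<le> G s" using galois[of s t] s m' m t by simp
        then have "t \<in> S s" using s by (auto simp: S_def)
        moreover have "logit (u t) \<le> logit (u s)"
          using u_mono[of t s] s m t u01[of s] ut by (intro logit_mono) auto
        moreover have "logit s \<le> logit m" using s m t by (intro logit_mono) auto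
        ultimately show "t \<in> S s \<and> h t / 2 \<le> h s" using l m by (auto simp: h_def)
      qed (use l m m' t in \<open>auto simp: h_def\<close>)
    next
      case 3
      have l: "logit (u t) < logit t" using 3 t ut by (intro logit_strict_mono) auto
      have m': "u t < m" "m < t"
        using logit_mono[of m "u t"] logit_mono[of t m] m t ut l by (force simp: not_le[symmetric])+
      show ?thesis
      proof (rule half[of t m t])
        fix s assume s: "m \<le> s" "s \<le> t"
        have "t \<le> G s" using galois[of s t] s m' m t by simp
        then have "t \<in> S s" using s by (auto simp: S_def)
        moreover have "logit (u s) \<le> logit (u t)"
          using u_mono[of s t] s m t u01[of s] ut by (intro logit_mono) auto
        moreover have "logit m \<le> logit s" using s m t by (intro logit_mono) auto
        ultimately show "t \<in> S s \<and> h t / 2 \<le> h s" using l m by (auto simp: h_def)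
      qed (use l m m' t in \<open>auto simp: h_def\<close>)
    qed
  qed
  define E where "E = (\<integral>\<^sup>+ t. indicator {0<..<1} t * ennreal (h t powr p) \<partial>lborel)"
  define A where "A = (\<integral>\<^sup>+ s. indicator {0<..<1} s * ennreal (a s powr p) \<partial>lborel)"
  have "E \<le> (\<integral>\<^sup>+ t. \<integral>\<^sup>+ s. 4 * (?K t s) \<partial>lborel \<partial>lborel)"
    unfolding E_def
  proof (intro nn_integral_mono)
    fix t :: real
    have "4 * (\<integral>\<^sup>+ s. ?K t s \<partial>lborel)
       = (\<integral>\<^sup>+ s. 4 * (?K t s) \<partial>lborel)"
      by (rule nn_integral_cmult[symmetric]) measurable
    then show "indicator {0<..<1} t * ennreal (h t powr p)
      \<le> (\<integral>\<^sup>+ s. 4 * (?K t s) \<partial>lborel)"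
      using ker[of t] by (auto simp: indicator_def)
  qed
  also have "\<dots> = (\<integral>\<^sup>+ s. \<integral>\<^sup>+ t. 4 * (?K t s) \<partial>lborel \<partial>lborel)"
    by (rule lborel_pair.Fubini') measurable
  also have "\<dots> \<le> (\<integral>\<^sup>+ s. 32 * (indicator {0<..<1} s * ennreal (a s powr p)) + ennreal (1/2) * (indicator {0<..<1} s * ennreal (h s powr p)) \<partial>lborel)"
  proof (intro nn_integral_mono)
    fix s :: real
    show "(\<integral>\<^sup>+ t. 4 * (?K t s) \<partial>lborel)
      \<le> 32 * (indicator {0<..<1} s * ennreal (a s powr p)) + ennreal (1/2) * (indicator {0<..<1} s * ennreal (h s powr p))"
    proof (cases "s \<in> {0<..<1}")
      case True
      have "(\<integral>\<^sup>+ t. 4 * (?K t s) \<partial>lborel)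
        = 4 * k s * emeasure lborel (S s)"
        using True by (subst nn_integral_cmult_indicator[symmetric]) (auto simp: S_def mult_ac intro!: nn_integral_cong)
      also have "emeasure lborel (S s) = ennreal \<bar>G s - s\<bar>"
        by (auto simp: S_def min_def max_def)
      also have "4 * k s * ennreal \<bar>G s - s\<bar> = ennreal (4 * a s * h s powr (p - 1))"
        using True by (simp add: k_def a_def ennreal_mult'[symmetric] flip: ennreal_numeral)
      also have "\<dots> \<le> ennreal (32 * a s powr p + 1/2 * h s powr p)"
      proof (rule ennreal_leI)
        have a0: "0 \<le> a s" using True by (simp add: a_def)
        have h0: "0 \<le> h s" by (simp add: h_def)
        \<comment> \<open>Young's inequality by hand, with the threshold \<open>8 a = h\<close>. The
          coefficient 1/2 of \<open>h s powr p\<close> must stay below 1 for the absorption that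
          follows.\<close>
        show "4 * a s * h s powr (p - 1) \<le> 32 * a s powr p + 1/2 * h s powr p"
        proof (cases "8 * a s \<le> h s")
          case True
          have "4 * a s * h s powr (p - 1) \<le> 1/2 * h s * h s powr (p - 1)"
            using True by (intro mult_right_mono) auto
          also have "\<dots> = 1/2 * h s powr p" using h0 p
            by (cases "h s = 0") (auto simp: powr_diff)
          finally show ?thesis using a0 by (simp add: add_increasing)
        next
          case False
          then have "4 * a s * h s powr (p - 1) \<le> 4 * a s * (8 * a s) powr (p - 1)"
            using a0 h0 p by (intro mult_left_mono powr_mono2) auto
          also have "\<dots> = 4 * 8 powr (p - 1) * a s powr p" using a0 False h0
            by (auto simp: powr_mult powr_diff)
          also have "\<dots> \<le> 4 * 8 powr 1 * a s powr p"
            using p by (intro mult_right_mono mult_left_mono powr_mono) auto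
          finally show ?thesis by (simp add: add_increasing2)
        qed
      qed
      also have "\<dots> = ennreal (32 * a s powr p) + ennreal (1/2 * h s powr p)"
        by (rule ennreal_plus) auto
      also have "\<dots> = 32 * ennreal (a s powr p) + ennreal (1/2) * ennreal (h s powr p)"
        by (simp only: ennreal_mult' ennreal_numeral zero_le_numeral zero_le_divide_1_iff)
      finally show ?thesis using True by simp
    qed simp
  qed
  also have "\<dots> = 32 * A + ennreal (1/2) * E"
    unfolding A_def E_def by (simp add: nn_integral_add nn_integral_cmult)
  finally have "E \<le> 32 * A + ennreal (1/2) * E" .
  moreover have "E < \<infinity>" using fin by (simp add: E_def h_def)
  \<comment> \<open>Since \<open>E\<close> is finite, half of it can be moved to the left-hand
    side.\<close>
  ultimately have "E \<le> 64 * A"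
  proof (cases "A = \<infinity>")
    case True then show ?thesis by (simp add: ennreal_mult_top)
  next
    case False
    assume 1: "E \<le> 32 * A + ennreal (1/2) * E" and 2: "E < \<infinity>"
    obtain e where e: "E = ennreal e" "0 \<le> e" using 2 by (cases E) auto
    obtain x where x: "A = ennreal x" "0 \<le> x" using False by (cases A) auto
    have "ennreal (32 * x + 1/2 * e) = ennreal (32 * x) + ennreal (1/2 * e)"
      using e x by (intro ennreal_plus) auto
    also have "\<dots> = 32 * A + ennreal (1/2) * E"
      unfolding e(1) x(1) by (simp only: ennreal_mult' ennreal_numeral zero_le_numeral zero_le_divide_1_iff)
    finally have "ennreal e \<le> ennreal (32 * x + 1/2 * e)" using 1 unfolding e(1) by (simp only:)
    then have "e \<le> 32 * x + 1/2 * e" using e x by (subst (asm) ennreal_le_iff) auto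
    then have "e \<le> 64 * x" by simp
    then show ?thesis using e x by (simp add: ennreal_mult'[symmetric] ennreal_leI flip: ennreal_numeral)
  qed
  then show ?thesis by (simp add: E_def A_def h_def a_def)
qed

section \<open>The uniform empirical process\<close>

lemma greaterThanAtMost_split:
  fixes a b c :: "'a :: linorder"
  shows "a \<le> b \<Longrightarrow> b \<le> c \<Longrightarrow> {a<..c} = {a<..b} \<union> {b<..c}"
  by auto

lemma (in prob_space) second_moment_sum:
  fixes Z :: "'i \<Rightarrow> 'a \<Rightarrow> real"
  assumes I: "finite I" and ind: "indep_vars (\<lambda>_. borel) Z I"
    and int: "\<And>i. i \<in> I \<Longrightarrow> integrable M (Z i)" "\<And>i. i \<in> I \<Longrightarrow> integrable M (\<lambda>\<omega>. (Z i \<omega>)\<^sup>2)"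
    and zero: "\<And>i. i \<in> I \<Longrightarrow> expectation (Z i) = 0"
    and var: "\<And>i. i \<in> I \<Longrightarrow> expectation (\<lambda>\<omega>. (Z i \<omega>)\<^sup>2) = V"
  shows "integrable M (\<lambda>\<omega>. (\<Sum>i\<in>I. Z i \<omega>)\<^sup>2)"
    and "expectation (\<lambda>\<omega>. (\<Sum>i\<in>I. Z i \<omega>)\<^sup>2) = real (card I) * V"
proof -
  have prod: "integrable M (\<lambda>\<omega>. Z i \<omega> * Z j \<omega>) \<and> expectation (\<lambda>\<omega>. Z i \<omega> * Z j \<omega>) = (if i = j then V else 0)"
    if ij: "i \<in> I" "j \<in> I" for i j
  proof (cases "i = j")
    case True then show ?thesis using int var ij by (simp add: power2_eq_square)
  next
    case False
    have indij: "indep_vars (\<lambda>_. borel) Z {i, j}" using ind by (rule indep_vars_subset) (use ij in auto)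
    have e: "Z i \<omega> * Z j \<omega> = (\<Prod>k\<in>{i, j}. Z k \<omega>)" for \<omega> using False by simp
    have "integrable M (\<lambda>\<omega>. \<Prod>k\<in>{i, j}. Z k \<omega>)"
      by (rule indep_vars_integrable[OF _ indij]) (use int ij in auto)
    moreover have "expectation (\<lambda>\<omega>. \<Prod>k\<in>{i, j}. Z k \<omega>) = (\<Prod>k\<in>{i, j}. expectation (Z k))"
      by (rule indep_vars_lebesgue_integral[OF _ indij]) (use int ij in auto)
    ultimately show ?thesis using False zero ij by (simp add: e del: prod.insert)
  qed
  have sq: "(\<Sum>i\<in>I. Z i \<omega>)\<^sup>2 = (\<Sum>i\<in>I. \<Sum>j\<in>I. Z i \<omega> * Z j \<omega>)" for \<omega>
    by (simp add: power2_eq_square sum_product)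
  show "integrable M (\<lambda>\<omega>. (\<Sum>i\<in>I. Z i \<omega>)\<^sup>2)"
    unfolding sq using prod by (intro Bochner_Integration.integrable_sum) auto
  have "expectation (\<lambda>\<omega>. (\<Sum>i\<in>I. Z i \<omega>)\<^sup>2) = (\<Sum>i\<in>I. \<Sum>j\<in>I. if i = j then V else 0)"
  proof -
    have "expectation (\<lambda>\<omega>. (\<Sum>i\<in>I. Z i \<omega>)\<^sup>2) = (\<Sum>i\<in>I. \<Sum>j\<in>I. expectation (\<lambda>\<omega>. Z i \<omega> * Z j \<omega>))"
      unfolding sq by (simp add: prod)
    also have "\<dots> = (\<Sum>i\<in>I. \<Sum>j\<in>I. if i = j then V else 0)"
      by (intro sum.cong refl) (simp add: prod)
    finally show ?thesis .
  qed
  also have "\<dots> = real (card I) * V" using I by simp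
  finally show "expectation (\<lambda>\<omega>. (\<Sum>i\<in>I. Z i \<omega>)\<^sup>2) = real (card I) * V" .
qed

lemma (in prob_space) sum_deviation_le:
  fixes Z :: "'i \<Rightarrow> 'a \<Rightarrow> real"
  assumes I: "finite I" and ind: "indep_vars (\<lambda>_. borel) Z I"
    and int: "\<And>i. i \<in> I \<Longrightarrow> integrable M (Z i)" "\<And>i. i \<in> I \<Longrightarrow> integrable M (\<lambda>\<omega>. (Z i \<omega>)\<^sup>2)"
    and zero: "\<And>i. i \<in> I \<Longrightarrow> expectation (Z i) = 0"
    and var: "\<And>i. i \<in> I \<Longrightarrow> expectation (\<lambda>\<omega>. (Z i \<omega>)\<^sup>2) = V"
    and c: "0 < c"
  shows "prob {\<omega>\<in>space M. c \<le> \<bar>\<Sum>i\<in>I. Z i \<omega>\<bar>} \<le> real (card I) * V / c\<^sup>2"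
proof -
  note sm = second_moment_sum[OF I ind int zero var]
  have [measurable]: "Z i \<in> borel_measurable M" if "i \<in> I" for i using int(1)[OF that] by auto
  have "{\<omega>\<in>space M. c \<le> \<bar>\<Sum>i\<in>I. Z i \<omega>\<bar>} = {\<omega>\<in>space M. c\<^sup>2 \<le> (\<Sum>i\<in>I. Z i \<omega>)\<^sup>2}"
    using c by (auto simp: abs_le_square_iff[symmetric])
  also have "prob \<dots> \<le> expectation (\<lambda>\<omega>. (\<Sum>i\<in>I. Z i \<omega>)\<^sup>2) / c\<^sup>2"
    using c by (intro integral_Markov_inequality_measure[where A = "space M"] sm) auto
  finally show ?thesis using sm by simp
qed

text \<open>For the left half of the empirical process \<open>T s = {..s}\<close>, for the right half \<open>T s = {1 - s<..}\<close>.\<close>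

locale nested_sample = prob_space +
  fixes U :: "nat \<Rightarrow> 'a \<Rightarrow> real" and N :: nat and T :: "real \<Rightarrow> real set"
  assumes N: "0 < N"
    and ind: "indep_vars (\<lambda>_. borel) U {1..N}"
    and T_meas [measurable]: "Measurable.pred (borel \<Otimes>\<^sub>M borel) (\<lambda>(x, s). x \<in> T s)"
    and T_mono: "\<And>s t. s \<le> t \<Longrightarrow> T s \<subseteq> T t"
    and prob_T: "\<And>i s. i \<in> {1..N} \<Longrightarrow> 0 \<le> s \<Longrightarrow> s \<le> 1 \<Longrightarrow> prob {\<omega>\<in>space M. U i \<omega> \<in> T s} = s"
begin

lemma U_meas [measurable]: "i \<in> {1..N} \<Longrightarrow> U i \<in> borel_measurable M"
  using ind unfolding indep_vars_def by auto

lemma T_meas' [measurable (raw)]: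
  assumes "f \<in> borel_measurable M'" "g \<in> borel_measurable M'"
  shows "Measurable.pred M' (\<lambda>x. f x \<in> T (g x))"
proof -
  have "(\<lambda>x. (f x, g x)) \<in> measurable M' (borel \<Otimes>\<^sub>M borel)" using assms by simp
  from measurable_compose[OF this T_meas] show ?thesis by simp
qed

definition cnt :: "real \<Rightarrow> 'a \<Rightarrow> real" where
  "cnt s \<omega> = (\<Sum>i=1..N. indicator (T s) (U i \<omega>))"

text \<open>Normalised by \<open>N s\<close> like \<open>dev\<close> in
  \<open>dyadic_levels\<close>, whose square it becomes on the grid. Its mean is
  \<open>1 - s\<close>.\<close>

definition nsq :: "real \<Rightarrow> 'a \<Rightarrow> real" where
  "nsq s \<omega> = (cnt s \<omega> - real N * s)\<^sup>2 / (real N * s)"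

lemma cnt_measurable [measurable (raw)]:
  assumes [measurable]: "f \<in> borel_measurable M'" "g \<in> measurable M' M"
  shows "(\<lambda>x. cnt (f x) (g x)) \<in> borel_measurable M'"
proof -
  have [measurable]: "(\<lambda>x. U i (g x)) \<in> borel_measurable M'" if "i \<in> {1..N}" for i
    using measurable_compose[OF assms(2) U_meas[OF that]] .
  have "(\<lambda>x. indicator (T (f x)) (U i (g x)) :: real) = (\<lambda>x. if U i (g x) \<in> T (f x) then 1 else 0)" for i
    by (auto simp: indicator_def)
  then show ?thesis unfolding cnt_def by simp
qed

lemma nsq_measurable [measurable (raw)]:
  assumes [measurable]: "f \<in> borel_measurable M'" "g \<in> measurable M' M"
  shows "(\<lambda>x. nsq (f x) (g x)) \<in> borel_measurable M'"
  unfolding nsq_def by measurable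

lemma cnt_mono: "s \<le> t \<Longrightarrow> cnt s \<omega> \<le> cnt t \<omega>"
  unfolding cnt_def using T_mono[of s t] by (intro sum_mono) (auto simp: indicator_def)

lemma nsq_nonneg: "0 \<le> s \<Longrightarrow> 0 \<le> nsq s \<omega>"
  by (simp add: nsq_def)

context
  fixes s :: real
  assumes s: "0 \<le> s" "s \<le> 1"
begin

lemma T_borel: "T s \<in> sets borel"
proof -
  have "Measurable.pred borel (\<lambda>x. id x \<in> T s)" by (rule T_meas') auto
  then show ?thesis by (simp add: pred_def)
qed

private definition Z :: "nat \<Rightarrow> 'a \<Rightarrow> real" where "Z i \<omega> = indicator (T s) (U i \<omega>) - s"

private lemma Z_sum: "(\<Sum>i=1..N. Z i \<omega>) = cnt s \<omega> - real N * s"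
  by (simp add: Z_def cnt_def sum_subtractf)

private lemma Z_props:
  shows "indep_vars (\<lambda>_. borel) Z {1..N}"
    and "i \<in> {1..N} \<Longrightarrow> integrable M (Z i)" "i \<in> {1..N} \<Longrightarrow> integrable M (\<lambda>\<omega>. (Z i \<omega>)\<^sup>2)"
    and "i \<in> {1..N} \<Longrightarrow> expectation (Z i) = 0"
    and "i \<in> {1..N} \<Longrightarrow> expectation (\<lambda>\<omega>. (Z i \<omega>)\<^sup>2) = s * (1 - s)"
proof -
  note [measurable] = T_borel
  have "indep_vars (\<lambda>_. borel) (\<lambda>i \<omega>. (\<lambda>x. indicator (T s) x - s) (U i \<omega>)) {1..N}"
    by (rule indep_vars_compose2[OF ind]) measurable
  then show "indep_vars (\<lambda>_. borel) Z {1..N}" by (simp add: Z_def[abs_def])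
  assume i: "i \<in> {1..N}"
  note [measurable] = U_meas[OF i]
  define A where "A = {\<omega>\<in>space M. U i \<omega> \<in> T s}"
  have A [measurable]: "A \<in> sets M" unfolding A_def by measurable
  have eA: "expectation (indicator A) = s" using prob_T[OF i s] by (simp add: A_def)
  have ZA: "Z i \<omega> = indicator A \<omega> - s" if "\<omega> \<in> space M" for \<omega>
    using that by (simp add: Z_def A_def indicator_def)
  have iA: "integrable M (indicator A :: 'a \<Rightarrow> real)" by (simp add: emeasure_eq_measure)
  show "integrable M (Z i)"
    by (rule Bochner_Integration.integrable_cong[THEN iffD2, OF refl ZA]) (use iA in auto)
  have "expectation (Z i) = expectation (\<lambda>\<omega>. indicator A \<omega> - s)"
    by (rule Bochner_Integration.integral_cong[OF refl ZA])
  then show "expectation (Z i) = 0" using iA eA by (simp add: prob_space)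
  have ZA2: "(Z i \<omega>)\<^sup>2 = (1 - 2 * s) * indicator A \<omega> + s\<^sup>2" if "\<omega> \<in> space M" for \<omega>
    unfolding ZA[OF that] by (simp add: indicator_def power2_eq_square algebra_simps)
  show "integrable M (\<lambda>\<omega>. (Z i \<omega>)\<^sup>2)"
    by (rule Bochner_Integration.integrable_cong[THEN iffD2, OF refl ZA2]) (use iA in auto)
  have "expectation (\<lambda>\<omega>. (Z i \<omega>)\<^sup>2) = expectation (\<lambda>\<omega>. (1 - 2 * s) * indicator A \<omega> + s\<^sup>2)"
    by (rule Bochner_Integration.integral_cong[OF refl ZA2])
  then show "expectation (\<lambda>\<omega>. (Z i \<omega>)\<^sup>2) = s * (1 - s)"
    using iA eA by (simp add: prob_space power2_eq_square algebra_simps)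
qed

lemma nn_integral_nsq:
  assumes "0 < s"
  shows "(\<integral>\<^sup>+ \<omega>. ennreal (nsq s \<omega>) \<partial>M) \<le> 1"
proof -
  note sm = second_moment_sum[OF _ Z_props, unfolded Z_sum, simplified]
  have "(\<integral>\<^sup>+ \<omega>. ennreal (nsq s \<omega>) \<partial>M) = ennreal (expectation (\<lambda>\<omega>. (cnt s \<omega> - real N * s)\<^sup>2 / (real N * s)))"
    unfolding nsq_def using sm s by (intro nn_integral_eq_integral) auto
  also have "expectation (\<lambda>\<omega>. (cnt s \<omega> - real N * s)\<^sup>2 / (real N * s)) = 1 - s"
    using sm assms N by simp
  finally show ?thesis using s by simp
qed

lemma prob_cnt_large:
  assumes "0 < s"
  shows "prob {\<omega>\<in>space M. 2 * real N * s < cnt s \<omega>} \<le> 1 / (real N * s)"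
proof -
  have Ns: "0 < real N * s" using assms N by simp
  have "prob {\<omega>\<in>space M. 2 * real N * s < cnt s \<omega>} \<le> prob {\<omega>\<in>space M. real N * s \<le> \<bar>cnt s \<omega> - real N * s\<bar>}"
    by (intro finite_measure_mono) auto
  also have "\<dots> \<le> real (card {1..N}) * (s * (1 - s)) / (real N * s)\<^sup>2"
    using sum_deviation_le[OF _ Z_props Ns, unfolded Z_sum, simplified] by simp
  also have "\<dots> = (1 - s) / (real N * s)" using Ns by (simp add: power2_eq_square)
  also have "\<dots> \<le> 1 / (real N * s)" using Ns s by (intro divide_right_mono) auto
  finally show ?thesis .
qed

end

text \<open>Origin of the weight: up to the factor \<open>1 / (1 - s)\<close>, the normalised
  transport integrand is \<open>sqrt (nsq s) * s powr (- (1/2))\<close>, whose \<open>p\<close>-th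
  power carries \<open>s powr (- (p / 2))\<close>. The cut at \<open>(1/2) ^ Suc J\<close> keeps the
  expected dyadic counts large as \<open>N\<close> grows, so that they can be capped.\<close>

definition bulk :: "nat \<Rightarrow> real \<Rightarrow> 'a \<Rightarrow> ennreal" where
  "bulk J p \<omega> = (\<integral>\<^sup>+ s. indicator {(1/2) ^ Suc J<..1/2} s * ennreal (s powr (- (p / 2)) * nsq s \<omega>) \<partial>lborel)"

definition edge :: "nat \<Rightarrow> real \<Rightarrow> 'a \<Rightarrow> ennreal" where
  "edge J p \<omega> = (\<integral>\<^sup>+ s. indicator {0<..(1/2) ^ Suc J} s * ennreal (s powr (- (p / 2)) * nsq s \<omega>) \<partial>lborel)"

lemma bulk_measurable [measurable]: "bulk J p \<in> borel_measurable M"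
  unfolding bulk_def by measurable

lemma edge_measurable [measurable]: "edge J p \<in> borel_measurable M"
  unfolding edge_def by measurable

text \<open>By Tonelli and \<open>nn_integral_nsq\<close> the mean is at most the integral of the
  weight, which converges for \<open>p < 2\<close> and vanishes as \<open>J\<close> grows. Markov's
  inequality is applied in \<open>ennreal\<close>, where no finiteness of \<open>edge\<close> has to
  be shown beforehand.\<close>

lemma edge_tail:
  assumes p: "0 \<le> p" "p < 2" and y: "0 < y"
  shows "prob {\<omega>\<in>space M. ennreal y \<le> edge J p \<omega>} \<le> ((1/2) ^ Suc J) powr (1 - p / 2) / ((1 - p / 2) * y)"
proof -
  interpret P: pair_sigma_finite M "lborel :: real measure"
    by (intro pair_sigma_finite.intro sigma_finite_measure_axioms sigma_finite_lborel)
  define d :: real where "d = (1/2) ^ Suc J"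
  let ?f = "\<lambda>s \<omega>. ennreal (s powr (- (p / 2)) * nsq s \<omega>)" and ?r = "d powr (1 - p / 2) / (1 - p / 2)"
  have d: "0 < d" "d \<le> 1" unfolding d_def by (simp, intro power_le_one) auto
  have "(\<integral>\<^sup>+ \<omega>. edge J p \<omega> \<partial>M)
     = (\<integral>\<^sup>+ s. \<integral>\<^sup>+ \<omega>. indicator {0<..d} s * ?f s \<omega> \<partial>M \<partial>lborel)"
    unfolding edge_def d_def by (rule P.Fubini'[symmetric]) measurable
  also have "\<dots> \<le> (\<integral>\<^sup>+ s. indicator {0..d} s * ennreal (s powr (- (p / 2))) \<partial>lborel)"
  proof (intro nn_integral_mono)
    fix s :: real
    show "(\<integral>\<^sup>+ \<omega>. indicator {0<..d} s * ?f s \<omega> \<partial>M)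
        \<le> indicator {0..d} s * ennreal (s powr (- (p / 2)))"
    proof (cases "s \<in> {0<..d}")
      case True
      have "(\<integral>\<^sup>+ \<omega>. ?f s \<omega> \<partial>M)
         = ennreal (s powr (- (p / 2))) * (\<integral>\<^sup>+ \<omega>. ennreal (nsq s \<omega>) \<partial>M)"
        by (simp add: ennreal_mult' nn_integral_cmult)
      also have "\<dots> \<le> ennreal (s powr (- (p / 2))) * 1"
        using True d by (intro mult_left_mono nn_integral_nsq) auto
      finally show ?thesis using True by simp
    qed simp
  qed
  also have "\<dots> = ennreal (?r)"
    using p d by (intro nn_integral_powr_0) auto
  finally have e: "(\<integral>\<^sup>+ \<omega>. edge J p \<omega> \<partial>M) \<le> ennreal (?r)" .
  have "{\<omega>\<in>space M. ennreal y \<le> edge J p \<omega>} = {\<omega>\<in>space M. 1 \<le> ennreal (1 / y) * edge J p \<omega>}"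
  proof (intro Collect_cong conj_cong refl)
    fix \<omega>
    have i: "ennreal (1 / y) * ennreal y = 1" "ennreal y * ennreal (1 / y) = 1"
      using y by (simp_all add: ennreal_mult'[symmetric] ennreal_mult''[symmetric])
    show "(ennreal y \<le> edge J p \<omega>) = (1 \<le> ennreal (1 / y) * edge J p \<omega>)"
    proof
      assume "ennreal y \<le> edge J p \<omega>"
      then have "ennreal (1 / y) * ennreal y \<le> ennreal (1 / y) * edge J p \<omega>" by (rule mult_left_mono) simp
      then show "1 \<le> ennreal (1 / y) * edge J p \<omega>" by (simp only: i)
    next
      assume "1 \<le> ennreal (1 / y) * edge J p \<omega>"
      then have "ennreal y * 1 \<le> ennreal y * (ennreal (1 / y) * edge J p \<omega>)" by (rule mult_left_mono) simp
      then show "ennreal y \<le> edge J p \<omega>" by (simp only: i mult.assoc[symmetric]) simp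
    qed
  qed
  also have "emeasure M \<dots> \<le> ennreal (1 / y) * (\<integral>\<^sup>+ \<omega>. edge J p \<omega> * indicator (space M) \<omega> \<partial>M)"
    by (rule nn_integral_Markov_inequality) auto
  also have "(\<integral>\<^sup>+ \<omega>. edge J p \<omega> * indicator (space M) \<omega> \<partial>M) = (\<integral>\<^sup>+ \<omega>. edge J p \<omega> \<partial>M)"
    by (intro nn_integral_cong) simp
  also have "ennreal (1 / y) * \<dots> \<le> ennreal (1 / y) * ennreal (?r)"
    by (intro mult_left_mono e) simp
  also have "\<dots> = ennreal (d powr (1 - p / 2) / ((1 - p / 2) * y))"
    using y by (simp add: ennreal_mult'[symmetric] mult.commute)
  finally show ?thesis using p y unfolding d_def
    by (subst (asm) emeasure_eq_measure) (simp add: ennreal_le_iff)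
qed

text \<open>One event for all grid offsets: as \<open>cnt\<close> is monotone and the offset is at
  least 1/2, the factor 2 here becomes the cap 4 required in \<open>dyadic_levels\<close>.\<close>

definition good :: "nat \<Rightarrow> 'a set" where
  "good J = {\<omega>\<in>space M. \<forall>j\<in>{1..J}. cnt ((1/2) ^ j) \<omega> \<le> 2 * real N * (1/2) ^ j}"

lemma good_sets [measurable]: "good J \<in> sets M"
  unfolding good_def by measurable

lemma prob_bad: "prob (space M - good J) \<le> 2 ^ Suc J / real N"
proof -
  have "space M - good J = (\<Union>j\<in>{1..J}. {\<omega>\<in>space M. 2 * real N * (1/2) ^ j < cnt ((1/2) ^ j) \<omega>})"
    by (auto simp: good_def not_le)
  also have "prob \<dots> \<le> (\<Sum>j\<in>{1..J}. prob {\<omega>\<in>space M. 2 * real N * (1/2) ^ j < cnt ((1/2) ^ j) \<omega>})"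
    by (intro finite_measure_subadditive_finite) auto
  also have "\<dots> \<le> (\<Sum>j\<in>{1..J}. 1 / (real N * (1/2) ^ j))"
    by (intro sum_mono prob_cnt_large) (auto intro: power_le_one)
  also have "\<dots> = (\<Sum>j\<in>{1..J}. 2 ^ j) / real N"
    unfolding sum_divide_distrib by (intro sum.cong) (auto simp: power_one_over field_simps)
  also have "(\<Sum>j\<in>{1..J}. 2 ^ j) \<le> (2 ^ Suc J :: real)"
    by (induction J) auto
  finally show ?thesis by (simp add: divide_right_mono)
qed

text \<open>A discretisation of \<open>bulk\<close> on the grid with offset \<open>\<tau>\<close>.
  The weight is the scale \<open>2^-j\<close> of a block times its \<open>- (p / 2)\<close>-th
  power; it decreases in \<open>j\<close>, as the recursion over the levels demands.\<close>

definition weighted_nsq :: "nat \<Rightarrow> real \<Rightarrow> real \<Rightarrow> 'a \<Rightarrow> real" where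
  "weighted_nsq J p \<tau> \<omega> = (\<Sum>j=1..J. ((1/2) powr (1 - p / 2)) ^ j * nsq (\<tau> * (1/2) ^ j) \<omega>)"

lemma weighted_nsq_measurable [measurable (raw)]:
  assumes [measurable]: "f \<in> borel_measurable M'" "g \<in> measurable M' M"
  shows "(\<lambda>x. weighted_nsq J p (f x) (g x)) \<in> borel_measurable M'"
  unfolding weighted_nsq_def by measurable

lemma exp_weighted_nsq_le:
  assumes p: "0 \<le> p" "p < 2" and \<kappa>: "0 \<le> \<kappa>" "\<kappa> \<le> 1/96" and \<tau>: "1/2 \<le> \<tau>" "\<tau> \<le> 1"
  shows "(\<integral>\<^sup>+ \<omega>. indicator (good J) \<omega> * ennreal (exp (\<kappa> * weighted_nsq J p \<tau> \<omega>)) \<partial>M)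
    \<le> ennreal (exp (24 * \<kappa> * (\<Sum>j=1..J. ((1/2) powr (1 - p / 2)) ^ j)))"
proof -
  \<comment> \<open>Level 0 gets probability 1 instead of \<open>\<tau>\<close>, since it must
    contain all samples. The first ratio is therefore \<open>\<tau> / 2\<close>, between 1/4 and
    1/2; all later ones are 1/2.\<close>
  define q where "q j = (if j = 0 then 1 else \<tau> * (1/2) ^ j)" for j :: nat
  have q: "0 < q j" "q j \<le> 1" for j
    using \<tau> mult_mono[of \<tau> 1 "(1/2) ^ j" 1] by (auto simp: q_def power_le_one)
  have q_anti: "q (Suc j) \<le> q j / 2" "q j / 4 \<le> q (Suc j)" for j
    using \<tau> by (auto simp: q_def)
  have q_dec: "q j \<le> q i" if "i \<le> j" for i j
    by (rule lift_Suc_antimono_le[OF _ that]) (smt (verit) q q_anti field_sum_of_halves)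
  \<comment> \<open>The sets \<open>T (q j)\<close> decrease in \<open>j\<close>, so the number of
    them that contain the sample is the index of the last one.\<close>
  define L where "L i \<omega> = card {j\<in>{1..J}. U i \<omega> \<in> T (q j)}" for i \<omega>
  have level: "j \<le> L i \<omega> \<longleftrightarrow> U i \<omega> \<in> T (q j)" if j: "j \<in> {1..J}" for i j \<omega>
  proof
    assume "U i \<omega> \<in> T (q j)"
    then have "U i \<omega> \<in> T (q k)" if "k \<le> j" for k using T_mono[OF q_dec[OF that]] by blast
    then have "{1..j} \<subseteq> {j\<in>{1..J}. U i \<omega> \<in> T (q j)}" using j by auto
    then have "card {1..j} \<le> L i \<omega>" unfolding L_def by (intro card_mono) auto
    then show "j \<le> L i \<omega>" by simp
  next
    assume le: "j \<le> L i \<omega>"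
    show "U i \<omega> \<in> T (q j)"
    proof (rule ccontr)
      assume "U i \<omega> \<notin> T (q j)"
      then have "U i \<omega> \<notin> T (q k)" if "j \<le> k" for k using T_mono[OF q_dec[OF that]] by blast
      then have "{j\<in>{1..J}. U i \<omega> \<in> T (q j)} \<subseteq> {1..<j}" by (auto simp: not_le[symmetric])
      then have "L i \<omega> \<le> card {1..<j}" unfolding L_def by (intro card_mono) auto
      then show False using le j by auto
    qed
  qed
  have Tq: "T (q j) \<in> sets borel" for j using q[of j] by (intro T_borel) auto
  have "(\<lambda>x. card {j\<in>{1..J}. x \<in> T (q j)}) \<in> measurable borel (count_space UNIV)"
    using Tq by measurable
  then have indL: "indep_vars (\<lambda>_. count_space UNIV) L {1..N}"
    unfolding L_def[abs_def] by (intro indep_vars_compose2[OF ind, of "\<lambda>_ x. card {j\<in>{1..J}. x \<in> T (q j)}"])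
  interpret D: dyadic_levels M "{1..N}" L q J
  proof
    show "finite {1..N}" "{1..N} \<noteq> {}" using N by auto
    show "prob {\<omega>\<in>space M. j \<le> L i \<omega>} = q j" if "i \<in> {1..N}" "j \<le> J" for i j
      using that level[of j i] prob_T[of i "q j"] q[of j]
      by (cases "j = 0") (auto simp: q_def prob_space)
  qed (use indL q q_anti in auto)
  define w where "w j = ((1/2) powr (1 - p / 2)) ^ j" for j :: nat
  have r: "0 \<le> (1/2) powr (1 - p / 2)" "(1/2) powr (1 - p / 2) \<le> (1::real)"
    using p powr_le1[of "1 - p / 2" "1/2"] by auto
  have w: "antimono w" "0 \<le> w j" "w j \<le> 1" for j
    using r by (auto simp: w_def antimono_def power_decreasing power_le_one)
  have count: "D.count j (\<lambda>i. L i \<omega>) = cnt (q j) \<omega>" if "j \<in> {1..J}" for j \<omega>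
    unfolding D.count_def cnt_def level[OF that]
    by (simp add: indicator_def sum.If_cases Int_def conj_commute)
  have dev: "(D.dev j (\<lambda>i. L i \<omega>))\<^sup>2 = nsq (\<tau> * (1/2) ^ j) \<omega>" if "j \<in> {1..J}" for j \<omega>
  proof -
    have "(D.dev j (\<lambda>i. L i \<omega>))\<^sup>2 = nsq (q j) \<omega>"
      using q[of j] unfolding D.dev_def nsq_def count[OF that] by (simp add: power_divide)
    then show ?thesis using that by (simp add: q_def)
  qed
  have sum: "weighted_nsq J p \<tau> \<omega> = (\<Sum>j=1..J. w j * (D.dev j (\<lambda>i. L i \<omega>))\<^sup>2)" for \<omega>
    unfolding weighted_nsq_def w_def by (intro sum.cong refl, subst dev) auto
  have "(\<integral>\<^sup>+ \<omega>. indicator (good J) \<omega> * ennreal (exp (\<kappa> * weighted_nsq J p \<tau> \<omega>)) \<partial>M)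
    \<le> (\<integral>\<^sup>+ \<omega>. indicator {f. \<forall>j\<le>J. D.count j f \<le> 4 * real (card {1..N}) * q j} (\<lambda>i. L i \<omega>) *
       ennreal (exp (\<kappa> * (\<Sum>j=1..J. w j * (D.dev j (\<lambda>i. L i \<omega>))\<^sup>2) + 0 * (D.dev J (\<lambda>i. L i \<omega>))\<^sup>2)) \<partial>M)"
  proof (intro nn_integral_mono mult_mono)
    fix \<omega>
    have "D.count j (\<lambda>i. L i \<omega>) \<le> 4 * real N * q j" if g: "\<omega> \<in> good J" and j: "j \<le> J" for j
    proof (cases "j = 0")
      case True
      have "{i\<in>{1..N}. 0 \<le> L i \<omega>} = {1..N}" by auto
      then show ?thesis using True unfolding D.count_def q_def by (simp only:) simp
    next
      case False
      have "(1/2) ^ j \<le> 2 * q j" "q j \<le> (1/2) ^ j" using False \<tau> by (auto simp: q_def)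
      have "cnt (q j) \<omega> \<le> cnt ((1/2) ^ j) \<omega>" by (rule cnt_mono) fact
      also have "\<dots> \<le> 2 * real N * (1/2) ^ j" using g j False by (auto simp: good_def)
      also have "\<dots> \<le> 2 * real N * (2 * q j)" by (intro mult_left_mono) (fact, simp)
      finally show ?thesis using count[of j \<omega>] j False by simp
    qed
    then show "indicator (good J) \<omega> \<le> (indicator {f. \<forall>j\<le>J. D.count j f \<le> 4 * real (card {1..N}) * q j} (\<lambda>i. L i \<omega>) :: ennreal)"
      by (auto simp: indicator_def)
  qed (auto simp: sum)
  also have "\<dots> \<le> ennreal (exp (24 * \<kappa> * (\<Sum>j=1..J. w j)))"
    by (rule D.exp_weighted_deviation_le) (use w \<kappa> in \<open>auto simp: q_def\<close>)
  finally show ?thesis by (simp add: w_def)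
qed

text \<open>The substitution \<open>s = \<tau> * (1/2) ^ j\<close> maps every dyadic block to the
  same offset interval, on which \<open>2 * indicator {1/2<..1}\<close> is the uniform density. The
  remaining factor \<open>\<tau> powr (- (p / 2))\<close> is at most 2.\<close>

lemma bulk_le_average:
  assumes p: "0 \<le> p" "p < 2" and \<omega>: "\<omega> \<in> space M"
  shows "bulk J p \<omega> \<le> (\<integral>\<^sup>+ \<tau>. 2 * indicator {1/2<..1} \<tau> * ennreal (weighted_nsq J p \<tau> \<omega>) \<partial>lborel)"
proof -
  have [measurable]: "(\<lambda>s. nsq s \<omega>) \<in> borel_measurable borel" using \<omega> by measurable
  define f where "f s = ennreal (s powr (- (p / 2)) * nsq s \<omega>)" for s
  have f [measurable]: "f \<in> borel_measurable borel" unfolding f_def by measurable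
  let ?I = "\<lambda>j. {(1/2) ^ Suc j<..(1/2::real) ^ j}"
  let ?g = "\<lambda>j \<tau>. 2 * indicator {1/2<..1} \<tau> * ennreal (((1/2) powr (1 - p / 2)) ^ j * nsq (\<tau> * (1/2) ^ j) \<omega>)"
  have split: "{(1/2) ^ Suc J<..1/2} = (\<Union>j\<in>{1..J}. (?I j))"
  proof (induction J)
    case (Suc J)
    have "(1/2) ^ Suc (Suc J) \<le> (1/2::real) ^ Suc J" "(1/2) ^ Suc J \<le> (1/2::real)"
      using power_decreasing[of 1 "Suc J" "1/2::real"] by simp_all
    then have "{(1/2) ^ Suc (Suc J)<..1/2} = {(1/2) ^ Suc (Suc J)<..(1/2) ^ Suc J} \<union> {(1/2) ^ Suc J<..1/2::real}"
      by (rule greaterThanAtMost_split)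
    then show ?case unfolding Suc by (auto simp: atLeastAtMostSuc_conv)
  qed simp
  have "bulk J p \<omega> \<le> (\<integral>\<^sup>+ s. (\<Sum>j=1..J. indicator (?I j) s * f s) \<partial>lborel)"
    unfolding bulk_def f_def[symmetric] sum_distrib_right[symmetric] split
  proof (intro nn_integral_mono mult_right_mono)
    fix s :: real
    show "indicator (\<Union>j\<in>{1..J}. (?I j)) s
      \<le> (\<Sum>j=1..J. indicator (?I j) s :: ennreal)"
    proof (cases "s \<in> (\<Union>j\<in>{1..J}. (?I j))")
      case True
      then obtain j where j: "j \<in> {1..J}" "s \<in> (?I j)" by blast
      have "indicator (?I j) s \<le> (\<Sum>j=1..J. indicator (?I j) s :: ennreal)"
        using j(1) by (intro member_le_sum) auto
      then show ?thesis by (simp only: indicator_simps(1)[OF True] indicator_simps(1)[OF j(2)])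
    qed simp
  qed simp
  also have "\<dots> = (\<Sum>j=1..J. \<integral>\<^sup>+ s. indicator (?I j) s * f s \<partial>lborel)"
    by (intro nn_integral_sum) measurable
  also have "\<dots> \<le> (\<Sum>j=1..J. \<integral>\<^sup>+ \<tau>. ?g j \<tau> \<partial>lborel)"
  proof (intro sum_mono)
    fix j assume j: "j \<in> {1..J}"
    define c where "c = (1/2::real) ^ j"
    have c: "0 < c" by (simp add: c_def)
    have "(\<integral>\<^sup>+ s. indicator (?I j) s * f s \<partial>lborel)
      = ennreal \<bar>c\<bar> * (\<integral>\<^sup>+ \<tau>. indicator (?I j) (0 + c * \<tau>) * f (0 + c * \<tau>) \<partial>lborel)"
      using c by (intro nn_integral_real_affine) auto
    also have "\<dots> = (\<integral>\<^sup>+ \<tau>. ennreal c * (indicator (?I j) (c * \<tau>) * f (c * \<tau>)) \<partial>lborel)"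
      using c by (subst nn_integral_cmult) auto
    also have "\<dots> \<le> (\<integral>\<^sup>+ \<tau>. ?g j \<tau> \<partial>lborel)"
    proof (intro nn_integral_mono)
      fix \<tau> :: real
      show "ennreal c * (indicator (?I j) (c * \<tau>) * f (c * \<tau>))
        \<le> ?g j \<tau>"
      proof (cases "c * \<tau> \<in> (?I j)")
        case True
        then have t: "1/2 < \<tau>" "\<tau> \<le> 1" using c by (auto simp: c_def)
        have n: "0 \<le> nsq (\<tau> * (1/2) ^ j) \<omega>" using t by (intro nsq_nonneg) simp
        have "c * (c * \<tau>) powr (- (p / 2)) = c powr (1 - p / 2) * \<tau> powr (- (p / 2))"
          using c t by (simp add: powr_mult powr_diff powr_minus_divide)
        also have "\<tau> powr (- (p / 2)) \<le> (1/2) powr (- (p / 2))"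
          using t p by (intro powr_mono2') auto
        also have "(1/2) powr (- (p / 2)) \<le> (1/2 :: real) powr (- 1)"
          using p by (intro powr_mono') auto
        also have "c powr (1 - p / 2) = ((1/2) powr (1 - p / 2)) ^ j"
          unfolding c_def by (simp add: powr_power powr_realpow[symmetric] powr_powr mult.commute)
        finally have "c * (c * \<tau>) powr (- (p / 2)) \<le> 2 * ((1/2) powr (1 - p / 2)) ^ j"
          by (simp add: mult_left_mono powr_minus_divide)
        then have "c * (c * \<tau>) powr (- (p / 2)) * nsq (\<tau> * (1/2) ^ j) \<omega> \<le> 2 * ((1/2) powr (1 - p / 2)) ^ j * nsq (\<tau> * (1/2) ^ j) \<omega>"
          using n by (rule mult_right_mono)
        then have "ennreal (c * ((c * \<tau>) powr (- (p / 2)) * nsq (c * \<tau>) \<omega>)) \<le> ennreal (2 * (((1/2) powr (1 - p / 2)) ^ j * nsq (\<tau> * (1/2) ^ j) \<omega>))"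
          by (intro ennreal_leI) (simp add: c_def mult_ac)
        then show ?thesis using True t c by (simp add: f_def ennreal_mult')
      qed simp
    qed
    finally show "(\<integral>\<^sup>+ s. indicator (?I j) s * f s \<partial>lborel)
      \<le> (\<integral>\<^sup>+ \<tau>. ?g j \<tau> \<partial>lborel)" .
  qed
  also have "\<dots> = (\<integral>\<^sup>+ \<tau>. (\<Sum>j=1..J. ?g j \<tau>) \<partial>lborel)"
    by (intro nn_integral_sum[symmetric]) measurable
  also have "\<dots> = (\<integral>\<^sup>+ \<tau>. 2 * indicator {1/2<..1} \<tau> * ennreal (weighted_nsq J p \<tau> \<omega>) \<partial>lborel)"
  proof (intro nn_integral_cong)
    fix \<tau> :: real
    show "(\<Sum>j=1..J. ?g j \<tau>)
      = 2 * indicator {1/2<..1} \<tau> * ennreal (weighted_nsq J p \<tau> \<omega>)"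
    proof (cases "\<tau> \<in> {1/2<..1}")
      case True
      then show ?thesis
        unfolding weighted_nsq_def sum_distrib_left[symmetric]
        by (subst sum_ennreal) (auto intro!: mult_nonneg_nonneg nsq_nonneg)
    qed simp
  qed
  finally show ?thesis .
qed

end

text \<open>With \<open>t = 1 - p / 2\<close> the ratio is \<open>r = 2^(-t)\<close>. As
  \<open>ln 2 \<ge> 1/2\<close>, \<open>1 / r \<ge> 1 + t / 2\<close>, and so
  \<open>r / (1 - r) \<le> 2 / t\<close>.\<close>

lemma sum_geometric_half_le:
  fixes p :: real
  assumes p: "p < 2"
  shows "(\<Sum>j=1..J. ((1/2) powr (1 - p / 2)) ^ j) \<le> 4 / (2 - p)"
proof -
  define t where "t = 1 - p / 2"
  have t: "0 < t" using p by (simp add: t_def)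
  define r :: real where "r = (1/2) powr t"
  have r: "0 < r" "r < 1" using t powr_less_mono2[of t "1/2" 1] by (auto simp: r_def)
  have "1 + t / 2 \<le> 1 / r"
  proof -
    have "1/2 \<le> ln (2::real)" using ln_add_one_self_le_self[of "-1/2"] ln_le_minus_one[of "1/2::real"] by (simp add: ln_div)
    then have "1 + t / 2 \<le> 1 + t * ln 2" using t by simp
    also have "\<dots> \<le> exp (t * ln 2)" by simp
    also have "\<dots> = 1 / r" by (simp add: r_def powr_def ln_div exp_minus inverse_eq_divide)
    finally show ?thesis .
  qed
  then have "t / 2 * r \<le> 1 - r" using r by (simp add: field_simps)
  have "(\<Sum>j=1..J. r ^ j) \<le> r / (1 - r)"
  proof -
    have "(\<Sum>j=1..J. r ^ j) = r * (\<Sum>j<J. r ^ j)"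
      unfolding sum_distrib_left by (rule sum.reindex_bij_witness[of _ Suc "\<lambda>j. j - 1"]) (auto simp: power_eq_if)
    also have "(\<Sum>j<J. r ^ j) = (1 - r ^ J) / (1 - r)" using r by (simp add: sum_gp_strict)
    also have "r * \<dots> \<le> r * (1 / (1 - r))" using r by (intro mult_left_mono divide_right_mono) auto
    finally show ?thesis by simp
  qed
  also have "\<dots> \<le> 2 / t" using \<open>t / 2 * r \<le> 1 - r\<close> r t by (simp add: field_simps)
  also have "\<dots> = 4 / (2 - p)" using p by (simp add: t_def field_simps)
  finally show ?thesis by (simp add: r_def t_def)
qed

text \<open>A form of Jensen's inequality that needs no integrability.\<close>

lemma exp_average_ge:
  fixes X :: "real \<Rightarrow> real"
  assumes [measurable]: "X \<in> borel_measurable borel" and X: "\<And>\<tau>. 1/2 < \<tau> \<Longrightarrow> \<tau> \<le> 1 \<Longrightarrow> 0 \<le> X \<tau>"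
    and \<kappa>: "0 \<le> \<kappa>" and y: "0 \<le> y"
    and avg: "ennreal y \<le> (\<integral>\<^sup>+ \<tau>. 2 * indicator {1/2<..1} \<tau> * ennreal (X \<tau>) \<partial>lborel)"
  shows "ennreal (exp (\<kappa> * y)) \<le> (\<integral>\<^sup>+ \<tau>. 2 * indicator {1/2<..1} \<tau> * ennreal (exp (\<kappa> * X \<tau>)) \<partial>lborel)"
proof -
  let ?I = "\<lambda>f. \<integral>\<^sup>+ \<tau>. 2 * indicator {1/2<..1::real} \<tau> * (f \<tau> :: ennreal) \<partial>lborel"
  define e where "e = exp (\<kappa> * y)"
  let ?y = "ennreal (e * \<kappa> * y)" and ?X = "\<lambda>\<tau>. ennreal (e * \<kappa>) * ennreal (X \<tau>)"
  let ?Y = "\<lambda>\<tau>. ennreal (exp (\<kappa> * X \<tau>))"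
  have e: "0 < e" by (simp add: e_def)
  have const: "?I (\<lambda>_. c) = c" for c
  proof -
    have "?I (\<lambda>_. c) = (\<integral>\<^sup>+ \<tau>. (2 * c) * indicator {1/2<..1::real} \<tau> \<partial>lborel)"
      by (intro nn_integral_cong) (simp add: mult_ac)
    also have "\<dots> = 2 * c * ennreal (1/2)" by (simp add: nn_integral_cmult_indicator)
    also have "\<dots> = c * (ennreal 2 * ennreal (1/2))" by (simp only: mult_ac ennreal_numeral)
    also have "ennreal 2 * ennreal (1/2) = 1" by (subst ennreal_mult'[symmetric]) auto
    finally show ?thesis by simp
  qed
  have "ennreal e + ?y \<le> ennreal e + ennreal (e * \<kappa>) * ?I (\<lambda>\<tau>. ennreal (X \<tau>))"
    using e \<kappa> avg by (simp add: ennreal_mult' add_left_mono mult_left_mono)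
  also have "\<dots> = ?I (\<lambda>\<tau>. ennreal e) + ?I (\<lambda>\<tau>. ?X \<tau>)"
    unfolding const by (subst nn_integral_cmult[symmetric]) (auto simp: mult_ac)
  also have "\<dots> = ?I (\<lambda>\<tau>. ennreal e + ?X \<tau>)"
    by (subst nn_integral_add[symmetric]) (auto simp: distrib_left)
  also have "\<dots> \<le> ?I (\<lambda>\<tau>. ?Y \<tau> + ?y)"
  proof (intro nn_integral_mono)
    fix \<tau> :: real
    show "2 * indicator {1/2<..1} \<tau> * (ennreal e + ?X \<tau>)
      \<le> 2 * indicator {1/2<..1} \<tau> * (?Y \<tau> + ?y)"
    proof (cases "\<tau> \<in> {1/2<..1}")
      case True
      then have X0: "0 \<le> X \<tau>" using X by simp
      \<comment> \<open>The tangent of the exponential at \<open>\<kappa> * y\<close>. The term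
        \<open>e * \<kappa> * y\<close> is kept on the other side and cancelled at the end, which
        avoids subtraction in \<open>ennreal\<close>.\<close>
      have "e * (1 + \<kappa> * (X \<tau> - y)) \<le> e * exp (\<kappa> * (X \<tau> - y))" using e by (intro mult_left_mono) auto
      also have "\<dots> = exp (\<kappa> * X \<tau>)" by (simp add: e_def algebra_simps flip: exp_add)
      finally have "e + e * \<kappa> * X \<tau> \<le> exp (\<kappa> * X \<tau>) + e * \<kappa> * y" by (simp add: algebra_simps)
      then have "ennreal (e + e * \<kappa> * X \<tau>) \<le> ennreal (exp (\<kappa> * X \<tau>) + e * \<kappa> * y)" by (rule ennreal_leI)
      also have "\<dots> = ?Y \<tau> + ?y"
        using e \<kappa> y by (intro ennreal_plus) auto
      also have "ennreal (e + e * \<kappa> * X \<tau>) = ennreal e + ?X \<tau>"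
        using e \<kappa> X0 by (simp add: ennreal_plus ennreal_mult')
      finally show ?thesis by (intro mult_left_mono) auto
    qed simp
  qed
  also have "\<dots> = ?I (\<lambda>\<tau>. ?Y \<tau>) + ?I (\<lambda>_. ?y)"
    by (subst nn_integral_add[symmetric]) (auto simp: distrib_left)
  finally have "ennreal e + ?y \<le> ?I (\<lambda>\<tau>. ?Y \<tau>) + ?y"
    unfolding const .
  then show ?thesis unfolding e_def[symmetric] by (simp add: ennreal_add_left_cancel_le add.commute[of _ "?y"])
qed

context nested_sample
begin

text \<open>Exponential Markov inequality on \<open>good J\<close>. Jensen takes the average over
  the offset out of the exponential before expectations are taken, so each offset needs only its own
  grid. The choice 1/96 is the largest \<open>\<kappa>\<close> allowed by the recursion, and
  \<open>24 * (1/96) * 4 / (2 - p)\<close> is the exponent \<open>1 / (2 - p)\<close>.\<close>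

lemma bulk_tail:
  assumes p: "0 \<le> p" "p < 2" and y: "0 \<le> y"
  shows "prob {\<omega>\<in>space M. ennreal y \<le> bulk J p \<omega>} \<le> 2 ^ Suc J / real N + exp (1 / (2 - p) - y / 96)"
proof -
  interpret P: pair_sigma_finite M "lborel :: real measure"
    by (intro pair_sigma_finite.intro sigma_finite_measure_axioms sigma_finite_lborel)
  define \<kappa> :: real where "\<kappa> = 1/96"
  let ?h = "\<lambda>\<omega> \<tau>. 2 * indicator {1/2<..1} \<tau> * (indicator (good J) \<omega> * ennreal (exp (\<kappa> * weighted_nsq J p \<tau> \<omega>)))"
  define C where "C = exp (1 / (2 - p))"
  define A where "A = good J \<inter> {\<omega>\<in>space M. ennreal y \<le> bulk J p \<omega>}"
  have A [measurable]: "A \<in> sets M" unfolding A_def by measurable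
  have "ennreal (exp (\<kappa> * y)) * emeasure M A = (\<integral>\<^sup>+ \<omega>. ennreal (exp (\<kappa> * y)) * indicator A \<omega> \<partial>M)"
    by (simp add: nn_integral_cmult_indicator)
  also have "\<dots> \<le> (\<integral>\<^sup>+ \<omega>. \<integral>\<^sup>+ \<tau>. ?h \<omega> \<tau> \<partial>lborel \<partial>M)"
  proof (intro nn_integral_mono)
    fix \<omega> assume \<omega>: "\<omega> \<in> space M"
    show "ennreal (exp (\<kappa> * y)) * indicator A \<omega>
      \<le> (\<integral>\<^sup>+ \<tau>. ?h \<omega> \<tau> \<partial>lborel)"
    proof (cases "\<omega> \<in> A")
      case True
      have "ennreal (exp (\<kappa> * y)) \<le> (\<integral>\<^sup>+ \<tau>. 2 * indicator {1/2<..1} \<tau> * ennreal (exp (\<kappa> * weighted_nsq J p \<tau> \<omega>)) \<partial>lborel)"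
      proof (rule exp_average_ge)
        show "(\<lambda>\<tau>. weighted_nsq J p \<tau> \<omega>) \<in> borel_measurable borel" using \<omega> by measurable
        show "ennreal y \<le> (\<integral>\<^sup>+ \<tau>. 2 * indicator {1/2<..1} \<tau> * ennreal (weighted_nsq J p \<tau> \<omega>) \<partial>lborel)"
          using True bulk_le_average[OF p \<omega>, of J] by (auto simp: A_def intro: order_trans)
        show "0 \<le> weighted_nsq J p \<tau> \<omega>" if "1/2 < \<tau>" "\<tau> \<le> 1" for \<tau>
          unfolding weighted_nsq_def using that by (intro sum_nonneg mult_nonneg_nonneg nsq_nonneg) auto
      qed (use y in \<open>auto simp: \<kappa>_def\<close>)
      then show ?thesis using True by (simp add: A_def)
    qed simp
  qed
  also have "\<dots> = (\<integral>\<^sup>+ \<tau>. \<integral>\<^sup>+ \<omega>. ?h \<omega> \<tau> \<partial>M \<partial>lborel)"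
    by (rule P.Fubini'[symmetric]) measurable
  also have "\<dots> \<le> (\<integral>\<^sup>+ \<tau>. (2 * ennreal C) * indicator {1/2<..1::real} \<tau> \<partial>lborel)"
  proof (intro nn_integral_mono)
    fix \<tau> :: real
    show "(\<integral>\<^sup>+ \<omega>. ?h \<omega> \<tau> \<partial>M)
      \<le> (2 * ennreal C) * indicator {1/2<..1} \<tau>"
    proof (cases "\<tau> \<in> {1/2<..1}")
      case True
      have "(\<integral>\<^sup>+ \<omega>. indicator (good J) \<omega> * ennreal (exp (\<kappa> * weighted_nsq J p \<tau> \<omega>)) \<partial>M)
        \<le> ennreal (exp (24 * \<kappa> * (\<Sum>j=1..J. ((1/2) powr (1 - p / 2)) ^ j)))"
        using True p by (intro exp_weighted_nsq_le) (auto simp: \<kappa>_def)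
      also have "\<dots> \<le> ennreal C"
        using sum_geometric_half_le[OF p(2), of J] unfolding C_def \<kappa>_def
        by (intro ennreal_leI) simp
      finally show ?thesis using True by (simp add: nn_integral_cmult mult_left_mono)
    qed simp
  qed
  also have "\<dots> = 2 * ennreal C * ennreal (1/2)" by (simp add: nn_integral_cmult_indicator)
  also have "\<dots> = ennreal C * (ennreal 2 * ennreal (1/2))" by (simp only: mult_ac ennreal_numeral)
  also have "ennreal 2 * ennreal (1/2) = 1" by (subst ennreal_mult'[symmetric]) auto
  finally have "ennreal (exp (\<kappa> * y) * prob A) \<le> ennreal C"
    by (simp add: emeasure_eq_measure ennreal_mult')
  then have "exp (\<kappa> * y) * prob A \<le> C" by (simp add: C_def ennreal_le_iff)
  then have PA: "prob A \<le> exp (1 / (2 - p) - y / 96)"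
  proof -
    have "exp (1 / (2 - p) - y / 96) = C / exp (\<kappa> * y)" by (simp add: C_def \<kappa>_def exp_diff)
    then show ?thesis using \<open>exp (\<kappa> * y) * prob A \<le> C\<close> by (simp add: pos_le_divide_eq mult.commute)
  qed
  have "prob {\<omega>\<in>space M. ennreal y \<le> bulk J p \<omega>} \<le> prob ((space M - good J) \<union> A)"
    by (intro finite_measure_mono) (auto simp: A_def)
  also have "\<dots> \<le> prob (space M - good J) + prob A" by (intro measure_Un_le) auto
  finally show ?thesis using prob_bad[of J] PA by linarith
qed

definition half :: "real \<Rightarrow> 'a \<Rightarrow> ennreal" where
  "half p \<omega> = (\<integral>\<^sup>+ s. indicator {0<..1/2} s * ennreal (s powr (- (p / 2)) * nsq s \<omega>) \<partial>lborel)"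

lemma half_measurable [measurable]: "half p \<in> borel_measurable M"
  unfolding half_def by measurable

lemma half_eq:
  assumes "\<omega> \<in> space M"
  shows "half p \<omega> = edge J p \<omega> + bulk J p \<omega>"
proof -
  have [measurable]: "(\<lambda>s. nsq s \<omega>) \<in> borel_measurable borel" using assms by measurable
  define d :: real where "d = (1/2) ^ Suc J"
  have d: "0 < d" "d \<le> 1/2" using power_decreasing[of 1 "Suc J" "1/2::real"] by (simp_all add: d_def)
  have "indicator {0<..1/2} s = (indicator {0<..d} s + indicator {d<..1/2} s :: ennreal)" for s
    using d by (auto simp: indicator_def)
  then show ?thesis
    unfolding half_def edge_def bulk_def d_def[symmetric]
    by (simp add: distrib_right nn_integral_add)
qed

lemma half_tail:
  assumes p: "0 \<le> p" "p < 2" and y: "0 < y"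
  shows "prob {\<omega>\<in>space M. ennreal (2 * y) \<le> half p \<omega>}
    \<le> ((1/2) ^ Suc J) powr (1 - p / 2) / ((1 - p / 2) * y) + 2 ^ Suc J / real N + exp (1 / (2 - p) - y / 96)"
proof -
  have "ennreal y \<le> edge J p \<omega> \<or> ennreal y \<le> bulk J p \<omega>" if "\<omega> \<in> space M" "ennreal (2 * y) \<le> half p \<omega>" for \<omega>
  proof (rule ccontr)
    assume "\<not> ?thesis"
    then have "edge J p \<omega> + bulk J p \<omega> < ennreal (y + y)" by (intro add_mono_ennreal) auto
    then show False using that half_eq by simp
  qed
  then have "prob {\<omega>\<in>space M. ennreal (2 * y) \<le> half p \<omega>}
     \<le> prob ({\<omega>\<in>space M. ennreal y \<le> edge J p \<omega>} \<union> {\<omega>\<in>space M. ennreal y \<le> bulk J p \<omega>})"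
    by (intro finite_measure_mono) auto
  also have "\<dots> \<le> prob {\<omega>\<in>space M. ennreal y \<le> edge J p \<omega>} + prob {\<omega>\<in>space M. ennreal y \<le> bulk J p \<omega>}"
    by (intro measure_Un_le) auto
  finally show ?thesis using edge_tail[OF p y, of J] bulk_tail[OF p, of y J] y by linarith
qed

text \<open>For \<open>p \<le> 2\<close>, \<open>v ^ p \<le> c ^ p + c ^ (p - 2) v\<^sup>2\<close> trades the \<open>p\<close>-th moment for the second one. Choosing \<open>c\<close> of the
  order of the mean keeps the resulting exponent proportional to the threshold, uniformly in \<open>p\<close>.\<close>

lemma half_moment_le:
  assumes p: "1 \<le> p" "p < 2" and c: "0 < c" and \<omega>: "\<omega> \<in> space M"
  shows "(\<integral>\<^sup>+ s. indicator {0<..1/2} s * ennreal ((\<bar>cnt s \<omega> - real N * s\<bar> / sqrt (real N) / (s * (1 - s))) powr p) \<partial>lborel)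
    \<le> ennreal (8 * c powr p / (2 - p)) + ennreal (4 * c powr (p - 2)) * half p \<omega>"
proof -
  have [measurable]: "(\<lambda>s. nsq s \<omega>) \<in> borel_measurable borel" using \<omega> by measurable
  let ?C = "ennreal (4 * c powr (p - 2))" and ?A = "ennreal (4 * c powr p)"
  let ?v = "\<lambda>s. s powr (- (p / 2))"
  let ?z = "\<lambda>s. \<bar>cnt s \<omega> - real N * s\<bar> / sqrt (real N) / (s * (1 - s))"
  let ?w = "\<lambda>s. ?v s * nsq s \<omega>"
  have "(\<integral>\<^sup>+ s. indicator {0<..1/2} s * ennreal ((?z s) powr p) \<partial>lborel)
    \<le> (\<integral>\<^sup>+ s. ?A * (indicator {0..1/2} s * ennreal (?v s))
        + ?C * (indicator {0<..1/2} s * ennreal (?w s)) \<partial>lborel)"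
  proof (intro nn_integral_mono)
    fix s :: real
    show "indicator {0<..1/2} s * ennreal ((?z s) powr p)
      \<le> ?A * (indicator {0..1/2} s * ennreal (?v s))
        + ?C * (indicator {0<..1/2} s * ennreal (?w s))"
    proof (cases "s \<in> {0<..1/2}")
      case True
      then have s: "0 < s" "s \<le> 1/2" by auto
      define v where "v = \<bar>cnt s \<omega> - real N * s\<bar> / sqrt (real N * s)"
      have v: "0 \<le> v" using s by (simp add: v_def)
      have v2: "v\<^sup>2 = nsq s \<omega>" using s by (simp add: v_def nsq_def power_divide)
      have vp: "v powr p \<le> c powr p + c powr (p - 2) * v\<^sup>2"
      proof (cases "v \<le> c")
        case True
        then have "v powr p \<le> c powr p" using v p by (intro powr_mono2) auto
        then show ?thesis by (simp add: add_increasing2)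
      next
        case False
        then have v0: "0 < v" using c by simp
        have "v powr p = v powr (p - 2) * v\<^sup>2" using v0 by (simp add: powr_diff powr_numeral)
        also have "v powr (p - 2) \<le> c powr (p - 2)" using False c p by (intro powr_mono2') auto
        finally show ?thesis by (simp add: add_increasing mult_right_mono)
      qed
      have e: "?z s = v * s powr (- (1/2)) * (1 / (1 - s))"
      proof -
        have "sqrt s * sqrt s = s" "s powr (- (1/2)) = 1 / sqrt s"
          using s by (simp_all add: powr_minus_divide powr_half_sqrt)
        moreover have "x / a / (q * q * b) = x / (a * q) * (1 / q) * (1 / b)" for x a q b :: real by simp
        ultimately show ?thesis unfolding v_def real_sqrt_mult by metis
      qed
      have "(?z s) powr p
         = v powr p * ?v s * (1 / (1 - s)) powr p"
      proof -
        have "(v * x * z) powr p = v powr p * x powr p * z powr p" if "0 \<le> x" "0 \<le> z" for x z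
          using v that by (simp add: powr_mult)
        moreover have "(s powr (- (1/2))) powr p = ?v s" by (simp add: powr_powr)
        moreover have "0 \<le> 1 / (1 - s)" using s by simp
        ultimately show ?thesis unfolding e by (metis powr_ge_zero)
      qed
      also have "(1 / (1 - s)) powr p \<le> 2 powr p"
        using s p by (intro powr_mono2) (auto simp: field_simps)
      also have "2 powr p \<le> (2 powr 2 :: real)" using p by (intro powr_mono) auto
      also have "v powr p * ?v s * 2 powr 2 \<le> (c powr p + c powr (p - 2) * v\<^sup>2) * ?v s * 2 powr 2"
        by (intro mult_right_mono vp) auto
      also have "\<dots> = 4 * c powr p * ?v s + 4 * c powr (p - 2) * (?w s)"
        by (simp add: v2 algebra_simps)
      finally have "(?z s) powr p
         \<le> 4 * c powr p * ?v s + 4 * c powr (p - 2) * (?w s)"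
        by (simp add: mult_left_mono)
      then have "ennreal ((?z s) powr p)
         \<le> ennreal (4 * c powr p * ?v s + 4 * c powr (p - 2) * (?w s))"
        by (rule ennreal_leI)
      also have "\<dots> = ennreal (4 * c powr p * ?v s) + ennreal (4 * c powr (p - 2) * (?w s))"
        using nsq_nonneg[of s \<omega>] s by (intro ennreal_plus) auto
      also have "\<dots> = ?A * ennreal (?v s) + ?C * ennreal (?w s)"
        using nsq_nonneg[of s \<omega>] s by (subst (1 2) ennreal_mult') auto
      finally show ?thesis using s by simp
    qed simp
  qed
  also have "\<dots> = ?A * (\<integral>\<^sup>+ s. indicator {0..1/2} s * ennreal (?v s) \<partial>lborel)
      + ?C * half p \<omega>"
    unfolding half_def by (subst nn_integral_add) (auto simp: nn_integral_cmult)
  also have "(\<integral>\<^sup>+ s. indicator {0..1/2} s * ennreal (?v s) \<partial>lborel) = ennreal ((1/2) powr (1 - p / 2) / (1 - p / 2))"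
    using p by (intro nn_integral_powr_0) auto
  also have "?A * \<dots> \<le> ennreal (8 * c powr p / (2 - p))"
  proof -
    have "(1/2) powr (1 - p / 2) \<le> (1::real)" using p by (intro powr_le1) auto
    then have "(1/2) powr (1 - p / 2) / (1 - p / 2) \<le> 1 / (1 - p / 2)"
      using p by (intro divide_right_mono) auto
    also have "\<dots> = 2 / (2 - p)" using p by (simp add: field_simps)
    finally have "4 * c powr p * ((1/2) powr (1 - p / 2) / (1 - p / 2)) \<le> 4 * c powr p * (2 / (2 - p))"
      by (intro mult_left_mono) auto
    then show ?thesis by (subst ennreal_mult'[symmetric]) (auto intro!: ennreal_leI simp: mult_ac)
  qed
  finally show ?thesis by (simp add: add_right_mono)
qed

end

section \<open>Both halves of the uniform empirical process together\<close>

locale uniform_sample = prob_space +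
  fixes U :: "nat \<Rightarrow> 'a \<Rightarrow> real" and N :: nat
  assumes N_pos: "0 < N"
    and indep: "indep_vars (\<lambda>_. borel) U {1..N}"
    and uniform: "\<And>i s. i \<in> {1..N} \<Longrightarrow> 0 \<le> s \<Longrightarrow> s \<le> 1 \<Longrightarrow> prob {\<omega>\<in>space M. U i \<omega> \<le> s} = s"
begin

sublocale L: nested_sample M U N "\<lambda>s. {..s}"
  by unfold_locales (use N_pos indep uniform in auto)

text \<open>The half-line is open so that it is the exact complement of \<open>{..1 - s}\<close>;
  deviations at \<open>s\<close> on the right then equal those at \<open>1 - s\<close> on the left
  up to sign.\<close>

sublocale R: nested_sample M U N "\<lambda>s. {1 - s<..}"
proof
  fix i and s :: real assume i: "i \<in> {1..N}" and s: "0 \<le> s" "s \<le> 1"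
  have [measurable]: "U i \<in> borel_measurable M" using indep i unfolding indep_vars_def by auto
  have "prob {\<omega>\<in>space M. U i \<omega> \<in> {1 - s<..}} = prob (space M - {\<omega>\<in>space M. U i \<omega> \<le> 1 - s})"
    by (intro arg_cong[of _ _ prob]) auto
  also have "\<dots> = s" using uniform[OF i, of "1 - s"] s by (subst prob_compl) auto
  finally show "prob {\<omega>\<in>space M. U i \<omega> \<in> {1 - s<..}} = s" .
qed (use N_pos indep in auto)

abbreviation ecdf :: "real \<Rightarrow> 'a \<Rightarrow> real" where
  "ecdf s \<omega> \<equiv> ecdf_of N (\<lambda>i. U i \<omega>) s"

definition ecdf_moment :: "real \<Rightarrow> 'a \<Rightarrow> ennreal" where
  "ecdf_moment p \<omega> =
     (\<integral>\<^sup>+ s. indicator {0<..<1} s * ennreal ((sqrt (real N) * (\<bar>ecdf s \<omega> - s\<bar> / (s * (1 - s)))) powr p) \<partial>lborel)"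

lemma ecdf_eq: "ecdf s \<omega> = L.cnt s \<omega> / real N"
  unfolding ecdf_of_def L.cnt_def by (simp add: indicator_def sum.If_cases Int_def conj_commute)

lemma cnt_reflect: "R.cnt s \<omega> = real N - L.cnt (1 - s) \<omega>"
proof -
  have "R.cnt s \<omega> + L.cnt (1 - s) \<omega> = (\<Sum>i=1..N. 1)"
    unfolding R.cnt_def L.cnt_def sum.distrib[symmetric] by (intro sum.cong) (auto simp: indicator_def)
  then show ?thesis by simp
qed

lemma ecdf_measurable [measurable (raw)]:
  assumes [measurable]: "f \<in> borel_measurable M'" "g \<in> measurable M' M"
  shows "(\<lambda>x. ecdf (f x) (g x)) \<in> borel_measurable M'"
  unfolding ecdf_eq by measurable

lemma ecdf_moment_measurable [measurable]: "ecdf_moment p \<in> borel_measurable M"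
  unfolding ecdf_moment_def by measurable

lemma ecdf_moment_le:
  assumes p: "1 \<le> p" "p < 2" and c: "0 < c" and \<omega>: "\<omega> \<in> space M"
  shows "ecdf_moment p \<omega> \<le> ennreal (16 * c powr p / (2 - p)) + ennreal (4 * c powr (p - 2)) * (L.half p \<omega> + R.half p \<omega>)"
proof -
  have [measurable]: "(\<lambda>s. L.cnt s \<omega>) \<in> borel_measurable borel" "(\<lambda>s. R.cnt s \<omega>) \<in> borel_measurable borel"
    using \<omega> by measurable
  let ?r = "\<lambda>s. ennreal ((\<bar>R.cnt s \<omega> - real N * s\<bar> / sqrt (real N) / (s * (1 - s))) powr p)"
  define f where "f s = ennreal ((\<bar>L.cnt s \<omega> - real N * s\<bar> / sqrt (real N) / (s * (1 - s))) powr p)" for s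
  have f [measurable]: "f \<in> borel_measurable borel" unfolding f_def by measurable
  have e: "sqrt (real N) * (\<bar>ecdf s \<omega> - s\<bar> / (s * (1 - s))) = \<bar>L.cnt s \<omega> - real N * s\<bar> / sqrt (real N) / (s * (1 - s))" for s
  proof -
    have "ecdf s \<omega> - s = (L.cnt s \<omega> - real N * s) / real N" using N_pos by (simp add: ecdf_eq field_simps)
    then have "\<bar>ecdf s \<omega> - s\<bar> = \<bar>L.cnt s \<omega> - real N * s\<bar> / (sqrt (real N) * sqrt (real N))" by simp
    moreover have "sqrt (real N) \<noteq> 0" using N_pos by simp
    ultimately show ?thesis by (simp del: real_sqrt_mult_self)
  qed
  have "ecdf_moment p \<omega> = (\<integral>\<^sup>+ s. indicator {0<..<1} s * f s \<partial>lborel)"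
    unfolding ecdf_moment_def e f_def ..
  also have "\<dots> \<le> (\<integral>\<^sup>+ s. indicator {0<..1/2} s * f s + indicator {1/2..<1} s * f s \<partial>lborel)"
    by (intro nn_integral_mono) (auto simp: indicator_def)
  also have "\<dots> = (\<integral>\<^sup>+ s. indicator {0<..1/2} s * f s \<partial>lborel) + (\<integral>\<^sup>+ s. indicator {1/2..<1} s * f s \<partial>lborel)"
    by (intro nn_integral_add) measurable
  also have "(\<integral>\<^sup>+ s. indicator {1/2..<1} s * f s \<partial>lborel) = (\<integral>\<^sup>+ s. indicator {1/2..<1} (1 - s) * f (1 - s) \<partial>lborel)"
    by (intro nn_integral_reflect[symmetric]) measurable
  also have "\<dots> = (\<integral>\<^sup>+ s. indicator {0<..1/2} s * ?r s \<partial>lborel)"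
  proof (intro nn_integral_cong)
    fix s :: real
    have "\<bar>R.cnt s \<omega> - real N * s\<bar> = \<bar>L.cnt (1 - s) \<omega> - real N * (1 - s)\<bar>"
      unfolding cnt_reflect by (simp add: algebra_simps)
    then show "indicator {1/2..<1} (1 - s) * f (1 - s)
      = indicator {0<..1/2} s * ?r s"
      by (auto simp: f_def indicator_def mult.commute)
  qed
  also have "(\<integral>\<^sup>+ s. indicator {0<..1/2} s * f s \<partial>lborel) + \<dots>
    \<le> (ennreal (8 * c powr p / (2 - p)) + ennreal (4 * c powr (p - 2)) * L.half p \<omega>)
      + (ennreal (8 * c powr p / (2 - p)) + ennreal (4 * c powr (p - 2)) * R.half p \<omega>)"
    unfolding f_def by (intro add_mono L.half_moment_le R.half_moment_le p c \<omega>)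
  also have "\<dots> = (ennreal (8 * c powr p / (2 - p)) + ennreal (8 * c powr p / (2 - p))) + ennreal (4 * c powr (p - 2)) * (L.half p \<omega> + R.half p \<omega>)"
    by (simp add: distrib_left ac_simps)
  also have "ennreal (8 * c powr p / (2 - p)) + ennreal (8 * c powr p / (2 - p)) = ennreal (16 * c powr p / (2 - p))"
    using p by (subst ennreal_plus[symmetric]) auto
  finally show ?thesis .
qed

text \<open>64 is the constant of \<open>logit_transport_le\<close>. The deterministic part is
  \<open>1024 * c powr p / (2 - p)\<close>, at most \<open>Q / 2\<close> by assumption. If both
  halves stay below \<open>2 * y\<close>, the random part is below
  \<open>256 * c powr (p - 2) * (4 * y)\<close>; \<open>y\<close> is chosen to make this
  \<open>Q / 2\<close>.\<close>

lemma ecdf_moment_tail: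
  fixes c Q :: real
  assumes p: "1 \<le> p" "p < 2" and c: "0 < c" and Q: "2048 * c powr p / (2 - p) \<le> Q"
  defines "y \<equiv> c powr (2 - p) * Q / 2048"
  shows "prob {\<omega>\<in>space M. ennreal Q \<le> 64 * ecdf_moment p \<omega>}
    \<le> 2 * (((1/2) ^ Suc J) powr (1 - p / 2) / ((1 - p / 2) * y) + 2 ^ Suc J / real N + exp (1 / (2 - p) - y / 96))"
proof -
  have "0 < 2048 * c powr p / (2 - p)" using c p by simp
  then have Q0: "0 < Q" using Q by linarith
  then have y: "0 < y" using c by (simp add: y_def)
  let ?k = "\<lambda>\<omega>. ennreal (256 * c powr (p - 2)) * (L.half p \<omega> + R.half p \<omega>)" and ?m = "ennreal (1024 * c powr p / (2 - p))"
  let ?Q = "\<lambda>h. {\<omega>\<in>space M. ennreal (2 * y) \<le> h \<omega>}"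
  have "ennreal (2 * y) \<le> L.half p \<omega> \<or> ennreal (2 * y) \<le> R.half p \<omega>"
    if \<omega>: "\<omega> \<in> space M" and le: "ennreal Q \<le> 64 * ecdf_moment p \<omega>" for \<omega>
  proof (rule ccontr)
    assume "\<not> ?thesis"
    then have "L.half p \<omega> + R.half p \<omega> < ennreal (2 * y + 2 * y)" by (intro add_mono_ennreal) auto
    then have lt: "L.half p \<omega> + R.half p \<omega> < ennreal (4 * y)" by simp
    have "64 * ecdf_moment p \<omega> \<le> 64 * (ennreal (16 * c powr p / (2 - p)) + ennreal (4 * c powr (p - 2)) * (L.half p \<omega> + R.half p \<omega>))"
      by (intro mult_left_mono ecdf_moment_le p c \<omega>) simp
    also have "\<dots> = ?m + ?k \<omega>"
    proof -
      have "64 * ennreal (16 * c powr p / (2 - p)) = ?m"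
        "64 * ennreal (4 * c powr (p - 2)) = ennreal (256 * c powr (p - 2))"
        by (simp_all only: ennreal_numeral[symmetric] ennreal_mult'[symmetric]) simp_all
      then show ?thesis by (simp add: distrib_left mult.assoc[symmetric])
    qed
    also have "\<dots> < ennreal (Q / 2 + Q / 2)"
    proof -
      have "?m \<le> ennreal (Q / 2)" using Q by (intro ennreal_leI) simp
      moreover have "?k \<omega> < ennreal (256 * c powr (p - 2)) * ennreal (4 * y)"
        using lt c by (intro ennreal_mult_strict_left_mono) auto
      moreover have "ennreal (256 * c powr (p - 2)) * ennreal (4 * y) = ennreal (Q / 2)"
      proof -
        have "c powr (p - 2) * c powr (2 - p) = 1" using c by (simp flip: powr_add)
        then have eq: "256 * c powr (p - 2) * (4 * y) = Q / 2" by (simp add: y_def)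
        have "ennreal (256 * c powr (p - 2)) * ennreal (4 * y) = ennreal (256 * c powr (p - 2) * (4 * y))"
          by (rule ennreal_mult'[symmetric]) simp
        then show ?thesis by (simp only: eq)
      qed
      ultimately have lt: "?k \<omega> < ennreal (Q / 2)"
        and le: "?m \<le> ennreal (Q / 2)" by simp_all
      have "?m + ?k \<omega>
         \<le> ennreal (Q / 2) + ?k \<omega>"
        using le by (rule add_right_mono)
      also have "\<dots> < ennreal (Q / 2) + ennreal (Q / 2)"
        using lt by (subst ennreal_add_left_cancel_less) simp
      finally have "?m + ?k \<omega>
         < ennreal (Q / 2) + ennreal (Q / 2)" .
      then show ?thesis using Q0 by (subst ennreal_plus) auto
    qed
    finally show False using le by simp
  qed
  then have "prob {\<omega>\<in>space M. ennreal Q \<le> 64 * ecdf_moment p \<omega>}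
    \<le> prob ((?Q (L.half p)) \<union> (?Q (R.half p)))"
    by (intro finite_measure_mono) auto
  also have "\<dots> \<le> prob (?Q (L.half p)) + prob (?Q (R.half p))"
    by (intro measure_Un_le) auto
  finally show ?thesis
    using L.half_tail[of p y J] R.half_tail[of p y J] p y by simp
qed

end

section \<open>Log-concave laws on the line\<close>

text \<open>\<open>ln f\<close> is concave, so its chord over \<open>[a, b]\<close> is at least as
  steep as the one over \<open>[m, r]\<close>. There the increment is at least
  \<open>1 - f m / f r\<close>, which is at least 1/3 because of the values 1/2 and 3/4.\<close>

lemma log_concave_slope:
  fixes f :: "real \<Rightarrow> real"
  assumes mono: "mono f"
    and lc: "\<And>x y t. 0 < t \<Longrightarrow> t < 1 \<Longrightarrow> f x powr (1 - t) * f y powr t \<le> f ((1 - t) * x + t * y)"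
    and m: "0 < f m" "f m \<le> 1/2" and r: "3/4 \<le> f r" "m < r"
    and ab: "a < b" "b \<le> m" "0 < f a"
  shows "b - a \<le> 3 * (r - m) * (ln (f b) - ln (f a))"
proof -
  have pos: "0 < f x" if "a \<le> x" for x using ab mono that by (meson less_le_trans monoD)
  have cv: "convex_on {a..} (\<lambda>x. - ln (f x))"
  proof (rule convex_onI)
    fix t x y :: real assume t: "0 < t" "t < 1" and xy: "x \<in> {a..}" "y \<in> {a..}"
    have "ln (f x powr (1 - t) * f y powr t) \<le> ln (f ((1 - t) * x + t * y))"
      using lc[OF t, of x y] pos[of x] pos[of y] xy
      by (intro ln_mono) auto
    then show "- ln (f ((1 - t) *\<^sub>R x + t *\<^sub>R y)) \<le> (1 - t) * - ln (f x) + t * - ln (f y)"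
      using pos[of x] pos[of y] xy by (simp add: ln_mult ln_powr)
  qed simp
  have s1: "(- ln (f a) - - ln (f b)) / (a - b) \<le> (- ln (f a) - - ln (f r)) / (a - r)"
    using ab r by (intro convex_on_slope_le(1)[OF cv]) auto
  have s2: "(- ln (f a) - - ln (f r)) / (a - r) \<le> (- ln (f m) - - ln (f r)) / (m - r)"
    using ab r by (intro convex_on_slope_le(2)[OF cv]) auto
  have "1/3 \<le> ln (f r / f m)"
  proof -
    have "1 - 1 / (f r / f m) \<le> ln (f r / f m)"
      using ln_le_minus_one[of "f m / f r"] m r by (simp add: ln_div)
    moreover have "f m / f r \<le> (1/2) / (3/4)" using m r by (intro frac_le) auto
    ultimately show ?thesis by simp
  qed
  then have l: "1/3 \<le> ln (f r) - ln (f m)" using m r by (simp add: ln_div)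
  have "(ln (f r) - ln (f m)) / (r - m) \<le> (ln (f b) - ln (f a)) / (b - a)"
    using order_trans[OF s1 s2] ab r by (simp add: divide_simps algebra_simps)
  moreover have "(1/3) / (r - m) \<le> (ln (f r) - ln (f m)) / (r - m)"
    using l r by (intro divide_right_mono) auto
  ultimately have "(1/3) / (r - m) \<le> (ln (f b) - ln (f a)) / (b - a)" by linarith
  then show ?thesis using ab r by (simp add: field_simps)
qed

locale bounded_log_concave = real_distribution M for M :: "real measure" +
  fixes B :: real
  assumes log_concave: "log_concave_measure M"
    and bounded: "AE x in M. \<bar>x\<bar> \<le> B"
    and variance_pos: "0 < variance (\<lambda>x. x)"
begin

definition \<sigma> :: real where "\<sigma> = sqrt (variance (\<lambda>x. x))"

lemma \<sigma>_pos: "0 < \<sigma>" using variance_pos by (simp add: \<sigma>_def)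

lemma measure_mono_AE:
  assumes "A \<in> sets borel" "A' \<in> sets borel" "A \<inter> {-B..B} \<subseteq> A'"
  shows "measure M A \<le> measure M A'"
proof (rule finite_measure_mono_AE)
  show "AE x in M. x \<in> A \<longrightarrow> x \<in> A'"
    using bounded
  proof eventually_elim
    fix x assume "\<bar>x\<bar> \<le> B"
    then have "x \<in> {-B..B}" by (simp add: abs_le_iff)
    then show "x \<in> A \<longrightarrow> x \<in> A'" using assms by blast
  qed
qed (use assms in auto)

lemma minkowski_le:
  assumes "compact A" "compact A'" "0 < t" "t < 1" "C \<in> sets borel"
    "\<And>u v. u \<in> A \<Longrightarrow> v \<in> A' \<Longrightarrow> (1 - t) * u + t * v \<in> C"
  shows "measure M A powr (1 - t) * measure M A' powr t \<le> measure M C"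
proof -
  have "measure M A powr (1 - t) * measure M A' powr t \<le> measure M {(1 - t) *\<^sub>R u + t *\<^sub>R v |u v. u \<in> A \<and> v \<in> A'}"
    using log_concave assms unfolding log_concave_measure_def by blast
  also have "\<dots> \<le> measure M C"
    using assms by (intro finite_measure_mono) auto
  finally show ?thesis .
qed

text \<open>Log-concavity is tested on compact sets; boundedness allows the half-lines to be cut at
  \<open>-B\<close> or \<open>B\<close> without loss of mass.\<close>

lemma halfline_log_concave:
  assumes t: "0 < t" "t < 1"
  shows "measure M {..x} powr (1 - t) * measure M {..y} powr t \<le> measure M {..(1 - t) * x + t * y}"
    and "measure M {x..} powr (1 - t) * measure M {y..} powr t \<le> measure M {(1 - t) * x + t * y..}"
proof -
  have z: "measure M {..z} = measure M {-B..z}" "measure M {z..} = measure M {z..B}" for z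
    by (auto intro!: antisym measure_mono_AE)
  have "measure M {-B..x} powr (1 - t) * measure M {-B..y} powr t \<le> measure M {..(1 - t) * x + t * y}"
    using t by (intro minkowski_le) (auto intro!: add_mono mult_left_mono)
  then show "measure M {..x} powr (1 - t) * measure M {..y} powr t \<le> measure M {..(1 - t) * x + t * y}"
    by (simp only: z[symmetric])
  have "measure M {x..B} powr (1 - t) * measure M {y..B} powr t \<le> measure M {(1 - t) * x + t * y..}"
    using t by (intro minkowski_le) (auto intro!: add_mono mult_left_mono)
  then show "measure M {x..} powr (1 - t) * measure M {y..} powr t \<le> measure M {(1 - t) * x + t * y..}"
    by (simp only: z[symmetric])
qed

text \<open>Positive variance puts mass on a compact set \<open>A\<close> away from a supposed atom
  \<open>c\<close>. Combining \<open>{c}\<close> with \<open>A\<close> under a small weight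
  \<open>t\<close> on \<open>A\<close> gives sets in ever smaller punctured neighbourhoods
  \<open>D k\<close> of \<open>c\<close>, each of mass at least
  \<open>measure M {c} * measure M A\<close>; but the \<open>D k\<close> decrease to the empty
  set.\<close>

lemma measure_singleton: "measure M {c} = 0"
proof (rule ccontr)
  assume "measure M {c} \<noteq> 0"
  then have c: "0 < measure M {c}" by (simp add: zero_less_measure_iff)
  let ?F = "\<lambda>n. {x. 1 / Suc n \<le> \<bar>x - c\<bar>}"
  have "\<exists>n. 0 < measure M (?F n)"
  proof (rule ccontr)
    assume "\<not> ?thesis"
    then have "emeasure M (?F n) = 0" for n
      by (metis emeasure_eq_measure ennreal_0 zero_less_measure_iff)
    then have "AE x in M. \<forall>n. \<not> 1 / Suc n \<le> \<bar>x - c\<bar>"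
      by (subst AE_all_countable) (auto intro!: AE_I[where N="{x. 1 / Suc _ \<le> \<bar>x - c\<bar>}"])
    then have "AE x in M. x = c"
    proof (rule eventually_mono)
      fix x assume *: "\<forall>n. \<not> 1 / Suc n \<le> \<bar>x - c\<bar>"
      show "x = c"
      proof (rule ccontr)
        assume "x \<noteq> c"
        then obtain n where "inverse (real (Suc n)) < \<bar>x - c\<bar>" using reals_Archimedean[of "\<bar>x - c\<bar>"] by auto
        then show False using *[rule_format, of n] by (simp add: field_simps)
      qed
    qed
    then have e: "expectation (\<lambda>x. x) = expectation (\<lambda>x. c)"
      by (intro integral_cong_AE) auto
    have "variance (\<lambda>x. x) = expectation (\<lambda>x. 0)"
      using \<open>AE x in M. x = c\<close> unfolding e
      using prob_space by (intro integral_cong_AE) (auto elim!: eventually_mono)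
    then show False using variance_pos by simp
  qed
  then obtain n where n: "0 < measure M (?F n)" by blast
  define H where "H = B + \<bar>c\<bar> + 1"
  define A where "A = (?F n) \<inter> cball c \<bar>H\<bar>"
  have "closed (?F n)" by (intro closed_Collect_le continuous_intros)
  then have A: "compact A" unfolding A_def by (simp add: closed_Int_compact)
  have "measure M (?F n) \<le> measure M A"
    using \<open>closed _\<close> by (intro measure_mono_AE) (auto simp: A_def dist_real_def H_def)
  then have mA: "0 < measure M A" using n by simp
  define D where "D k = {x. 0 < \<bar>x - c\<bar> \<and> \<bar>x - c\<bar> \<le> \<bar>H\<bar> / Suc (Suc k)}" for k
  have D_sets [measurable]: "D k \<in> sets M" for k unfolding D_def by simp
  define \<gamma> where "\<gamma> = measure M {c} * measure M A"
  have \<gamma>: "0 < \<gamma>" using c mA by (simp add: \<gamma>_def)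
  have le: "\<gamma> \<le> measure M (D k)" for k
  proof -
    define t where "t = 1 / real (Suc (Suc k))"
    have t: "0 < t" "t < 1" by (auto simp: t_def)
    have p: "u \<le> u powr s" if "0 < u" "u \<le> 1" "0 < s" "s < 1" for u s :: real
      using powr_mono'[of s 1 u] that by simp
    have "\<gamma> \<le> measure M {c} powr (1 - t) * measure M A powr t"
      unfolding \<gamma>_def using c mA t by (intro mult_mono p) auto
    also have "\<dots> \<le> measure M (D k)"
    proof (rule minkowski_le[OF _ A t])
      fix u v assume u: "u \<in> {c}" and v: "v \<in> A"
      have e: "(1 - t) * u + t * v - c = t * (v - c)" using u by (simp add: algebra_simps)
      have "\<bar>v - c\<bar> \<le> \<bar>H\<bar>" "0 < 1 / real (Suc n)" "1 / real (Suc n) \<le> \<bar>v - c\<bar>"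
        using v by (auto simp: A_def dist_real_def abs_minus_commute)
      then have vc: "\<bar>v - c\<bar> \<le> \<bar>H\<bar>" "0 < \<bar>v - c\<bar>" by linarith+
      have "t * \<bar>v - c\<bar> \<le> t * \<bar>H\<bar>" "0 < t * \<bar>v - c\<bar>" using t vc by (auto intro: mult_left_mono)
      then show "(1 - t) * u + t * v \<in> D k" 
        unfolding D_def mem_Collect_eq e abs_mult using t by (simp add: t_def)
    qed (auto simp: D_def)
    finally show ?thesis .
  qed
  have dec: "decseq D"
    unfolding D_def by (intro decseq_SucI) (auto elim!: order_trans intro!: divide_left_mono)
  have "(\<Inter>k. D k) = {}"
  proof (rule ccontr)
    assume "\<not> ?thesis"
    then obtain x where x: "\<And>k. 0 < \<bar>x - c\<bar>" "\<And>k. \<bar>x - c\<bar> \<le> \<bar>H\<bar> / Suc (Suc k)" by (auto simp: D_def)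
    have "(\<lambda>k. \<bar>H\<bar> / Suc (Suc k)) \<longlonglongrightarrow> 0" by real_asymp
    then have "\<bar>x - c\<bar> \<le> 0" using x(2) by (intro LIMSEQ_le_const) auto
    then show False using x(1) by simp
  qed
  then have "(\<lambda>k. measure M (D k)) \<longlonglongrightarrow> 0"
    using finite_Lim_measure_decseq[OF _ dec] D_sets by auto
  then have "\<gamma> \<le> 0" using le by (intro LIMSEQ_le_const) auto
  then show False using \<gamma> by simp
qed

lemma cdf_continuous: "isCont (cdf M) x"
  by (simp add: isCont_cdf measure_singleton)

lemma integrable_id: "integrable M (\<lambda>x. x)" "integrable M (\<lambda>x. x\<^sup>2)"
proof -
  show "integrable M (\<lambda>x. x)"
    by (rule integrable_const_bound[of _ B]) (use bounded in auto)
  show "integrable M (\<lambda>x. x\<^sup>2)"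
  proof (rule integrable_const_bound[of _ "B\<^sup>2"])
    show "AE x in M. norm (x\<^sup>2) \<le> B\<^sup>2"
      using bounded
    proof eventually_elim
      fix x assume "\<bar>x\<bar> \<le> B"
      then have "\<bar>x\<bar>\<^sup>2 \<le> B\<^sup>2" by (intro power_mono) auto
      then show "norm (x\<^sup>2) \<le> B\<^sup>2" by simp
    qed
  qed measurable
qed

lemma chebyshev: "measure M {x. 2 * \<sigma> \<le> \<bar>x - expectation (\<lambda>x. x)\<bar>} \<le> 1/4"
proof -
  have "prob {x\<in>space M. 2 * \<sigma> \<le> \<bar>x - expectation (\<lambda>x. x)\<bar>} \<le> variance (\<lambda>x. x) / (2 * \<sigma>)\<^sup>2"
    using \<sigma>_pos by (intro Chebyshev_inequality[OF _ integrable_id(2)]) simp_all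
  also have "\<dots> = 1/4" using variance_pos by (simp add: \<sigma>_def power_mult_distrib)
  finally show ?thesis by simp
qed

lemma cdf_bounds:
  defines "e \<equiv> expectation (\<lambda>x. x)"
  shows "cdf M (e - 2 * \<sigma>) \<le> 1/4" "3/4 \<le> cdf M (e + 2 * \<sigma>)"
proof -
  have "cdf M (e - 2 * \<sigma>) \<le> measure M {x. 2 * \<sigma> \<le> \<bar>x - e\<bar>}"
    unfolding cdf_def by (intro finite_measure_mono) auto
  then show "cdf M (e - 2 * \<sigma>) \<le> 1/4" using chebyshev unfolding e_def by simp
  have "1 - cdf M (e + 2 * \<sigma>) = measure M (space M - {..e + 2 * \<sigma>})"
    unfolding cdf_def by (subst prob_compl) auto
  also have "\<dots> \<le> measure M {x. 2 * \<sigma> \<le> \<bar>x - e\<bar>}" by (intro finite_measure_mono) auto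
  finally show "3/4 \<le> cdf M (e + 2 * \<sigma>)" using chebyshev unfolding e_def by simp
qed

lemma ex_median:
  obtains m where "cdf M m = 1/2" "\<bar>m - expectation (\<lambda>x. x)\<bar> \<le> 2 * \<sigma>"
proof -
  define e where "e = expectation (\<lambda>x. x)"
  have "\<exists>m\<ge>e - 2 * \<sigma>. m \<le> e + 2 * \<sigma> \<and> cdf M m = 1/2"
    using cdf_bounds \<sigma>_pos cdf_continuous by (intro IVT) (auto simp: e_def)
  then show ?thesis using that by (auto simp: e_def abs_le_iff)
qed

lemma measure_atLeast: "measure M {x..} = 1 - cdf M x"
proof -
  have "1 - cdf M x = measure M (space M - {..x})"
    unfolding cdf_def by (subst prob_compl) auto
  moreover have "measure M {x..} = measure M {x<..}"
  proof -
    have "{x..} = {x} \<union> {x<..}" by auto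
    then have "measure M {x..} = measure M {x} + measure M {x<..}"
      using finite_measure_Union[of "{x}" "{x<..}"] by auto
    then show ?thesis by (simp add: measure_singleton)
  qed
  moreover have "space M - {..x} = {x<..}" by auto
  ultimately show ?thesis by simp
qed

text \<open>Equivalently, \<open>M\<close> is the image of the logistic distribution under a \<open>12 \<sigma>\<close>-Lipschitz map.\<close>

theorem diff_le_logit_diff:
  assumes ab: "a < b" "0 < cdf M a" "cdf M b < 1"
  shows "b - a \<le> 12 * \<sigma> * ((ln (cdf M b) - ln (1 - cdf M b)) - (ln (cdf M a) - ln (1 - cdf M a)))"
proof -
  obtain m where m: "cdf M m = 1/2" "\<bar>m - expectation (\<lambda>x. x)\<bar> \<le> 2 * \<sigma>" by (rule ex_median)
  define e where "e = expectation (\<lambda>x. x)"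
  define F where "F = cdf M"
  let ?g = "\<lambda>x. ln (F x) - ln (1 - F x)"
  have F_mono: "x \<le> y \<Longrightarrow> F x \<le> F y" for x y by (simp add: F_def cdf_nondecreasing)
  have cb: "F (e - 2 * \<sigma>) \<le> 1/4" "3/4 \<le> F (e + 2 * \<sigma>)" using cdf_bounds by (simp_all add: e_def F_def)
  have me: "e - 2 * \<sigma> < m" "m < e + 2 * \<sigma>"
    using cb m F_mono[of m "e - 2 * \<sigma>"] F_mono[of "e + 2 * \<sigma>" m] unfolding F_def by (force simp: not_le[symmetric])+
  have left: "y - x \<le> 12 * \<sigma> * (ln (F y) - ln (F x))" if xy: "x \<le> y" "y \<le> m" "0 < F x" for x y
  proof (cases "x = y")
    case False
    have "y - x \<le> 3 * (e + 2 * \<sigma> - m) * (ln (F y) - ln (F x))"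
    proof (rule log_concave_slope[of F])
      show "F u powr (1 - t) * F v powr t \<le> F ((1 - t) * u + t * v)" if "0 < t" "t < 1" for u v t
        using halfline_log_concave(1)[OF that] by (simp add: F_def cdf_def)
    qed (use m me cb xy False in \<open>auto simp: F_def cdf_nondecreasing mono_def\<close>)
    \<comment> \<open>The median \<open>m\<close> lies within \<open>2 * \<sigma>\<close> of the
      mean \<open>e\<close>, so \<open>e + 2 * \<sigma> - m \<le> 4 * \<sigma>\<close>; the 12 is 3
      times 4.\<close>
    also have "\<dots> \<le> 12 * \<sigma> * (ln (F y) - ln (F x))"
      using me xy F_mono[of x y] by (intro mult_right_mono) (auto simp: abs_le_iff e_def)
    finally show ?thesis .
  qed simp
  have right: "y - x \<le> 12 * \<sigma> * (ln (1 - F x) - ln (1 - F y))" if xy: "x \<le> y" "m \<le> x" "F y < 1" for x y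
  proof (cases "x = y")
    case False
    \<comment> \<open>Reflection makes the upper tail nondecreasing, so the same slope bound
      applies, now with \<open>e - 2 * \<sigma>\<close> as the far point.\<close>
    have "(- x) - (- y) \<le> 3 * (- (e - 2 * \<sigma>) - (- m)) * (ln (1 - F (- (- x))) - ln (1 - F (- (- y))))"
    proof (rule log_concave_slope[of "\<lambda>z. 1 - F (- z)" "- m" "- (e - 2 * \<sigma>)" "- y" "- x"])
      show "(1 - F (- u)) powr (1 - t) * (1 - F (- v)) powr t \<le> 1 - F (- ((1 - t) * u + t * v))" if "0 < t" "t < 1" for u v t
        using halfline_log_concave(2)[OF that, of "- u" "- v"] unfolding measure_atLeast F_def by simp
    qed (use m me cb xy False in \<open>auto simp: F_def cdf_nondecreasing mono_def\<close>)
    also have "\<dots> \<le> 12 * \<sigma> * (ln (1 - F x) - ln (1 - F y))"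
      using me xy F_mono[of x y] by (simp, intro mult_right_mono) (auto simp: abs_le_iff e_def)
    finally show ?thesis by simp
  qed simp
  have F01: "0 < F x" "F x < 1" if "a \<le> x" "x \<le> b" for x
    using F_mono[of a x] F_mono[of x b] ab that by (auto simp: F_def)
  have lnm: "ln (F x) \<le> ln (F y)" "ln (1 - F y) \<le> ln (1 - F x)" if "a \<le> x" "x \<le> y" "y \<le> b" for x y
    using F01[of x] F01[of y] F_mono[of x y] that by auto
  \<comment> \<open>The median clamped to \<open>[a, b]\<close>: left of \<open>c\<close> the term
    \<open>ln F\<close> carries the estimate, right of it \<open>ln (1 - F)\<close>, and the other
    logarithm has the favourable sign.\<close>
  define c where "c = max a (min m b)"
  have c: "a \<le> c" "c \<le> b" using ab by (auto simp: c_def)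
  have "c - a \<le> 12 * \<sigma> * (ln (F c) - ln (F a))"
    using F01[of a] ab by (cases "a \<le> m") (auto simp: c_def intro!: left)
  also have "\<dots> \<le> 12 * \<sigma> * (?g c - ?g a)"
    using \<sigma>_pos lnm[of a c] c by (intro mult_left_mono) auto
  finally have 1: "c - a \<le> 12 * \<sigma> * (?g c - ?g a)" .
  have "b - c \<le> 12 * \<sigma> * (ln (1 - F c) - ln (1 - F b))"
    using F01[of b] ab by (cases "m \<le> b") (auto simp: c_def intro!: right)
  also have "\<dots> \<le> 12 * \<sigma> * (?g b - ?g c)"
    using \<sigma>_pos lnm[of c b] c by (intro mult_left_mono) auto
  finally have 2: "b - c \<le> 12 * \<sigma> * (?g b - ?g c)" .
  show ?thesis using add_mono[OF 1 2] by (simp add: F_def algebra_simps)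
qed

end

section \<open>Coupling with the empirical distribution\<close>

text \<open>\<open>enn2real\<close> sends an infinite infimum to 0, which \<open>0 < \<rho>\<close>
  excludes; hence \<open>\<rho> powr p\<close> lies below the infimum itself and below the cost of
  every coupling.\<close>

lemma wasserstein_le_coupling:
  assumes p: "0 < p" and \<rho>: "0 < \<rho>" and le: "\<rho> \<le> wasserstein p P Q" and J: "J \<in> couplings P Q"
  shows "ennreal (\<rho> powr p) \<le> (\<integral>\<^sup>+z. ennreal (\<bar>fst z - snd z\<bar> powr p) \<partial>J)"
proof -
  define I where "I = (INF J\<in>couplings P Q. \<integral>\<^sup>+z. ennreal (\<bar>fst z - snd z\<bar> powr p) \<partial>J)"
  have le': "\<rho> \<le> enn2real I powr (1 / p)" using le by (simp add: wasserstein_def I_def)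
  then have "\<rho> powr p \<le> (enn2real I powr (1 / p)) powr p" using p \<rho> by (intro powr_mono2) auto
  also have "\<dots> = enn2real I" using p by (simp add: powr_powr)
  finally have le2: "\<rho> powr p \<le> enn2real I" .
  moreover have "0 < \<rho> powr p" using \<rho> by simp
  ultimately have "I < top" by (metis enn2real_top less_le_trans less_irrefl top.not_eq_extremum)
  then have "ennreal (\<rho> powr p) \<le> I" using le2 by (metis ennreal_enn2real ennreal_leI)
  also have "I \<le> (\<integral>\<^sup>+z. ennreal (\<bar>fst z - snd z\<bar> powr p) \<partial>J)"
    unfolding I_def by (rule INF_lower[OF J])
  finally show ?thesis .
qed

lemma real_distribution_empirical:
  assumes N: "0 < N"
  shows "real_distribution (empirical_distribution N x)"
proof -
  have "emeasure (empirical_distribution N x) UNIV = ennreal (1 / real N) * of_nat N"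
    by (simp add: emeasure_empirical_distribution)
  also have "\<dots> = ennreal (1 / real N * real N)"
    by (subst ennreal_mult') (auto simp: ennreal_of_nat_eq_real_of_nat)
  finally have "emeasure (empirical_distribution N x) UNIV = 1" using N by simp
  then interpret prob_space "empirical_distribution N x" by (intro prob_spaceI) simp
  show ?thesis by unfold_locales simp
qed

lemma cdf_empirical:
  assumes N: "0 < N"
  shows "cdf (empirical_distribution N x) a = real (card {i\<in>{1..N}. x i \<le> a}) / real N"
proof -
  interpret real_distribution "empirical_distribution N x" by (rule real_distribution_empirical[OF N])
  have "ennreal (cdf (empirical_distribution N x) a) = ennreal (1 / real N) * (\<Sum>i = 1..N. indicator {..a} (x i))"
    by (simp add: cdf_def emeasure_eq_measure[symmetric] emeasure_empirical_distribution)
  also have "(\<Sum>i = 1..N. indicator {..a} (x i)) = (of_nat (card {i\<in>{1..N}. x i \<le> a}) :: ennreal)"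
    by (simp add: indicator_def sum.If_cases Int_def conj_commute)
  also have "ennreal (1 / real N) * \<dots> = ennreal (real (card {i\<in>{1..N}. x i \<le> a}) / real N)"
    by (simp add: ennreal_of_nat_eq_real_of_nat flip: ennreal_mult')
  finally show ?thesis by (subst (asm) ennreal_inj) (auto simp: cdf_def)
qed

text \<open>The truncation \<open>min t 1\<close> keeps the set nonempty, and the quantile monotone, for \<open>t > 1\<close>.\<close>

definition equantile :: "nat \<Rightarrow> (nat \<Rightarrow> real) \<Rightarrow> real \<Rightarrow> real" where
  "equantile N x t = Min (x ` {i\<in>{1..N}. min t 1 \<le> ecdf_of N x (x i)})"

context
  fixes N :: nat and x :: "nat \<Rightarrow> real"
  assumes N: "0 < N"
begin

lemma ecdf_of_mono: "a \<le> b \<Longrightarrow> ecdf_of N x a \<le> ecdf_of N x b"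
  unfolding ecdf_of_def by (intro divide_right_mono of_nat_mono card_mono) auto

lemma ecdf_of_bounds: "0 \<le> ecdf_of N x a" "ecdf_of N x a \<le> 1"
proof -
  have "card {i\<in>{1..N}. x i \<le> a} \<le> card {1..N}" by (intro card_mono) auto
  then show "0 \<le> ecdf_of N x a" "ecdf_of N x a \<le> 1" using N by (auto simp: ecdf_of_def)
qed

lemma equantile_in: "equantile N x t \<in> x ` {i\<in>{1..N}. min t 1 \<le> ecdf_of N x (x i)}"
  unfolding equantile_def
proof (intro Min_in)
  have ne: "x ` {1..N} \<noteq> {}" using N by auto
  then have "Max (x ` {1..N}) \<in> x ` {1..N}" by (intro Max_in) auto
  then obtain k where k: "k \<in> {1..N}" "x k = Max (x ` {1..N})" by auto
  have "{i\<in>{1..N}. x i \<le> x k} = {1..N}" using k by auto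
  then have "ecdf_of N x (x k) = 1" using N unfolding ecdf_of_def by (simp only:) simp
  then show "x ` {i\<in>{1..N}. min t 1 \<le> ecdf_of N x (x i)} \<noteq> {}" using k by auto
qed simp

lemma equantile_mono: "mono (equantile N x)"
proof (rule monoI)
  fix s t :: real assume "s \<le> t"
  then show "equantile N x s \<le> equantile N x t"
    unfolding equantile_def
    by (intro Min_antimono image_mono) (use equantile_in[of t] in auto)
qed

lemma equantile_le_member:
  "i \<in> {1..N} \<Longrightarrow> t \<le> ecdf_of N x (x i) \<Longrightarrow> equantile N x t \<le> x i"
  unfolding equantile_def by (intro Min_le) auto

text \<open>Needed for the identity, to identify the law of the quantile, and for
  \<open>F = cdf M\<close>, to feed the transport inequality. Ties created by \<open>F\<close> are
  harmless: the converse direction works with the largest sample whose image is at most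
  \<open>s\<close>.\<close>

lemma equantile_galois:
  assumes F: "mono F" and t: "0 < t" "t \<le> 1"
  shows "F (equantile N x t) \<le> s \<longleftrightarrow> t \<le> ecdf_of N (\<lambda>i. F (x i)) s"
proof
  assume le: "F (equantile N x t) \<le> s"
  have "t \<le> ecdf_of N x (equantile N x t)" using equantile_in[of t] t by auto
  also have "\<dots> \<le> ecdf_of N (\<lambda>i. F (x i)) s"
    unfolding ecdf_of_def
    by (intro divide_right_mono of_nat_mono card_mono) (auto intro: order_trans[OF monoD[OF F] le])
  finally show "t \<le> ecdf_of N (\<lambda>i. F (x i)) s" .
next
  assume le: "t \<le> ecdf_of N (\<lambda>i. F (x i)) s"
  define S where "S = {i\<in>{1..N}. F (x i) \<le> s}"
  have "S \<noteq> {}"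
  proof
    assume "S = {}"
    then have "ecdf_of N (\<lambda>i. F (x i)) s = 0" unfolding ecdf_of_def S_def[symmetric] by simp
    then show False using le t by simp
  qed
  then have S: "finite S" "S \<noteq> {}" by (simp_all add: S_def)
  then have "Max (x ` S) \<in> x ` S" by (intro Max_in) auto
  then obtain k where k: "k \<in> S" "x k = Max (x ` S)" by auto
  have "S \<subseteq> {i\<in>{1..N}. x i \<le> x k}" using k S by (auto simp: S_def)
  then have "card S \<le> card {i\<in>{1..N}. x i \<le> x k}" by (intro card_mono) auto
  then have "t \<le> ecdf_of N x (x k)"
    using le unfolding ecdf_of_def S_def[symmetric]
    by (elim order_trans) (auto intro!: divide_right_mono)
  then have "equantile N x t \<le> x k" using k by (intro equantile_le_member) (auto simp: S_def)
  then have "F (equantile N x t) \<le> F (x k)" using F by (rule monoD[rotated])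
  also have "\<dots> \<le> s" using k by (simp add: S_def)
  finally show "F (equantile N x t) \<le> s" .
qed

lemma equantile_measurable [measurable]: "equantile N x \<in> borel_measurable borel"
  by (rule borel_measurable_mono[OF equantile_mono])

lemma ecdf_of_measurable [measurable]: "ecdf_of N x \<in> borel_measurable borel"
  by (rule borel_measurable_mono) (simp add: mono_def ecdf_of_mono)

end

section \<open>Probability integral transform and quantile coupling\<close>

context bounded_log_concave
begin

lemma cdf_mono: "mono (cdf M)" by (simp add: mono_def cdf_nondecreasing)

lemma cdf_measurable [measurable]: "cdf M \<in> borel_measurable borel"
  by (rule borel_measurable_mono[OF cdf_mono])

text \<open>By continuity the level set of \<open>t\<close> is nonempty and compact. With
  \<open>q\<close> its largest point, \<open>cdf M x \<le> t\<close> is equivalent to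
  \<open>x \<le> q\<close>, although \<open>cdf M\<close> may have flat parts.\<close>

lemma prob_cdf_le_aux:
  assumes t: "0 < t" "t < 1"
  shows "prob {x. cdf M x \<le> t} = t"
proof -
  define l where "l = - B - 1"
  have B: "cdf M B = 1"
  proof -
    have "prob UNIV \<le> prob {..B}" by (intro measure_mono_AE) auto
    then have "1 \<le> prob {..B}" using prob_space by simp
    then show ?thesis unfolding cdf_def by (intro antisym prob_le_1)
  qed
  have l: "cdf M l = 0"
  proof -
    have "prob {..l} \<le> prob {}" by (intro measure_mono_AE) (auto simp: l_def)
    then show ?thesis by (simp add: cdf_def measure_le_0_iff)
  qed
  have lB: "l \<le> B" using B l cdf_nondecreasing[of B l] by (cases "l \<le> B") auto
  define S where "S = {x\<in>{l..B}. cdf M x = t}"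
  have cont: "continuous_on {l..B} (cdf M)"
    using cdf_continuous by (intro continuous_at_imp_continuous_on) auto
  have "\<exists>x\<ge>l. x \<le> B \<and> cdf M x = t" using B l t lB cdf_continuous by (intro IVT) auto
  then have "S \<noteq> {}" by (auto simp: S_def)
  moreover have "compact S"
    unfolding S_def using continuous_closed_preimage_constant[OF cont closed_atLeastAtMost]
    by (auto simp: compact_eq_bounded_closed intro: bounded_subset[of "{l..B}"])
  ultimately obtain q where q: "q \<in> S" "\<And>x. x \<in> S \<Longrightarrow> x \<le> q" using compact_attains_sup by metis
  have "cdf M x \<le> t \<longleftrightarrow> x \<le> q" for x
  proof
    assume x: "cdf M x \<le> t"
    show "x \<le> q"
    proof (rule ccontr)
      assume "\<not> x \<le> q"
      then have "t \<le> cdf M x" using q(1) cdf_nondecreasing[of q x] by (simp add: S_def)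
      then have "cdf M x = t" using x by simp
      moreover have "x \<le> B" using cdf_nondecreasing[of B x] x B t by (cases "x \<le> B") auto
      moreover have "l \<le> x" using \<open>\<not> x \<le> q\<close> q(1) by (auto simp: S_def)
      ultimately have "x \<in> S" by (simp add: S_def)
      then show False using q(2) \<open>\<not> x \<le> q\<close> by blast
    qed
  next
    assume "x \<le> q"
    then show "cdf M x \<le> t" using q(1) cdf_nondecreasing[of x q] by (simp add: S_def)
  qed
  then have "prob {x. cdf M x \<le> t} = cdf M q" by (simp add: cdf_def atMost_def)
  then show ?thesis using q(1) by (simp add: S_def)
qed

lemma prob_cdf_le:
  assumes t: "0 \<le> t" "t \<le> 1"
  shows "prob {x. cdf M x \<le> t} = t"
proof -
  consider "t = 0" | "t = 1" | "0 < t" "t < 1" using t by linarith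
  then show ?thesis
  proof cases
    case 1
    have "prob {x. cdf M x \<le> t} \<le> e" if "0 < e" for e :: real
    proof -
      have "prob {x. cdf M x \<le> t} \<le> prob {x. cdf M x \<le> min e (1/2)}"
        using that 1 by (intro finite_measure_mono) auto
      also have "\<dots> = min e (1/2)" using that by (intro prob_cdf_le_aux) auto
      finally show ?thesis by simp
    qed
    then have "prob {x. cdf M x \<le> t} \<le> 0" by (rule field_le_epsilon[of _ 0, simplified])
    then show ?thesis using 1 by (simp add: measure_le_0_iff)
  next
    case 2
    then show ?thesis using prob_space cdf_bounded_prob by simp
  qed (rule prob_cdf_le_aux)
qed

lemma cdf_uniform:
  assumes [measurable]: "g \<in> borel_measurable borel"
  shows "(\<integral>\<^sup>+ x. g (cdf M x) \<partial>M) = (\<integral>\<^sup>+ t. indicator {0<..<1} t * g t \<partial>lborel)"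
proof -
  have "distributed M lborel (cdf M) (\<lambda>x. indicator {0..1} x / measure lborel {0..1::real})"
    by (rule uniform_distrI_borel_atLeastAtMost) (use prob_cdf_le in auto)
  then have "(\<integral>\<^sup>+ x. g (cdf M x) \<partial>M) = (\<integral>\<^sup>+ t. ennreal (indicator {0..1} t / measure lborel {0..1::real}) * g t \<partial>lborel)"
    by (intro distributed_nn_integral[symmetric]) auto
  also have "\<dots> = (\<integral>\<^sup>+ t. indicator {0<..<1} t * g t \<partial>lborel)"
  proof (rule nn_integral_cong_AE)
    have "AE t in lborel. t \<noteq> (0::real)" "AE t in lborel. t \<noteq> (1::real)"
      using AE_lborel_singleton[of 0] AE_lborel_singleton[of 1] by auto
    then show "AE t in lborel. ennreal (indicator {0..1} t / measure lborel {0..1::real}) * g t = indicator {0<..<1} t * g t"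
      by eventually_elim (auto simp: indicator_def)
  qed
  finally show ?thesis .
qed

lemma AE_cdf: "AE x in M. 0 < cdf M x \<and> cdf M x < 1"
proof -
  have "prob {x. cdf M x \<le> 0} = 0" using prob_cdf_le[of 0] by simp
  then have "AE x in M. \<not> cdf M x \<le> 0"
    by (intro AE_I[where N="{x. cdf M x \<le> 0}"]) (auto simp: emeasure_eq_measure)
  moreover have "AE x in M. cdf M x < 1"
  proof -
    have "prob {x. 1 \<le> cdf M x} \<le> e" if "0 < e" for e :: real
    proof -
      have "prob {x. 1 \<le> cdf M x} \<le> prob (space M - {x. cdf M x \<le> 1 - min e 1})"
        using that by (intro finite_measure_mono) auto
      also have "\<dots> = min e 1" using that prob_cdf_le[of "1 - min e 1"] by (subst prob_compl) auto
      finally show ?thesis by simp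
    qed
    then have "prob {x. 1 \<le> cdf M x} \<le> 0" by (rule field_le_epsilon[of _ 0, simplified])
    then have "prob {x. 1 \<le> cdf M x} = 0" by (simp add: measure_le_0_iff)
    then show ?thesis
      by (intro AE_I[where N="{x. 1 \<le> cdf M x}"]) (auto simp: emeasure_eq_measure)
  qed
  ultimately show ?thesis by eventually_elim simp
qed

text \<open>The quantile coupling: \<open>cdf M z\<close> is uniform under \<open>M\<close>, and the
  empirical quantile function turns a uniform variable into the empirical law.\<close>

lemma empirical_coupling:
  assumes N: "0 < N"
  shows "distr M borel (\<lambda>z. (equantile N x (cdf M z), z)) \<in> couplings (empirical_distribution N x) M"
proof -
  note [measurable] = equantile_measurable[OF N]
  let ?T = "\<lambda>z. (equantile N x (cdf M z), z)" and ?q = "\<lambda>z. equantile N x (cdf M z)"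
  have m [measurable]: "?T \<in> measurable M (borel :: (real \<times> real) measure)"
    by (subst borel_prod[symmetric]) measurable
  have f: "fst \<in> measurable (borel :: (real \<times> real) measure) (borel :: real measure)"
    and s: "snd \<in> measurable (borel :: (real \<times> real) measure) (borel :: real measure)"
    by (simp_all add: borel_prod[symmetric])
  have "distr (distr M borel ?T) borel fst = distr M borel ?q"
    by (subst distr_distr[OF f m]) (simp add: comp_def)
  also have "\<dots> = empirical_distribution N x"
  proof (rule cdf_unique)
    show "real_distribution (distr M borel ?q)"
      by (rule real_distribution_distr) measurable
    show "real_distribution (empirical_distribution N x)" by (rule real_distribution_empirical[OF N])
    show "cdf (distr M borel ?q) = cdf (empirical_distribution N x)"
    proof
      fix a
      have "cdf (distr M borel ?q) a = prob {z. equantile N x (cdf M z) \<le> a}"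
        by (subst cdf_def, subst measure_distr) (measurable, auto intro!: arg_cong[of _ _ prob])
      also have "\<dots> = prob {z. cdf M z \<le> ecdf_of N x a}"
      proof (rule finite_measure_eq_AE)
        show "AE z in M. (z \<in> {z. equantile N x (cdf M z) \<le> a}) = (z \<in> {z. cdf M z \<le> ecdf_of N x a})"
          using AE_cdf by eventually_elim (use equantile_galois[OF N, of "\<lambda>u. u" _ x a] in \<open>auto simp: mono_def\<close>)
      qed measurable
      also have "\<dots> = ecdf_of N x a" by (intro prob_cdf_le ecdf_of_bounds N)
      finally show "cdf (distr M borel ?q) a = cdf (empirical_distribution N x) a"
        by (simp add: cdf_empirical[OF N] ecdf_of_def)
    qed
  qed
  moreover have "distr (distr M borel ?T) borel snd = M"
    by (subst distr_distr[OF s m]) (simp add: comp_def distr_id2)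
  ultimately show ?thesis by (simp add: couplings_def)
qed

text \<open>The Lipschitz bound moves the cost of the quantile coupling to the logit scale, and
  \<open>cdf_uniform\<close> replaces \<open>M\<close> by Lebesgue measure on the unit interval.
  There \<open>logit_transport_le\<close> applies to the quantile \<open>u\<close> and the
  distribution function of the transformed sample.\<close>

theorem wasserstein_empirical_le:
  assumes N: "0 < N" and p: "1 \<le> p" "p \<le> 2" and x: "\<And>i. i \<in> {1..N} \<Longrightarrow> 0 < cdf M (x i) \<and> cdf M (x i) < 1"
    and \<rho>: "0 < \<rho>" "\<rho> \<le> wasserstein p (empirical_distribution N x) M"
  shows "ennreal (\<rho> powr p) \<le> ennreal ((12 * \<sigma>) powr p) *
    (64 * (\<integral>\<^sup>+ s. indicator {0<..<1} s * ennreal ((\<bar>ecdf_of N (\<lambda>i. cdf M (x i)) s - s\<bar> / (s * (1 - s))) powr p) \<partial>lborel))"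
proof -
  note [measurable] = equantile_measurable[OF N] ecdf_of_measurable[OF N]
  define u where "u t = cdf M (equantile N x t)" for t
  have [measurable]: "u \<in> borel_measurable borel" unfolding u_def by measurable
  let ?l = "\<lambda>z. \<bar>logit (u (cdf M z)) - logit (cdf M z)\<bar>"
  let ?e = "\<lambda>z. \<bar>equantile N x (cdf M z) - z\<bar>"
  let ?d = "\<lambda>z. ennreal (?l z powr p)"
  have u_in: "\<exists>i\<in>{1..N}. u t = cdf M (x i)" for t
    using equantile_in[OF N, of x t] unfolding u_def by auto
  have u01: "0 < u t" "u t < 1" for t using u_in[of t] x by auto
  have m [measurable]: "(\<lambda>z. (equantile N x (cdf M z), z)) \<in> measurable M (borel :: (real \<times> real) measure)"
    by (subst borel_prod[symmetric]) measurable
  have "ennreal (\<rho> powr p) \<le> (\<integral>\<^sup>+z. ennreal (\<bar>fst z - snd z\<bar> powr p) \<partial>distr M borel (\<lambda>z. (equantile N x (cdf M z), z)))"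
    using p \<rho> by (intro wasserstein_le_coupling[OF _ _ _ empirical_coupling[OF N]]) auto
  also have "\<dots> = (\<integral>\<^sup>+z. ennreal (?e z powr p) \<partial>M)"
    by (subst nn_integral_distr[OF m]) (simp_all add: borel_prod[symmetric])
  also have "\<dots> \<le> (\<integral>\<^sup>+z. ennreal ((12 * \<sigma>) powr p) * ?d z \<partial>M)"
  proof (rule nn_integral_mono_AE)
    have lip: "\<bar>a - b\<bar> \<le> 12 * \<sigma> * \<bar>logit (cdf M a) - logit (cdf M b)\<bar>"
      if "0 < cdf M a" "cdf M a < 1" "0 < cdf M b" "cdf M b < 1" for a b
    proof -
      have one: "c - d \<le> 12 * \<sigma> * \<bar>logit (cdf M c) - logit (cdf M d)\<bar>" if "d < c" "0 < cdf M d" "cdf M c < 1" for c d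
      proof -
        have "c - d \<le> 12 * \<sigma> * (logit (cdf M c) - logit (cdf M d))"
          using diff_le_logit_diff[OF that] by (simp add: logit_def)
        also have "\<dots> \<le> 12 * \<sigma> * \<bar>logit (cdf M c) - logit (cdf M d)\<bar>"
          using \<sigma>_pos by (intro mult_left_mono) auto
        finally show ?thesis .
      qed
      show ?thesis
      proof (cases a b rule: linorder_cases)
        case less
        then show ?thesis using one[of a b] that abs_minus_commute[of "logit (cdf M a)"] by simp
      next
        case greater
        then show ?thesis using one[of b a] that by simp
      qed simp
    qed
    show "AE z in M. ennreal (?e z powr p)
        \<le> ennreal ((12 * \<sigma>) powr p) * ?d z"
      using AE_cdf
    proof eventually_elim
      fix z assume z: "0 < cdf M z \<and> cdf M z < 1"
      have "?e z \<le> 12 * \<sigma> * ?l z"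
        unfolding u_def by (rule lip) (use z u01[of "cdf M z"] in \<open>auto simp: u_def\<close>)
      then have "?e z powr p \<le> (12 * \<sigma> * ?l z) powr p"
        using p by (intro powr_mono2) auto
      also have "\<dots> = (12 * \<sigma>) powr p * ?l z powr p"
        using \<sigma>_pos by (subst powr_mult) auto
      finally show "ennreal (?e z powr p)
        \<le> ennreal ((12 * \<sigma>) powr p) * ?d z"
        by (subst ennreal_mult'[symmetric]) (auto intro: ennreal_leI)
    qed
  qed
  also have "\<dots> = ennreal ((12 * \<sigma>) powr p) * (\<integral>\<^sup>+z. ?d z \<partial>M)"
    by (intro nn_integral_cmult) measurable
  also have "(\<integral>\<^sup>+z. ?d z \<partial>M)
    = (\<integral>\<^sup>+ t. indicator {0<..<1} t * ennreal (\<bar>logit (u t) - logit t\<bar> powr p) \<partial>lborel)"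
    by (rule cdf_uniform[of "\<lambda>t. ennreal (\<bar>logit (u t) - logit t\<bar> powr p)"]) measurable
  also have "\<dots> \<le> 64 * (\<integral>\<^sup>+ s. indicator {0<..<1} s * ennreal ((\<bar>ecdf_of N (\<lambda>i. cdf M (x i)) s - s\<bar> / (s * (1 - s))) powr p) \<partial>lborel)"
  proof (rule logit_transport_le[OF p])
    show "u s \<le> u t" if "s \<le> t" for s t
      unfolding u_def using that by (intro monoD[OF cdf_mono] monoD[OF equantile_mono[OF N]])
    show "u t \<le> s \<longleftrightarrow> t \<le> ecdf_of N (\<lambda>i. cdf M (x i)) s" if "0 < t" "t < 1" for s t
      unfolding u_def using that by (intro equantile_galois[OF N cdf_mono]) auto
    show "(\<integral>\<^sup>+ t. indicator {0<..<1} t * ennreal (\<bar>logit (u t) - logit t\<bar> powr p) \<partial>lborel) < \<infinity>"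
    proof (rule logit_moment_finite)
      \<comment> \<open>\<open>u\<close> takes only the values \<open>cdf M (x i)\<close>, so its
        logit is bounded by a finite sum.\<close>
      show "\<bar>logit (u t)\<bar> \<le> (\<Sum>i=1..N. \<bar>logit (cdf M (x i))\<bar>)" for t
      proof -
        obtain i where "i \<in> {1..N}" "u t = cdf M (x i)" using u_in by blast
        then show ?thesis
          using member_le_sum[of i "{1..N}" "\<lambda>i. \<bar>logit (cdf M (x i))\<bar>"] by simp
      qed
    qed (use p in auto)
  qed (use u01 in auto)
  finally show ?thesis by (simp add: mult_left_mono)
qed

end

section \<open>Projections and the sample variance\<close>

lemma weighted_output_eq: "weighted_output a x z = weighted_decision a x \<bullet> z"
  unfolding weighted_output_def weighted_decision_def inner_vec_def
  by (intro sum.cong) (auto simp: mult_ac)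

lemma quad_form_eq: "quad_form (\<chi> v w. f v w) u = (\<Sum>v\<in>UNIV. \<Sum>w\<in>UNIV. u $ v * u $ w * f v w)"
  unfolding quad_form_def matrix_vector_mult_def inner_vec_def
  by (simp add: sum_distrib_left mult_ac)

lemma square_inner_eq:
  fixes u d :: "real ^ 'w"
  shows "(u \<bullet> d)\<^sup>2 = (\<Sum>v\<in>UNIV. \<Sum>w\<in>UNIV. u $ v * u $ w * (d $ v * d $ w))"
  unfolding inner_vec_def power2_eq_square sum_product by (simp add: mult_ac)

definition sample_variance :: "nat \<Rightarrow> (nat \<Rightarrow> real) \<Rightarrow> real" where
  "sample_variance N y = 1 / (real N - 1) * (\<Sum>i=1..N. (y i - 1 / real N * (\<Sum>j=1..N. y j))\<^sup>2)"

lemma quad_form_sample_covariance: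
  fixes z :: "nat \<Rightarrow> real ^ 'w"
  shows "quad_form (sample_covariance_matrix N z) u = sample_variance N (\<lambda>i. u \<bullet> z i)"
proof -
  define d where "d i = z i - sample_mean N z" for i
  let ?t = "\<lambda>v w i. 1 / (real N - 1) * (u $ v * u $ w * (d i $ v * d i $ w))"
  have "quad_form (sample_covariance_matrix N z) u
     = (\<Sum>v\<in>UNIV. \<Sum>w\<in>UNIV. \<Sum>i=1..N. ?t v w i)"
    unfolding sample_covariance_matrix_def quad_form_eq d_def
    by (simp add: sum_distrib_left sum_divide_distrib mult_ac)
  also have "\<dots> = (\<Sum>i=1..N. \<Sum>v\<in>UNIV. \<Sum>w\<in>UNIV. ?t v w i)"
  proof -
    have "(\<Sum>v\<in>UNIV. \<Sum>w\<in>UNIV. \<Sum>i=1..N. ?t v w i)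
      = (\<Sum>v\<in>UNIV. \<Sum>i=1..N. \<Sum>w\<in>UNIV. ?t v w i)"
      by (intro sum.cong refl sum.swap)
    also have "\<dots> = (\<Sum>i=1..N. \<Sum>v\<in>UNIV. \<Sum>w\<in>UNIV. ?t v w i)"
      by (rule sum.swap)
    finally show ?thesis .
  qed
  also have "\<dots> = 1 / (real N - 1) * (\<Sum>i=1..N. (u \<bullet> d i)\<^sup>2)"
    unfolding square_inner_eq sum_distrib_left ..
  also have "(\<Sum>i=1..N. (u \<bullet> d i)\<^sup>2) = (\<Sum>i=1..N. (u \<bullet> z i - 1 / real N * (\<Sum>j=1..N. u \<bullet> z j))\<^sup>2)"
    by (simp add: d_def sample_mean_def inner_diff_right inner_sum_right)
  finally show ?thesis by (simp only: sample_variance_def)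
qed

lemma quad_form_covariance:
  fixes \<xi> :: "'s \<Rightarrow> real ^ 'w"
  assumes "prob_space M" and m: "\<xi> \<in> borel_measurable M" and b: "AE \<omega> in M. norm (\<xi> \<omega>) \<le> B"
  shows "quad_form (covariance_matrix M \<xi>) u = (\<integral>\<omega>. (u \<bullet> \<xi> \<omega> - (\<integral>\<omega>'. u \<bullet> \<xi> \<omega>' \<partial>M))\<^sup>2 \<partial>M)"
proof -
  interpret prob_space M by fact
  note [measurable] = m
  define e :: "real ^ 'w" where "e = (\<chi> v. \<integral>\<omega>'. \<xi> \<omega>' $ v \<partial>M)"
  define d where "d \<omega> = \<xi> \<omega> - e" for \<omega>
  have vm [measurable]: "(\<lambda>\<omega>. \<xi> \<omega> $ v) \<in> borel_measurable M" for v
    by (rule measurable_compose[OF m]) (intro borel_measurable_continuous_onI continuous_intros)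
  have int: "integrable M (\<lambda>\<omega>. \<xi> \<omega> $ v)" for v
  proof (rule integrable_const_bound)
    show "AE \<omega> in M. norm (\<xi> \<omega> $ v) \<le> B"
      using b by eventually_elim (auto intro: order_trans[OF component_le_norm_cart])
  qed (rule vm)
  have db: "AE \<omega> in M. norm (d \<omega>) \<le> B + norm e"
    using b by eventually_elim (auto simp: d_def intro: order_trans[OF norm_triangle_ineq4])
  have intd: "integrable M (\<lambda>\<omega>. d \<omega> $ v * d \<omega> $ w)" for v w
  proof (rule integrable_const_bound)
    show "AE \<omega> in M. norm (d \<omega> $ v * d \<omega> $ w) \<le> (B + norm e) * (B + norm e)"
      using db
    proof eventually_elim
      fix \<omega> assume "norm (d \<omega>) \<le> B + norm e"
      then have "\<bar>d \<omega> $ v\<bar> \<le> B + norm e" "\<bar>d \<omega> $ w\<bar> \<le> B + norm e"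
        using component_le_norm_cart order_trans by blast+
      then show "norm (d \<omega> $ v * d \<omega> $ w) \<le> (B + norm e) * (B + norm e)"
        unfolding real_norm_def abs_mult by (intro mult_mono) auto
    qed
  qed (simp add: d_def)
  have ue: "(\<integral>\<omega>'. u \<bullet> \<xi> \<omega>' \<partial>M) = u \<bullet> e"
    unfolding inner_vec_def using int by (simp add: e_def)
  have "quad_form (covariance_matrix M \<xi>) u = (\<Sum>v\<in>UNIV. \<Sum>w\<in>UNIV. u $ v * u $ w * (\<integral>\<omega>. d \<omega> $ v * d \<omega> $ w \<partial>M))"
    unfolding covariance_matrix_def quad_form_eq d_def e_def by simp
  also have "\<dots> = (\<integral>\<omega>. (\<Sum>v\<in>UNIV. \<Sum>w\<in>UNIV. u $ v * u $ w * (d \<omega> $ v * d \<omega> $ w)) \<partial>M)"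
    using intd by simp
  also have "\<dots> = (\<integral>\<omega>. (u \<bullet> d \<omega>)\<^sup>2 \<partial>M)" unfolding square_inner_eq ..
  finally show ?thesis by (simp add: ue d_def inner_diff_right)
qed

text \<open>Preimages of compact sets under a projection are closed but may be unbounded.
  Intersecting them with \<open>cball 0 B\<close>, which carries all the mass, makes them
  compact.\<close>

lemma log_concave_inner:
  fixes \<nu> :: "'a::euclidean_space measure"
  assumes \<nu>: "prob_space \<nu>" "log_concave_measure \<nu>" and b: "AE z in \<nu>. norm z \<le> B"
  shows "log_concave_measure (distr \<nu> borel (\<lambda>z. u \<bullet> z))"
proof -
  interpret prob_space \<nu> by fact
  have sets [simp, measurable_cong]: "sets \<nu> = sets borel" using \<nu> by (simp add: log_concave_measure_def)
  have sp [simp]: "space \<nu> = UNIV" using sets_eq_imp_space_eq[OF sets] by simp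
  let ?m = "measure (distr \<nu> borel (\<lambda>z. u \<bullet> z))"
  define pre where "pre A = {z. u \<bullet> z \<in> A} \<inter> cball 0 B" for A
  have comp: "compact (pre A)" if "compact A" for A
  proof -
    have "closed ((\<lambda>z. u \<bullet> z) -` A)"
      using that by (intro continuous_closed_vimage compact_imp_closed continuous_intros) auto
    then show ?thesis unfolding pre_def vimage_def by (simp add: closed_Int_compact)
  qed
  have meas: "?m A = measure \<nu> {z. u \<bullet> z \<in> A}" if "A \<in> sets borel" for A
    using that by (subst measure_distr) (auto intro!: arg_cong[of _ _ "measure \<nu>"])
  have eq: "measure \<nu> {z. u \<bullet> z \<in> A} = measure \<nu> (pre A)" if A: "compact A" for A
  proof (rule finite_measure_eq_AE)
    show "AE z in \<nu>. (z \<in> {z. u \<bullet> z \<in> A}) = (z \<in> pre A)"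
      using b by eventually_elim (auto simp: pre_def)
    have [measurable]: "A \<in> sets borel" using A by (simp add: borel_compact)
    show "{z. u \<bullet> z \<in> A} \<in> sets \<nu>" by measurable
    show "pre A \<in> sets \<nu>" using comp[OF A] by (simp add: borel_compact)
  qed
  have "?m A powr (1 - t) * ?m C powr t
      \<le> ?m {(1 - t) *\<^sub>R a + t *\<^sub>R c |a c. a \<in> A \<and> c \<in> C}"
    if A: "compact A" and C: "compact C" and t: "0 < t" "t < 1" for A C t
  proof -
    define S where "S = {(1 - t) *\<^sub>R a + t *\<^sub>R c |a c. a \<in> A \<and> c \<in> C}"
    have "S = (\<lambda>(a, c). (1 - t) *\<^sub>R a + t *\<^sub>R c) ` (A \<times> C)" by (auto simp: S_def)
    moreover have "compact \<dots>"
      using A C by (intro compact_continuous_image compact_Times)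
        (auto simp: split_beta intro!: continuous_intros)
    ultimately have S: "compact S" by simp
    then have [measurable]: "S \<in> sets borel" by (simp add: borel_compact)
    have "measure \<nu> (pre A) powr (1 - t) * measure \<nu> (pre C) powr t
      \<le> measure \<nu> {(1 - t) *\<^sub>R a + t *\<^sub>R c |a c. a \<in> pre A \<and> c \<in> pre C}"
      using \<nu>(2) comp A C t unfolding log_concave_measure_def by blast
    also have "\<dots> \<le> measure \<nu> {z. u \<bullet> z \<in> S}"
      by (intro finite_measure_mono)
         (fastforce simp: pre_def S_def inner_add_right, measurable)
    finally show ?thesis
      unfolding S_def[symmetric] using A C S by (simp add: meas eq borel_compact)
  qed
  then show ?thesis unfolding log_concave_measure_def by auto
qed

text \<open>With \<open>Z\<close> centred and sum \<open>s\<close>, the sum of squares about the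
  sample mean is \<open>(\<Sum>i=1..N. (Z i)^2) - s^2 / N\<close>. Outside two Chebyshev events this
  is at least \<open>N v / 2 - N v / 4\<close>. The event for the squares uses a fourth moment,
  finite by boundedness.\<close>

lemma (in prob_space) sample_variance_small:
  fixes Y :: "nat \<Rightarrow> 'a \<Rightarrow> real" and \<mu> :: "real measure"
  assumes N: "1 < N" and ind: "indep_vars (\<lambda>_. borel) Y {1..N}"
    and law: "\<And>i. i \<in> {1..N} \<Longrightarrow> distr M borel (Y i) = \<mu>"
    and bound: "AE y in \<mu>. \<bar>y\<bar> \<le> B"
    and m: "m = (\<integral>y. y \<partial>\<mu>)" and v: "v = (\<integral>y. (y - m)\<^sup>2 \<partial>\<mu>)" "0 < v"
  shows "prob {\<omega>\<in>space M. sample_variance N (\<lambda>i. Y i \<omega>) < v / 4}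
    \<le> (4 + 4 * (\<integral>y. ((y - m)\<^sup>2 - v)\<^sup>2 \<partial>\<mu>) / v\<^sup>2) / real N"
proof -
  have Y [measurable]: "Y i \<in> borel_measurable M" if "i \<in> {1..N}" for i
    using ind that unfolding indep_vars_def by auto
  have mu: "\<mu> = distr M borel (Y 1)" using law[of 1] N by simp
  have [measurable]: "Y 1 \<in> borel_measurable M" using Y[of 1] N by simp
  interpret \<mu>: real_distribution \<mu> unfolding mu by (rule real_distribution_distr) measurable
  have int_\<mu>: "integrable \<mu> g" if [measurable]: "g \<in> borel_measurable borel" and "\<And>y. \<bar>y\<bar> \<le> B \<Longrightarrow> \<bar>g y\<bar> \<le> K"
    for g :: "real \<Rightarrow> real" and K
    by (rule \<mu>.integrable_const_bound[of _ K]) (use that bound in \<open>auto elim!: eventually_mono\<close>)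
  define W where "W = \<bar>B\<bar> + \<bar>m\<bar>"
  have d: "\<bar>y - m\<bar> \<le> W" if "\<bar>y\<bar> \<le> B" for y using that by (auto simp: W_def)
  have d2: "(y - m)\<^sup>2 \<le> W\<^sup>2" if "\<bar>y\<bar> \<le> B" for y
    using power_mono[OF d[OF that], of 2] by simp
  have d3: "\<bar>(y - m)\<^sup>2 - v\<bar> \<le> W\<^sup>2 + v" if "\<bar>y\<bar> \<le> B" for y
    using d2[OF that] v zero_le_power2[of "y - m"] by linarith
  have d4: "((y - m)\<^sup>2 - v)\<^sup>2 \<le> (W\<^sup>2 + v)\<^sup>2" if "\<bar>y\<bar> \<le> B" for y
    using power_mono[OF d3[OF that], of 2] by simp
  have i1: "integrable \<mu> (\<lambda>y. y)" by (rule int_\<mu>) auto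
  have i2: "integrable \<mu> (\<lambda>y. (y - m)\<^sup>2)" by (rule int_\<mu>[of _ "W\<^sup>2"]) (use d2 in auto)
  have i4: "integrable \<mu> (\<lambda>y. ((y - m)\<^sup>2 - v)\<^sup>2)" by (rule int_\<mu>[of _ "(W\<^sup>2 + v)\<^sup>2"]) (use d4 in auto)
  have int_Y: "integrable M (\<lambda>\<omega>. g (Y i \<omega>))" "expectation (\<lambda>\<omega>. g (Y i \<omega>)) = (\<integral>y. g y \<partial>\<mu>)"
    if i: "i \<in> {1..N}" and [measurable]: "g \<in> borel_measurable borel" and "integrable \<mu> g" for i and g :: "real \<Rightarrow> real"
    using that(3) Y[OF i] unfolding law[OF i, symmetric]
    by (simp_all add: integrable_distr_eq integral_distr)
  define Z where "Z i \<omega> = Y i \<omega> - m" for i \<omega>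
  define Z2 where "Z2 i \<omega> = (Y i \<omega> - m)\<^sup>2 - v" for i \<omega>
  define V4 where "V4 = (\<integral>y. ((y - m)\<^sup>2 - v)\<^sup>2 \<partial>\<mu>)"
  have indZ: "indep_vars (\<lambda>_. borel) Z {1..N}"
    unfolding Z_def[abs_def] by (rule indep_vars_compose2[OF ind, of "\<lambda>_ y. y - m"]) measurable
  have indZ2: "indep_vars (\<lambda>_. borel) Z2 {1..N}"
    unfolding Z2_def[abs_def] by (rule indep_vars_compose2[OF ind, of "\<lambda>_ y. (y - m)\<^sup>2 - v"]) measurable
  have e1: "(\<integral>y. y - m \<partial>\<mu>) = 0" using i1 \<mu>.prob_space m by simp
  have e2: "(\<integral>y. (y - m)\<^sup>2 - v \<partial>\<mu>) = 0" using i2 \<mu>.prob_space v by simp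
  let ?A = "{\<omega>\<in>space M. real N * sqrt v / 2 \<le> \<bar>\<Sum>i=1..N. Z i \<omega>\<bar>}" and ?A2 = "{\<omega>\<in>space M. real N * v / 2 \<le> \<bar>\<Sum>i=1..N. Z2 i \<omega>\<bar>}"
  let ?S = "{\<omega>\<in>space M. sample_variance N (\<lambda>i. Y i \<omega>) < v / 4}"
  have Z_facts: "integrable M (Z i)" "expectation (Z i) = 0"
    "integrable M (\<lambda>\<omega>. (Z i \<omega>)\<^sup>2)" "expectation (\<lambda>\<omega>. (Z i \<omega>)\<^sup>2) = v" if i: "i \<in> {1..N}" for i
  proof -
    have "integrable \<mu> (\<lambda>y. y - m)" using i1 by simp
    then show "integrable M (Z i)" "expectation (Z i) = 0"
      using int_Y[OF i, of "\<lambda>y. y - m"] e1 by (simp_all add: Z_def[abs_def])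
    show "integrable M (\<lambda>\<omega>. (Z i \<omega>)\<^sup>2)" "expectation (\<lambda>\<omega>. (Z i \<omega>)\<^sup>2) = v"
      using int_Y[OF i, of "\<lambda>y. (y - m)\<^sup>2"] i2 by (simp_all add: Z_def v)
  qed
  have Z2_facts: "integrable M (Z2 i)" "expectation (Z2 i) = 0"
    "integrable M (\<lambda>\<omega>. (Z2 i \<omega>)\<^sup>2)" "expectation (\<lambda>\<omega>. (Z2 i \<omega>)\<^sup>2) = V4" if i: "i \<in> {1..N}" for i
  proof -
    have "integrable \<mu> (\<lambda>y. (y - m)\<^sup>2 - v)" using i2 by simp
    then show "integrable M (Z2 i)" "expectation (Z2 i) = 0"
      using int_Y[OF i, of "\<lambda>y. (y - m)\<^sup>2 - v"] e2 unfolding Z2_def[abs_def] by simp_all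
    show "integrable M (\<lambda>\<omega>. (Z2 i \<omega>)\<^sup>2)" "expectation (\<lambda>\<omega>. (Z2 i \<omega>)\<^sup>2) = V4"
      using int_Y[OF i, of "\<lambda>y. ((y - m)\<^sup>2 - v)\<^sup>2"] i4 unfolding Z2_def V4_def by simp_all
  qed
  have PZ: "prob ?A \<le> real (card {1..N}) * v / (real N * sqrt v / 2)\<^sup>2"
    by (rule sum_deviation_le[OF _ indZ Z_facts(1,3,2,4)]) (use N v in auto)
  have PZ2: "prob ?A2 \<le> real (card {1..N}) * V4 / (real N * v / 2)\<^sup>2"
    by (rule sum_deviation_le[OF _ indZ2 Z2_facts(1,3,2,4)]) (use N v in auto)
  have sqN: "(real N * sqrt v / 2)\<^sup>2 = real N * (real N * v / 4)"
    using v(2) by (simp add: power_mult_distrib power_divide power2_eq_square[of "real N"])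
  have sv: "v / 4 \<le> sample_variance N (\<lambda>i. Y i \<omega>)"
    if 1: "\<bar>\<Sum>i=1..N. Z i \<omega>\<bar> < real N * sqrt v / 2" and 2: "\<bar>\<Sum>i=1..N. Z2 i \<omega>\<bar> < real N * v / 2" for \<omega>
  proof -
    define s where "s = (\<Sum>i=1..N. Z i \<omega>)"
  let ?Q = "\<Sum>i=1..N. (Z i \<omega>)\<^sup>2" and ?R = "\<Sum>i=1..N. (Z i \<omega> - s / real N)\<^sup>2"
    have N0: "0 < real N" using N by simp
    have a: "Y i \<omega> - 1 / real N * (\<Sum>j=1..N. Y j \<omega>) = Z i \<omega> - s / real N" for i
      using N0 by (simp add: Z_def s_def sum_subtractf field_simps)
    have "?R = (\<Sum>i=1..N. (Z i \<omega>)\<^sup>2 - 2 * (s / real N) * Z i \<omega> + (s / real N)\<^sup>2)"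
      by (intro sum.cong refl) (simp add: power2_eq_square algebra_simps)
    also have "\<dots> = ?Q - 2 * (s / real N) * s + real N * (s / real N)\<^sup>2"
      unfolding sum.distrib sum_subtractf sum_distrib_left[symmetric] s_def[symmetric] by simp
    also have "\<dots> = ?Q - s\<^sup>2 / real N"
      using N0 by (simp add: power2_eq_square field_simps)
    finally have b: "?R = ?Q - s\<^sup>2 / real N" .
    have "?Q = (\<Sum>i=1..N. Z2 i \<omega>) + real N * v"
      by (simp add: Z_def Z2_def sum_subtractf)
    then have c: "real N * v / 2 \<le> ?Q" using 2 by linarith
    have "\<bar>s\<bar>\<^sup>2 \<le> (real N * sqrt v / 2)\<^sup>2" using 1 by (intro power_mono) (auto simp: s_def)
    then have "s\<^sup>2 \<le> real N * (real N * v / 4)" by (simp only: sqN power2_abs)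
    then have "s\<^sup>2 / real N \<le> real N * v / 4" using N0 by (simp add: field_simps)
    then have f: "real N * v / 4 \<le> ?R" using b c by linarith
    have "v / 4 * (real N - 1) \<le> real N * v / 4" using v(2) by (simp add: field_simps)
    then have "v / 4 * (real N - 1) \<le> ?R" using f by linarith
    then show ?thesis unfolding sample_variance_def a using N by (simp add: field_simps)
  qed
  have Zm [measurable]: "Z i \<in> borel_measurable M" "Z2 i \<in> borel_measurable M" if "i \<in> {1..N}" for i
    using Y[OF that] unfolding Z_def[abs_def] Z2_def[abs_def] by simp_all
  have "prob ?S
    \<le> prob (?A \<union> ?A2)"
  proof (rule finite_measure_mono)
    show "?S
      \<subseteq> ?A \<union> ?A2"
      using sv by (fastforce simp: not_le[symmetric])
  qed measurable
  also have "\<dots> \<le> prob ?A + prob ?A2"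
    by (intro measure_Un_le) measurable
  also have "\<dots> \<le> real N * v / (real N * sqrt v / 2)\<^sup>2 + real N * V4 / (real N * v / 2)\<^sup>2"
    using PZ PZ2 by simp
  also have "real N * v / (real N * sqrt v / 2)\<^sup>2 = 4 / real N"
    using N v(2) unfolding sqN by simp
  also have "real N * V4 / (real N * v / 2)\<^sup>2 = 4 * V4 / v\<^sup>2 / real N"
    using N v(2) by (simp add: power_mult_distrib power_divide power2_eq_square mult_ac)
  finally show ?thesis by (simp add: V4_def add_divide_distrib)
qed

section \<open>Concentration of the Wasserstein distance\<close>

text \<open>The factor \<open>576 = 24\<^sup>2\<close> combines the Lipschitz constant \<open>12 \<sigma>\<close> with a factor \<open>2\<close> for a sample variance that may
  be as small as \<open>\<sigma>\<^sup>2 / 4\<close>; \<open>10 ^ 14\<close> is the \<open>p\<close>-th power of the truncation level \<open>c\<close> below.\<close>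

definition C2_const :: real where "C2_const = 576 * 2048 * 10 ^ 14"

text \<open>For \<open>k < 1\<close> the first exponential alone is at least
  \<open>exp (- ln (C1 / \<beta>)) = \<beta> / C1\<close>, as the logarithm is nonnegative.\<close>

lemma level_ge:
  assumes "0 < \<beta>" "\<beta> < 1" "p < 2" "1 \<le> C1" "0 \<le> C2"
  shows "\<beta> \<le> level C1 C2 C3 C4 p \<beta> N v"
  unfolding level_def
proof (rule cINF_greatest)
  fix k :: real assume k: "k \<in> {0<..<1}"
  have L: "0 \<le> ln (C1 / \<beta>)" using assms by (intro ln_ge_zero) (simp add: field_simps)
  have "\<beta> = C1 * exp (- ln (C1 / \<beta>))" using assms by (simp add: exp_minus)
  also have "\<dots> \<le> C1 * exp (- k * ln (C1 / \<beta>) + (1 - k) / sqrt 3 * (C2 / (2 - p)) powr (1 / p))"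
  proof (intro mult_left_mono, subst exp_le_cancel_iff)
    have "k * ln (C1 / \<beta>) \<le> 1 * ln (C1 / \<beta>)" using k L by (intro mult_right_mono) auto
    moreover have "0 \<le> (1 - k) / sqrt 3 * (C2 / (2 - p)) powr (1 / p)" using k by simp
    ultimately show "- ln (C1 / \<beta>) \<le> - k * ln (C1 / \<beta>) + (1 - k) / sqrt 3 * (C2 / (2 - p)) powr (1 / p)"
      by simp
  qed (use assms in auto)
  finally show "\<beta> \<le> C1 * exp (- k * ln (C1 / \<beta>) + (1 - k) / sqrt 3 * (C2 / (2 - p)) powr (1 / p))
        + 2 * exp (- real N * min (C3 * (1 - k\<^sup>2)\<^sup>2 * v\<^sup>2) (C4 * (1 - k\<^sup>2) * v))"
    by (simp add: add_increasing2)
qed auto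

text \<open>At \<open>v = 0\<close> the second summand equals 2 for every \<open>k\<close>.\<close>

lemma level_zero_variance: "0 \<le> C1 \<Longrightarrow> 1 \<le> level C1 C2 C3 C4 p \<beta> N 0"
  unfolding level_def by (rule cINF_greatest) (auto simp: add_increasing)

text \<open>\<open>R\<close> is the radius divided by \<open>24 * sqrt (v / N)\<close>. The first
  claim makes the deterministic part of the transport cost negligible; it holds because
  \<open>24 powr p \<le> 576\<close> and \<open>c powr p = 10 ^ 14\<close>. The second makes the
  exponential tail at most \<open>exp (- L)\<close>: with \<open>y\<close> as in
  \<open>ecdf_moment_tail\<close>, half of \<open>y / 96\<close> covers \<open>1 / (2 - p)\<close>
  and the other half covers \<open>L\<close>.\<close>

lemma threshold_bounds:
  fixes p L :: real
  assumes p: "1 \<le> p" "p < 2" and L: "0 \<le> L"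
  defines "R \<equiv> (sqrt 3 * L + (C2_const / (2 - p)) powr (1 / p)) / 24" and "c \<equiv> (10 ^ 14) powr (1 / p)"
  shows "2048 * c powr p / (2 - p) \<le> R powr p"
    and "1 / (2 - p) - c powr (2 - p) * R powr p / 2048 / 96 \<le> - L"
proof -
  define A where "A = (C2_const / (2 - p)) powr (1 / p)"
  have A: "0 \<le> A" by (simp add: A_def)
  have sL: "L \<le> sqrt 3 * L" using L mult_right_mono[of 1 "sqrt 3" L] by simp
  have cp: "c powr p = 10 ^ 14" using p by (simp add: c_def powr_powr)
  have c7: "10 ^ 7 \<le> c"
  proof -
    have "(10 ^ 14 :: real) powr (1/2) \<le> c" unfolding c_def using p by (intro powr_mono) (auto simp: field_simps)
    moreover have "(10 ^ 14 :: real) powr (1/2) = 10 ^ 7"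
      by (simp add: powr_half_sqrt real_sqrt_unique)
    ultimately show ?thesis by simp
  qed
  have RA: "A / 24 \<le> R" "L / 24 \<le> R" using A sL L by (auto simp: R_def A_def[symmetric] add_increasing)
  have "2048 * c powr p / (2 - p) = C2_const / (2 - p) / 24 powr 2"
    using p by (simp add: cp C2_const_def field_simps)
  also have "\<dots> \<le> C2_const / (2 - p) / 24 powr p"
    using p by (intro divide_left_mono powr_mono mult_pos_pos) (auto simp: C2_const_def)
  also have "\<dots> = (A / 24) powr p"
  proof -
    have "A powr p = (C2_const / (2 - p)) powr (1 / p * p)" unfolding A_def by (rule powr_powr)
    also have "1 / p * p = 1" using p by simp
    also have "(C2_const / (2 - p)) powr 1 = C2_const / (2 - p)"
      using p by (subst powr_one) (auto simp: C2_const_def)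
    finally show ?thesis using A by (simp add: powr_divide)
  qed
  finally have A24: "2048 * c powr p / (2 - p) \<le> (A / 24) powr p" .
  also have "(A / 24) powr p \<le> R powr p" using RA A p by (intro powr_mono2) auto
  finally show R1: "2048 * c powr p / (2 - p) \<le> R powr p" .
  have "c \<le> A / 24"
  proof (rule ccontr)
    assume "\<not> c \<le> A / 24"
    then have "(A / 24) powr p < c powr p" using A p by (intro powr_less_mono2) auto
    moreover have "c powr p \<le> 2048 * c powr p / (2 - p)" using p by (simp add: field_simps cp)
    ultimately show False using A24 by linarith
  qed
  then have cR: "c \<le> R" using RA by linarith
  define y where "y = c powr (2 - p) * R powr p / 2048"
  have y1: "192 / (2 - p) \<le> y"
  proof -
    have "1 \<le> c powr (2 - p)" using c7 p by (intro ge_one_powr_ge_zero) auto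
    then have "1 * (2048 * c powr p / (2 - p)) \<le> c powr (2 - p) * R powr p"
      using R1 p by (intro mult_mono) auto
    then have "c powr p / (2 - p) \<le> y" by (simp add: y_def mult.commute)
    moreover have "192 / (2 - p) \<le> c powr p / (2 - p)" using p by (intro divide_right_mono) (auto simp: cp)
    ultimately show ?thesis by linarith
  qed
  \<comment> \<open>Bounding \<open>R powr p\<close> below by \<open>c powr (p - 1) * L / 24\<close>
    keeps the exponent linear in \<open>L\<close> for all \<open>p\<close>. The step needs
    \<open>c \<ge> 192 * 24 * 2048 = 9437184\<close>; as \<open>c \<ge> 10 ^ 7\<close>, this is
    where \<open>10 ^ 14\<close> comes from.\<close>
  have y2: "192 * L \<le> y"
  proof -
    have "c * (L / 24) = c powr (2 - p) * (c powr (p - 1) * (L / 24))"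
      using c7 by (simp flip: powr_add mult.assoc)
    also have "\<dots> \<le> c powr (2 - p) * (R powr (p - 1) * R)"
      using c7 cR RA p L by (intro mult_left_mono mult_mono powr_mono2) auto
    also have "R powr (p - 1) * R = R powr p"
      using cR c7 by (simp add: powr_diff)
    finally have "c * L / 49152 \<le> y" by (simp add: y_def mult_ac)
    moreover have "192 * L \<le> c * L / 49152" using c7 L mult_right_mono[of "192 * 49152" c L] by simp
    ultimately show ?thesis by linarith
  qed
  show "1 / (2 - p) - c powr (2 - p) * R powr p / 2048 / 96 \<le> - L"
    using y1 y2 unfolding y_def by linarith
qed

context bounded_log_concave
begin

theorem empirical_tail:
  fixes X :: "nat \<Rightarrow> 'b \<Rightarrow> real" and P :: "'b measure"
  assumes P: "prob_space P" and N: "1 < N" and ind: "prob_space.indep_vars P (\<lambda>_. borel) X {1..N}"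
    and law: "\<And>i. i \<in> {1..N} \<Longrightarrow> distr P borel (X i) = M"
    and p: "1 \<le> p" "p < 2" and \<beta>: "0 < \<beta>" "\<beta> < 1"
  defines "y \<equiv> ((10 ^ 14) powr (1 / p)) powr (2 - p) *
      (((sqrt 3 * ln (8 / \<beta>) + (C2_const / (2 - p)) powr (1 / p)) / 24) powr p) / 2048"
    and "sv \<equiv> \<lambda>\<omega>. sample_variance N (\<lambda>i. X i \<omega>)"
  shows "measure P {\<omega>\<in>space P. radius 8 C2_const p \<beta> N (sv \<omega>)
        \<le> wasserstein p (empirical_distribution N (\<lambda>i. X i \<omega>)) M}
    \<le> \<beta> / 4 + 2 * (((1/2) ^ Suc J) powr (1 - p / 2) / ((1 - p / 2) * y)) + 2 * (2 ^ Suc J / real N)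
      + (4 + 4 * (\<integral>y. ((y - expectation (\<lambda>x. x))\<^sup>2 - variance (\<lambda>x. x))\<^sup>2 \<partial>M) / (variance (\<lambda>x. x))\<^sup>2) / real N"
proof -
  let ?bad = "{\<omega>\<in>space P. radius 8 C2_const p \<beta> N (sv \<omega>)
        \<le> wasserstein p (empirical_distribution N (\<lambda>i. X i \<omega>)) M}"
  interpret P: prob_space P by (rule P)
  have X [measurable]: "X i \<in> borel_measurable P" if "i \<in> {1..N}" for i
    using ind that unfolding P.indep_vars_def by auto
  define U where "U i \<omega> = cdf M (X i \<omega>)" for i \<omega>
  have pr: "P.prob {\<omega>\<in>space P. X i \<omega> \<in> A} = prob A" if "i \<in> {1..N}" "A \<in> sets borel" for i A
    using that unfolding law[OF that(1), symmetric]
    by (subst measure_distr) (auto intro!: arg_cong[of _ _ "measure P"])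
  interpret U: uniform_sample P U N
  proof
    show "0 < N" using N by simp
    show "P.indep_vars (\<lambda>_. borel) U {1..N}"
      unfolding U_def[abs_def] by (rule P.indep_vars_compose2[OF ind, of "\<lambda>_. cdf M"]) measurable
    fix i and s :: real assume i: "i \<in> {1..N}" and s: "0 \<le> s" "s \<le> 1"
    have "P.prob {\<omega>\<in>space P. X i \<omega> \<in> {x. cdf M x \<le> s}} = prob {x. cdf M x \<le> s}"
      by (rule pr[OF i]) measurable
    then show "P.prob {\<omega>\<in>space P. U i \<omega> \<le> s} = s" using prob_cdf_le[OF s] by (simp add: U_def)
  qed
  define L where "L = ln (8 / \<beta>)"
  define A where "A = (C2_const / (2 - p)) powr (1 / p)"
  define c :: real where "c = (10 ^ 14) powr (1 / p)"
  define R where "R = (sqrt 3 * L + A) / 24"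
  have L: "0 < L" using \<beta> by (simp add: L_def field_simps)
  have A: "0 < A" using p by (simp add: A_def C2_const_def)
  have R: "0 < R" using L A by (simp add: R_def add_pos_pos)
  have c: "0 < c" by (simp add: c_def)
  have y: "y = c powr (2 - p) * R powr p / 2048" by (simp add: y_def c_def R_def L_def A_def)
  note thr = threshold_bounds[OF p less_imp_le[OF L], folded A_def c_def, folded R_def]
  define E2 where "E2 = {\<omega>\<in>space P. ennreal (R powr p) \<le> 64 * U.ecdf_moment p \<omega>}"
  define E1 where "E1 = {\<omega>\<in>space P. sv \<omega> < variance (\<lambda>x. x) / 4}"
  define S where "S = {\<omega>\<in>space P. \<exists>i\<in>{1..N}. \<not> (0 < cdf M (X i \<omega>) \<and> cdf M (X i \<omega>) < 1)}"
  have [measurable]: "E2 \<in> sets P" unfolding E2_def by measurable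
  have [measurable]: "E1 \<in> sets P" unfolding E1_def sv_def sample_variance_def by measurable
  have [measurable]: "S \<in> sets P" unfolding S_def by measurable
  have "AE \<omega> in P. 0 < cdf M (X i \<omega>) \<and> cdf M (X i \<omega>) < 1" if i: "i \<in> {1..N}" for i
  proof -
    have "AE x in distr P borel (X i). 0 < cdf M x \<and> cdf M x < 1" unfolding law[OF i] by (rule AE_cdf)
    then show ?thesis using X[OF i] by (subst (asm) AE_distr_iff) auto
  qed
  then have "AE \<omega> in P. \<omega> \<notin> S" by (auto simp: S_def AE_finite_all intro!: AE_ball_countable'[of "{1..N}"])
  then have "emeasure P S = 0" by (subst (asm) AE_iff_measurable[OF \<open>S \<in> sets P\<close>]) (auto simp: S_def)
  then have PS: "P.prob S = 0" by (simp add: measure_def)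
  have "P.prob E2 \<le> 2 * (((1/2) ^ Suc J) powr (1 - p / 2) / ((1 - p / 2) * y) + 2 ^ Suc J / real N + exp (1 / (2 - p) - y / 96))"
    unfolding E2_def y by (rule U.ecdf_moment_tail[OF p c thr(1)])
  moreover have e8: "exp (1 / (2 - p) - y / 96) \<le> \<beta> / 8"
  proof -
    have "exp (1 / (2 - p) - y / 96) \<le> exp (- L)" using thr(2) by (simp add: y)
    also have "\<dots> = \<beta> / 8" using \<beta> by (simp add: L_def exp_minus)
    finally show ?thesis .
  qed
  moreover have "q \<le> 2 * (s + t + r) \<Longrightarrow> r \<le> \<beta> / 8 \<Longrightarrow> q \<le> \<beta> / 4 + 2 * s + 2 * t" for q r s t :: real
    by (simp add: distrib_left)
  ultimately have PE2: "P.prob E2 \<le> \<beta> / 4 + 2 * (((1/2) ^ Suc J) powr (1 - p / 2) / ((1 - p / 2) * y)) + 2 * (2 ^ Suc J / real N)"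
    by blast
  have PE1: "P.prob E1 \<le> (4 + 4 * (\<integral>y. ((y - expectation (\<lambda>x. x))\<^sup>2 - variance (\<lambda>x. x))\<^sup>2 \<partial>M) / (variance (\<lambda>x. x))\<^sup>2) / real N"
    unfolding E1_def sv_def by (rule P.sample_variance_small[OF N ind law bounded refl refl variance_pos])
  have "\<omega> \<in> S \<union> E1 \<union> E2" if \<omega>: "\<omega> \<in> space P"
      and W: "radius 8 C2_const p \<beta> N (sv \<omega>) \<le> wasserstein p (empirical_distribution N (\<lambda>i. X i \<omega>)) M" for \<omega>
  proof (rule ccontr)
    assume "\<omega> \<notin> S \<union> E1 \<union> E2"
    then have x: "\<And>i. i \<in> {1..N} \<Longrightarrow> 0 < cdf M (X i \<omega>) \<and> cdf M (X i \<omega>) < 1"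
      and s: "variance (\<lambda>x. x) / 4 \<le> sv \<omega>" and nE2: "\<omega> \<notin> E2" using \<omega> by (auto simp: S_def E1_def)
    let ?I = "\<integral>\<^sup>+ s. indicator {0<..<1} s * ennreal ((\<bar>U.ecdf s \<omega> - s\<bar> / (s * (1 - s))) powr p) \<partial>lborel"
    let ?k = "ennreal (sqrt (real N) powr p / (12 * \<sigma>) powr p)"
    have N0: "0 < sqrt (real N)" using N by simp
    \<comment> \<open>A lower bound for the radius once the sample variance is at least a quarter of
      the true one: \<open>\<sigma> / 2\<close> times \<open>24 * R\<close>. In the transport bound
      \<open>12 * \<sigma>\<close> then cancels and a statement about the uniform sample alone
      remains, which contradicts \<open>\<omega> \<notin> E2\<close>.\<close>
    define \<rho> where "\<rho> = 12 * \<sigma> * R / sqrt (real N)"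
    have \<rho>: "0 < \<rho>" using \<sigma>_pos R N0 by (simp add: \<rho>_def)
    have "\<sigma> / 2 / sqrt (real N) = sqrt (variance (\<lambda>x. x) / 4 / real N)"
      by (simp add: \<sigma>_def real_sqrt_divide real_sqrt_mult)
    also have "\<dots> \<le> sqrt (sv \<omega> / real N)" using s by (intro real_sqrt_le_mono divide_right_mono) auto
    finally have q: "\<sigma> / 2 / sqrt (real N) \<le> sqrt (sv \<omega> / real N)" .
    have "\<rho> = \<sigma> / 2 / sqrt (real N) * (sqrt 3 * L + A)" by (simp add: \<rho>_def R_def)
    also have "\<dots> \<le> sqrt (sv \<omega> / real N) * (sqrt 3 * L + A)"
      using q L A by (intro mult_right_mono) auto
    also have "\<dots> = radius 8 C2_const p \<beta> N (sv \<omega>)"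
      by (simp add: radius_def L_def A_def real_sqrt_mult real_sqrt_divide algebra_simps)
    finally have "\<rho> \<le> wasserstein p (empirical_distribution N (\<lambda>i. X i \<omega>)) M" using W by linarith
    then have "ennreal (\<rho> powr p) \<le> ennreal ((12 * \<sigma>) powr p) *
      (64 * ?I)"
      unfolding U_def using p x N \<rho> by (intro wasserstein_empirical_le) auto
    then have "?k * ennreal (\<rho> powr p)
      \<le> ?k * (ennreal ((12 * \<sigma>) powr p) *
      (64 * ?I))"
      by (rule mult_left_mono) simp
    also have "\<dots> = 64 * (ennreal (sqrt (real N) powr p) * ?I)"
    proof -
      have "?k * ennreal ((12 * \<sigma>) powr p) = ennreal (sqrt (real N) powr p)"
        using \<sigma>_pos by (subst ennreal_mult'[symmetric]) auto
      then show ?thesis by (simp only: mult.assoc[symmetric]) (simp only: mult.commute mult.left_commute)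
    qed
    also have "ennreal (sqrt (real N) powr p) * ?I
      = U.ecdf_moment p \<omega>"
    proof -
      have [measurable]: "(\<lambda>s. U.ecdf s \<omega>) \<in> borel_measurable borel" using \<omega> by measurable
      have "ennreal (sqrt (real N) powr p) * (indicator {0<..<1} s * ennreal ((\<bar>U.ecdf s \<omega> - s\<bar> / (s * (1 - s))) powr p))
        = indicator {0<..<1} s * ennreal ((sqrt (real N) * (\<bar>U.ecdf s \<omega> - s\<bar> / (s * (1 - s)))) powr p)" for s
      proof (cases "s \<in> {0<..<1}")
        case True
        then have "0 \<le> \<bar>U.ecdf s \<omega> - s\<bar> / (s * (1 - s))" by simp
        moreover have "ennreal (sqrt (real N) powr p) * ennreal (z powr p) = ennreal ((sqrt (real N) * z) powr p)" if "0 \<le> z" for z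
          using that by (simp add: powr_mult ennreal_mult')
        ultimately show ?thesis using True by (simp only: indicator_simps) simp
      qed simp
      then show ?thesis unfolding U.ecdf_moment_def by (subst nn_integral_cmult[symmetric]) auto
    qed
    also have "?k * ennreal (\<rho> powr p) = ennreal (R powr p)"
    proof -
      have "sqrt (real N) powr p / (12 * \<sigma>) powr p * \<rho> powr p = (sqrt (real N) / (12 * \<sigma>) * \<rho>) powr p"
        using \<sigma>_pos \<rho> by (simp add: powr_mult powr_divide)
      also have "sqrt (real N) / (12 * \<sigma>) * \<rho> = R" using \<sigma>_pos N0 by (simp add: \<rho>_def)
      finally show ?thesis by (subst ennreal_mult'[symmetric]) auto
    qed
    finally show False using nE2 \<omega> by (simp add: E2_def)
  qed
  then have "?bad \<subseteq> S \<union> E1 \<union> E2" by blast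
  then have "measure P ?bad \<le> P.prob (S \<union> E1 \<union> E2)"
    by (intro P.finite_measure_mono) auto
  also have "\<dots> \<le> P.prob S + P.prob E1 + P.prob E2"
    using measure_Un_le[of "S \<union> E1" P E2] measure_Un_le[of S P E1] by simp
  finally show ?thesis using PS PE1 PE2 by linarith
qed

text \<open>The order of the choices matters: \<open>J\<close> is fixed first to make the ends of
  the unit interval small, because the bound \<open>2 ^ Suc J / N\<close> for the capped counts
  vanishes only when \<open>N\<close> grows with \<open>J\<close> fixed.\<close>

corollary eventually_empirical_tail:
  assumes p: "1 \<le> p" "p < 2" and \<beta>: "0 < \<beta>" "\<beta> < 1" and P: "prob_space P"
  shows "\<forall>\<^sub>F N in sequentially. \<forall>X. prob_space.indep_vars P (\<lambda>_. borel) X {1..N} \<longrightarrow>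
     (\<forall>i\<in>{1..N}. distr P borel (X i) = M) \<longrightarrow>
     measure P {\<omega>\<in>space P. radius 8 C2_const p \<beta> N (sample_variance N (\<lambda>i. X i \<omega>))
        \<le> wasserstein p (empirical_distribution N (\<lambda>i. X i \<omega>)) M} \<le> \<beta>"
proof -
  let ?d = "\<lambda>J. ((1/2) ^ Suc J) powr (1 - p / 2)"
  let ?ok = "\<lambda>N X. measure P {\<omega>\<in>space P. radius 8 C2_const p \<beta> N (sample_variance N (\<lambda>i. X i \<omega>))
        \<le> wasserstein p (empirical_distribution N (\<lambda>i. X i \<omega>)) M} \<le> \<beta>"
  define y where "y = ((10 ^ 14) powr (1 / p)) powr (2 - p) *
      (((sqrt 3 * ln (8 / \<beta>) + (C2_const / (2 - p)) powr (1 / p)) / 24) powr p) / 2048"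
  define V where "V = (4 + 4 * (\<integral>y. ((y - expectation (\<lambda>x. x))\<^sup>2 - variance (\<lambda>x. x))\<^sup>2 \<partial>M) / (variance (\<lambda>x. x))\<^sup>2)"
  have "(\<lambda>J. ?d J) \<longlonglongrightarrow> 0 powr (1 - p / 2)"
  proof (rule tendsto_powr2[OF _ tendsto_const])
    show "(\<lambda>J. (1/2) ^ Suc J) \<longlonglongrightarrow> (0 :: real)"
      by (rule LIMSEQ_Suc, rule LIMSEQ_power_zero) simp
  qed (use p in auto)
  then have "(\<lambda>J. ?d J * (2 / ((1 - p / 2) * y))) \<longlonglongrightarrow> 0 powr (1 - p / 2) * (2 / ((1 - p / 2) * y))"
    by (rule tendsto_mult_right)
  then have "\<forall>\<^sub>F J in sequentially. ?d J * (2 / ((1 - p / 2) * y)) < \<beta> / 4"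
    by (rule order_tendstoD(2)) (use \<beta> in simp)
  moreover have "z * (2 / k) = 2 * (z / k)" for z k :: real by simp
  ultimately have "\<forall>\<^sub>F J in sequentially. 2 * (?d J / ((1 - p / 2) * y)) < \<beta> / 4"
    by (simp only:)
  then obtain J where J: "2 * (?d J / ((1 - p / 2) * y)) < \<beta> / 4"
    using eventually_happens'[OF sequentially_bot] by blast
  have "(\<lambda>N. 2 * (2 ^ Suc J / real N) + V / real N) \<longlonglongrightarrow> 2 * 0 + 0"
    by (intro tendsto_intros lim_const_over_n)
  then have "\<forall>\<^sub>F N in sequentially. 2 * (2 ^ Suc J / real N) + V / real N < \<beta> / 4"
    by (rule order_tendstoD(2)) (use \<beta> in simp)
  moreover have "\<forall>\<^sub>F N in sequentially. 1 < (N :: nat)" by (rule eventually_gt_at_top)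
  ultimately show ?thesis
  proof eventually_elim
    fix N :: nat assume N: "2 * (2 ^ Suc J / real N) + V / real N < \<beta> / 4" "1 < N"
    show "\<forall>X. prob_space.indep_vars P (\<lambda>_. borel) X {1..N} \<longrightarrow>
     (\<forall>i\<in>{1..N}. distr P borel (X i) = M) \<longrightarrow>
     ?ok N X"
    proof (intro allI impI)
      fix X assume X: "prob_space.indep_vars P (\<lambda>_. borel) X {1..N}" "\<forall>i\<in>{1..N}. distr P borel (X i) = M"
      note empirical_tail[OF P N(2) X(1) X(2)[rule_format] p \<beta>, of J, folded y_def V_def]
      then show "?ok N X"
        using N(1) J \<beta> by linarith
    qed
  qed
qed

end

lemma weighted_output_tail:
  fixes M :: "'s measure" and \<xi> :: "'s \<Rightarrow> real ^ 'w" and x :: "nat ^ 'w"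
  assumes M: "prob_space M" and \<xi> [measurable]: "\<xi> \<in> borel_measurable M"
    and B: "AE \<omega> in M. norm (\<xi> \<omega>) \<le> B" and lc: "log_concave_measure (distr M borel \<xi>)"
    and p: "1 \<le> p" "p < 2" and \<beta>: "0 < \<beta>" "\<beta> < 1"
  shows "\<forall>\<^sub>F N in sequentially. \<forall>\<xi>hat. iid_samples M \<xi> N \<xi>hat \<longrightarrow>
    measure M {\<omega> \<in> space M.
       wasserstein p (empirical_distribution N (\<lambda>i. weighted_output a x (\<xi>hat i \<omega>)))
         (distr M borel (\<lambda>\<omega>'. weighted_output a x (\<xi> \<omega>')))
       \<ge> radius 8 C2_const p \<beta> N
            (quad_form (sample_covariance_matrix N (\<lambda>i. \<xi>hat i \<omega>)) (weighted_decision a x))}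
    \<le> level 8 C2_const 1 1 p \<beta> N (quad_form (covariance_matrix M \<xi>) (weighted_decision a x))"
proof -
  interpret M: prob_space M by fact
  define u where "u = weighted_decision a x"
  define v where "v = quad_form (covariance_matrix M \<xi>) u"
  define \<mu> where "\<mu> = distr M borel (\<lambda>\<omega>'. u \<bullet> \<xi> \<omega>')"
  define bad where "bad N X = {\<omega>\<in>space M. radius 8 C2_const p \<beta> N (sample_variance N (\<lambda>i. X i \<omega>))
    \<le> wasserstein p (empirical_distribution N (\<lambda>i. X i \<omega>)) \<mu>}" for N X
  have v: "v = (\<integral>\<omega>. (u \<bullet> \<xi> \<omega> - (\<integral>\<omega>'. u \<bullet> \<xi> \<omega>' \<partial>M))\<^sup>2 \<partial>M)"
    unfolding v_def by (rule quad_form_covariance[OF M \<xi> B])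
  then have v0: "0 \<le> v" by simp
  have "\<forall>\<^sub>F N in sequentially. \<forall>\<xi>hat. iid_samples M \<xi> N \<xi>hat \<longrightarrow>
    measure M (bad N (\<lambda>i \<omega>. u \<bullet> \<xi>hat i \<omega>)) \<le> level 8 C2_const 1 1 p \<beta> N v"
  proof (cases "v = 0")
    case True
    then show ?thesis
      by (intro always_eventually allI impI order_trans[OF M.prob_le_1]) (simp add: level_zero_variance)
  next
    case False
    have \<mu>: "\<mu> = distr (distr M borel \<xi>) borel (\<lambda>z. u \<bullet> z)"
      unfolding \<mu>_def by (subst distr_distr) (auto simp: comp_def)
    interpret \<mu>: bounded_log_concave \<mu> "norm u * B"
    proof (intro bounded_log_concave.intro bounded_log_concave_axioms.intro)
      show "real_distribution \<mu>" unfolding \<mu>_def by (rule M.real_distribution_distr) measurable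
      have "AE z in distr M borel \<xi>. norm z \<le> B" using B by (subst AE_distr_iff) auto
      then show "log_concave_measure \<mu>"
        unfolding \<mu> by (intro log_concave_inner[OF M.prob_space_distr[OF \<xi>] lc])
      have "AE \<omega> in M. \<bar>u \<bullet> \<xi> \<omega>\<bar> \<le> norm u * B"
        using B
      proof eventually_elim
        fix \<omega> assume "norm (\<xi> \<omega>) \<le> B"
        then have "norm u * norm (\<xi> \<omega>) \<le> norm u * B" by (intro mult_left_mono) auto
        then show "\<bar>u \<bullet> \<xi> \<omega>\<bar> \<le> norm u * B" using Cauchy_Schwarz_ineq2[of u "\<xi> \<omega>"] by linarith
      qed
      then show "AE x in \<mu>. \<bar>x\<bar> \<le> norm u * B" unfolding \<mu>_def by (subst AE_distr_iff) auto
      have "v = (\<integral>x. (x - (\<integral>x. x \<partial>\<mu>))\<^sup>2 \<partial>\<mu>)" unfolding v \<mu>_def by (simp add: integral_distr)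
      moreover have "0 < v" using False v0 by simp
      ultimately show "0 < (\<integral>x. (x - (\<integral>x. x \<partial>\<mu>))\<^sup>2 \<partial>\<mu>)" by (simp only:)
    qed
    have "\<forall>\<^sub>F N in sequentially. \<forall>X. M.indep_vars (\<lambda>_. borel) X {1..N} \<longrightarrow>
       (\<forall>i\<in>{1..N}. distr M borel (X i) = \<mu>) \<longrightarrow> measure M (bad N X) \<le> \<beta>"
      unfolding bad_def by (rule \<mu>.eventually_empirical_tail[OF p \<beta> M])
    then show ?thesis
    proof (rule eventually_mono, intro allI impI)
      fix N and \<xi>hat :: "nat \<Rightarrow> 's \<Rightarrow> real ^ 'w"
      assume tail: "\<forall>X. M.indep_vars (\<lambda>_. borel) X {1..N} \<longrightarrow>
         (\<forall>i\<in>{1..N}. distr M borel (X i) = \<mu>) \<longrightarrow> measure M (bad N X) \<le> \<beta>"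
        and iid: "iid_samples M \<xi> N \<xi>hat"
      have ind: "M.indep_vars (\<lambda>_. borel) \<xi>hat {1..N}" using iid by (simp add: iid_samples_def)
      have indX: "M.indep_vars (\<lambda>_. borel) (\<lambda>i \<omega>. u \<bullet> \<xi>hat i \<omega>) {1..N}"
        by (rule M.indep_vars_compose2[OF ind, of "\<lambda>_ z. u \<bullet> z"]) measurable
      have lawX: "distr M borel (\<lambda>\<omega>. u \<bullet> \<xi>hat i \<omega>) = \<mu>" if i: "i \<in> {1..N}" for i
      proof -
        have [measurable]: "\<xi>hat i \<in> borel_measurable M" using ind i unfolding M.indep_vars_def by auto
        have "distr M borel (\<lambda>\<omega>. u \<bullet> \<xi>hat i \<omega>) = distr (distr M borel (\<xi>hat i)) borel (\<lambda>z. u \<bullet> z)"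
          by (subst distr_distr) (auto simp: comp_def)
        also have "distr M borel (\<xi>hat i) = distr M borel \<xi>" using iid i by (simp add: iid_samples_def)
        finally show ?thesis by (simp add: \<mu>)
      qed
      have "\<beta> \<le> level 8 C2_const 1 1 p \<beta> N v" using p \<beta> by (intro level_ge) (auto simp: C2_const_def)
      then show "measure M (bad N (\<lambda>i \<omega>. u \<bullet> \<xi>hat i \<omega>)) \<le> level 8 C2_const 1 1 p \<beta> N v"
        using indX lawX by (intro order_trans[OF tail[rule_format]]) auto
    qed
  qed
  then show ?thesis
    unfolding bad_def \<mu>_def v_def u_def weighted_output_eq quad_form_sample_covariance .
qed

theorem theorem2:
  shows "\<exists>C1>0. \<exists>C2>0.
    \<forall>(M :: 's measure) (\<xi> :: 's \<Rightarrow> real ^ 'w) (a :: real ^ 'w).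
      prob_space M \<and> \<xi> \<in> borel_measurable M \<and>
      (\<exists>B. AE \<omega> in M. norm (\<xi> \<omega>) \<le> B) \<and>
      log_concave_measure (distr M borel \<xi>) \<longrightarrow>
      (\<exists>C3>0. \<exists>C4>0. \<forall>(p :: real) (x :: nat ^ 'w) (\<beta> :: real).
         1 \<le> p \<and> p < 2 \<and> 0 < \<beta> \<and> \<beta> < 1 \<longrightarrow>
         (\<forall>\<^sub>F N in sequentially. \<forall>\<xi>hat. iid_samples M \<xi> N \<xi>hat \<longrightarrow>
            measure M {\<omega> \<in> space M.
               wasserstein p
                 (empirical_distribution N (\<lambda>i. weighted_output a x (\<xi>hat i \<omega>)))
                 (distr M borel (\<lambda>\<omega>'. weighted_output a x (\<xi> \<omega>')))
               \<ge> radius C1 C2 p \<beta> N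
                    (quad_form (sample_covariance_matrix N (\<lambda>i. \<xi>hat i \<omega>))
                       (weighted_decision a x))}
            \<le> level C1 C2 C3 C4 p \<beta> N
                 (quad_form (covariance_matrix M \<xi>) (weighted_decision a x))))"
\<comment> \<open>All four witnesses are independent of the law. \<open>C1 = 8\<close> and
  \<open>C2_const\<close> are dictated by \<open>threshold_bounds\<close> and the error budget,
  while the lower bound \<open>level_ge\<close> holds for every choice of \<open>C3\<close> and
  \<open>C4\<close>, so both are 1.\<close>
proof (rule exI[of _ 8], rule conjI, simp, rule exI[of _ C2_const], rule conjI, simp add: C2_const_def,
    intro allI impI exI[of _ "1::real"] conjI)
qed (auto intro: weighted_output_tail)

end
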